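(* Let $\mathsf{C}_1\subset V_1$ and $\mathsf{C}_2\subset V_2$ be non-classical proper cones. For any $k\in\mathbb{N}$, there exists a linear map $P:V_1\to V_2$ such that: (1) $P^{\otimes k}(\mathsf{C}_1^{\otimes_{\max}k})\subseteq\mathsf{C}_2^{\otimes_{\min}k}$; (2) the map $P$ is not $(\mathsf{C}_1,\mathsf{C}_2)$-entanglement breaking.
   Context: All vector spaces are finite-dimensional and real. A convex cone $\mathsf{C}\subset V$ is proper if it is closed, $\mathsf{C}-\mathsf{C}=V$ and $\mathsf{C}\cap(-\mathsf{C})=\{0\}$. It is classical if it is linearly isomorphic to $\mathbb{R}_+^n$ for some $n\in\mathbb{N}$. The dual cone is $\mathsf{C}^*=\{\phi\in V^*:\phi(x)\ge0\ \forall x\in\mathsf{C}\}$. Let $\mathsf{C}_1\otimes_{\min}\mathsf{C}_2=\mathrm{conv}\{x\otimes y: x\in\mathsf{C}_1,y\in\mathsf{C}_2\}$ and $\mathsf{C}_1\otimes_{\max}\mathsf{C}_2=(\mathsf{C}_1^*\otimes_{\min}\mathsf{C}_2^* )^*\subset V_1\otimes V_2$. Powers: $\mathsf{C}^{\otimes_{\min}1}=\mathsf{C}^{\otimes_{\max}1}=\mathsf{C}$, $\mathsf{C}^{\otimes_{\min}(k+1)}=\mathsf{C}\otimes_{\min}\mathsf{C}^{\otimes_{\min}k}$, $\mathsf{C}^{\otimes_{\max}(k+1)}=\mathsf{C}\otimes_{\max}\mathsf{C}^{\otimes_{\max}k}$. A linear map $P:V_1\to V_2$ is $(\mathsf{C}_1,\mathsf{C}_2)$-entanglement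 breaking if it is a finite sum $P=\sum_i x_i\phi_i$ with $x_i\in\mathsf{C}_2$ and $\phi_i\in\mathsf{C}_1^*$. *)

theory Defs
  imports "HOL-Analysis.Analysis" "HOL-Analysis.Finite_Function_Topology"
begin

section \<open>Cones\<close>

definition proper_cone :: "'v::real_normed_vector set \<Rightarrow> bool" where
  "proper_cone C \<longleftrightarrow> convex_cone C \<and> closed C \<and> {x - y | x y. x \<in> C \<and> y \<in> C} = UNIV
     \<and> C \<inter> uminus ` C = {0}"

text \<open>The model of \<open>\<real>\<^sup>n\<close> is the set of extensional functions \<^term>\<open>{..<n::nat} \<rightarrow>\<^sub>E (UNIV :: real set)\<close>;
  a linear map into it is a family of \<open>n\<close> linear coordinate functions.\<close>

definition classical_cone :: "'v::real_vector set \<Rightarrow> bool" where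
  "classical_cone C \<longleftrightarrow>
     (\<exists>(n::nat) (f :: nat \<Rightarrow> 'v \<Rightarrow> real).
        (\<forall>i<n. linear (f i))
        \<and> bij_betw (\<lambda>x. \<lambda>i\<in>{..<n}. f i x) UNIV ({..<n} \<rightarrow>\<^sub>E UNIV)
        \<and> (\<lambda>x. \<lambda>i\<in>{..<n}. f i x) ` C = ({..<n} \<rightarrow>\<^sub>E {0..}))"

text \<open>On a finite-dimensional space every linear functional is bounded, so there the type of
  bounded functionals is the full algebraic dual.\<close>

definition dual_cone :: "'v::real_normed_vector set \<Rightarrow> ('v \<Rightarrow>\<^sub>L real) set" where
  "dual_cone C = {\<phi>. \<forall>x\<in>C. 0 \<le> blinfun_apply \<phi> x}"

definition entanglement_breaking ::
  "'a::real_normed_vector set \<Rightarrow> 'b::real_normed_vector set \<Rightarrow> ('a \<Rightarrow> 'b) \<Rightarrow> bool" where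
  "entanglement_breaking C1 C2 P \<longleftrightarrow>
     (\<exists>(n::nat) (x :: nat \<Rightarrow> 'b) (\<phi> :: nat \<Rightarrow> ('a \<Rightarrow>\<^sub>L real)).
        (\<forall>i<n. x i \<in> C2 \<and> \<phi> i \<in> dual_cone C1)
        \<and> P = (\<lambda>v. \<Sum>i<n. blinfun_apply (\<phi> i) v *\<^sub>R x i))"

section \<open>Tensor powers\<close>

text \<open>
  The powers \<open>V\<^bsup>\<otimes>k\<^esup>\<close> of a space \<open>V\<close> (a type \<open>'a\<close> of class \<^class>\<open>euclidean_space\<close>) are realised
  inside one real vector space, that of finitely supported functions on words over \<open>'a\<close>.
  The word \<open>[b\<^sub>1, \<dots>, b\<^sub>k]\<close> of vectors of \<^const>\<open>Basis\<close> stands for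
  \<open>b\<^sub>1 \<otimes> \<dots> \<otimes> b\<^sub>k\<close>; so \<open>V\<^bsup>\<otimes>k\<^esup>\<close> is the space of functions supported on such words
  of length \<open>k\<close>. Words containing other letters exist in the type but carry no meaning.
  The inner product of \<open>V\<close> only serves to take coordinates with respect to \<^const>\<open>Basis\<close>.
\<close>

type_synonym 'a tensor = "'a list \<Rightarrow>\<^sub>0 real"

definition tensor_space :: "nat \<Rightarrow> 'a::euclidean_space tensor set" where
  "tensor_space k = {t. \<forall>w\<in>Poly_Mapping.keys t. length w = k \<and> set w \<subseteq> Basis}"

definition lin_extend :: "('a list \<Rightarrow> 'v::real_vector) \<Rightarrow> 'a tensor \<Rightarrow> 'v" where
  "lin_extend g t = (\<Sum>w\<in>Poly_Mapping.keys t. Poly_Mapping.lookup t w *\<^sub>R g w)"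

text \<open>The bilinear map \<open>(x, t) \<mapsto> x \<otimes> t\<close> from \<open>V \<times> V\<^bsup>\<otimes>k\<^esup>\<close> to \<open>V\<^bsup>\<otimes>(k+1)\<^esup>\<close>.\<close>

definition tensor_mult :: "'a::euclidean_space \<Rightarrow> 'a tensor \<Rightarrow> 'a tensor" where
  "tensor_mult x = lin_extend (\<lambda>w. \<Sum>b\<in>Basis. (x \<bullet> b) *\<^sub>R Poly_Mapping.single (b # w) 1)"

text \<open>\<open>elementary [x\<^sub>1, \<dots>, x\<^sub>k] = x\<^sub>1 \<otimes> \<dots> \<otimes> x\<^sub>k\<close>\<close>

primrec elementary :: "'a::euclidean_space list \<Rightarrow> 'a tensor" where
  "elementary [] = Poly_Mapping.single [] 1"
| "elementary (x # xs) = tensor_mult x (elementary xs)"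

text \<open>On \<^term>\<open>tensor_space k\<close>, \<open>tensor_map P\<close> is \<open>P\<^bsup>\<otimes>k\<^esup>\<close>; see \<open>tensor_map_elementary\<close> below.\<close>

definition tensor_map ::
  "('a::euclidean_space \<Rightarrow> 'b::euclidean_space) \<Rightarrow> 'a tensor \<Rightarrow> 'b tensor" where
  "tensor_map P = lin_extend (\<lambda>w. elementary (map P w))"

text \<open>The product functional \<open>\<phi> \<otimes> \<psi>\<close>, determined by \<open>(\<phi> \<otimes> \<psi>)(x \<otimes> t) = \<phi>(x) \<psi>(t)\<close>
  (\<open>dual_mult_tensor_mult\<close> below).\<close>

definition dual_mult ::
  "('a::euclidean_space \<Rightarrow>\<^sub>L real) \<Rightarrow> ('a tensor \<Rightarrow>\<^sub>L real) \<Rightarrow> ('a tensor \<Rightarrow>\<^sub>L real)" where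
  "dual_mult \<phi> \<psi> = Blinfun (lin_extend (\<lambda>w. case w of [] \<Rightarrow> 0
     | b # v \<Rightarrow> if b \<in> Basis
               then blinfun_apply \<phi> b * blinfun_apply \<psi> (Poly_Mapping.single v 1) else 0))"

section \<open>Minimal and maximal tensor products\<close>

text \<open>The first argument is the tensor multiplication: \<^const>\<open>tensor_mult\<close> for cones in \<open>V\<close> and
  \<open>V\<^bsup>\<otimes>k\<^esup>\<close>, \<^const>\<open>dual_mult\<close> for cones in their duals.\<close>

definition min_tensor :: "('u \<Rightarrow> 'v \<Rightarrow> 'w::real_vector) \<Rightarrow> 'u set \<Rightarrow> 'v set \<Rightarrow> 'w set" where
  "min_tensor prd C D = convex hull {prd x y | x y. x \<in> C \<and> y \<in> D}"

text \<open>The maximal tensor product of \<open>C \<subseteq> V\<close> and \<open>D \<subseteq> V\<^bsup>\<otimes>k\<^esup>\<close>. The outer dual cone is taken in the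
  bidual \<open>V\<^bsup>\<otimes>(k+1)\<^esup>\<close>. The functionals in \<^term>\<open>dual_cone D\<close> live on the ambient space of
  \<open>V\<^bsup>\<otimes>k\<^esup>\<close>; their restrictions are all functionals on \<open>V\<^bsup>\<otimes>k\<^esup>\<close> that are nonnegative on \<open>D\<close>,
  and on \<open>V\<^bsup>\<otimes>(k+1)\<^esup>\<close> the functional \<open>\<phi> \<otimes> \<psi>\<close> only depends on the restriction of \<open>\<psi>\<close>.\<close>

definition max_tensor ::
  "nat \<Rightarrow> 'a::euclidean_space set \<Rightarrow> 'a tensor set \<Rightarrow> 'a tensor set" where
  "max_tensor k C D =
     {t \<in> tensor_space (Suc k).
        \<forall>f \<in> min_tensor dual_mult (dual_cone C) (dual_cone D). 0 \<le> blinfun_apply f t}"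

text \<open>Powers start at exponent 1, where \<open>V\<^bsup>\<otimes>1\<^esup>\<close> is identified with \<open>V\<close> through
  \<open>x \<mapsto> elementary [x]\<close>. The value at exponent 0 is the conventional cone \<open>\<real>\<^sub>+\<close> in
  \<open>V\<^bsup>\<otimes>0\<^esup> = \<real>\<close>.\<close>

fun min_power :: "'a::euclidean_space set \<Rightarrow> nat \<Rightarrow> 'a tensor set" where
  "min_power C 0 = {Poly_Mapping.single [] c | c. 0 \<le> c}"
| "min_power C (Suc 0) = (\<lambda>x. elementary [x]) ` C"
| "min_power C (Suc (Suc k)) = min_tensor tensor_mult C (min_power C (Suc k))"

fun max_power :: "'a::euclidean_space set \<Rightarrow> nat \<Rightarrow> 'a tensor set" where
  "max_power C 0 = {Poly_Mapping.single [] c | c. 0 \<le> c}"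
| "max_power C (Suc 0) = (\<lambda>x. elementary [x]) ` C"
| "max_power C (Suc (Suc k)) = max_tensor (Suc k) C (max_power C (Suc k))"

section \<open>Defining properties of the tensor operations\<close>

lemma lookup_scaleR_tensor [simp]:
  "Poly_Mapping.lookup (c *\<^sub>R (t::'a tensor)) w = c * Poly_Mapping.lookup t w"
proof -
  have "finite {i. c *\<^sub>R Poly_Mapping.lookup t i \<noteq> 0}"
    by (rule finite_subset[OF _ finite_lookup[of t]]) auto
  then show ?thesis by (simp add: scaleR_poly_mapping_def)
qed

lemma lin_extend_superset:
  assumes "finite A" "Poly_Mapping.keys t \<subseteq> A"
  shows "lin_extend g t = (\<Sum>w\<in>A. Poly_Mapping.lookup t w *\<^sub>R g w)"
  unfolding lin_extend_def using assms
  by (intro sum.mono_neutral_left) (auto simp: in_keys_iff)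

lemma linear_lin_extend: "linear (lin_extend g)"
proof (rule linearI)
  fix s t :: "'a tensor" and c :: real
  let ?A = "Poly_Mapping.keys s \<union> Poly_Mapping.keys t"
  have "lin_extend g (s + t) = (\<Sum>w\<in>?A. Poly_Mapping.lookup (s + t) w *\<^sub>R g w)"
    by (rule lin_extend_superset) (use Poly_Mapping.keys_add[of s t] in auto)
  also have "\<dots> = (\<Sum>w\<in>?A. Poly_Mapping.lookup s w *\<^sub>R g w)
                 + (\<Sum>w\<in>?A. Poly_Mapping.lookup t w *\<^sub>R g w)"
    by (simp add: lookup_add scaleR_add_left sum.distrib)
  also have "\<dots> = lin_extend g s + lin_extend g t"
    by (simp add: lin_extend_superset[of ?A])
  finally show "lin_extend g (s + t) = lin_extend g s + lin_extend g t" .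
  have "lin_extend g (c *\<^sub>R s) = (\<Sum>w\<in>Poly_Mapping.keys s. Poly_Mapping.lookup (c *\<^sub>R s) w *\<^sub>R g w)"
    by (rule lin_extend_superset) (auto simp: in_keys_iff)
  also have "\<dots> = c *\<^sub>R lin_extend g s"
    by (simp add: lin_extend_def scaleR_sum_right)
  finally show "lin_extend g (c *\<^sub>R s) = c *\<^sub>R lin_extend g s" .
qed

lemma lin_extend_single [simp]: "lin_extend g (Poly_Mapping.single w c) = c *\<^sub>R g w"
  by (cases "c = 0") (simp_all add: lin_extend_def)

lemma tensor_expand:
  "(t::'a tensor)
     = (\<Sum>w\<in>Poly_Mapping.keys t. Poly_Mapping.lookup t w *\<^sub>R Poly_Mapping.single w 1)"
proof (rule poly_mapping_eqI)
  fix v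
  have "(\<Sum>w\<in>Poly_Mapping.keys t. Poly_Mapping.lookup t w * (1 when w = v))
      = (\<Sum>w\<in>Poly_Mapping.keys t. if w = v then Poly_Mapping.lookup t w else 0)"
    by (rule sum.cong) (auto simp: when_def)
  also have "\<dots> = Poly_Mapping.lookup t v"
    by (simp add: in_keys_iff)
  finally show "Poly_Mapping.lookup t v = Poly_Mapping.lookup
      (\<Sum>w\<in>Poly_Mapping.keys t. Poly_Mapping.lookup t w *\<^sub>R Poly_Mapping.single w 1) v"
    by (simp add: lookup_sum lookup_single)
qed

lemma linear_eq_on_words:
  fixes f g :: "'a tensor \<Rightarrow> 'b::real_vector"
  assumes "linear f" "linear g"
    and "\<And>w. w \<in> Poly_Mapping.keys t \<Longrightarrow>
          f (Poly_Mapping.single w (1::real)) = g (Poly_Mapping.single w 1)"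
  shows "f t = g t"
proof -
  have *: "h t = (\<Sum>w\<in>Poly_Mapping.keys t. Poly_Mapping.lookup t w *\<^sub>R h (Poly_Mapping.single w 1))"
    if "linear h" for h :: "'a tensor \<Rightarrow> 'b"
    using arg_cong[OF tensor_expand[of t], of h]
    by (simp only: linear_sum[OF that] linear_scale[OF that])
  show ?thesis
    using assms(3) by (simp add: *[OF assms(1)] *[OF assms(2)])
qed

lemma linear_tensor_mult_right: "linear (tensor_mult x)"
  unfolding tensor_mult_def by (rule linear_lin_extend)

lemma linear_tensor_mult_left: "linear (\<lambda>x. tensor_mult x t)"
  by (rule linearI)
    (simp_all add: tensor_mult_def lin_extend_def inner_add_left scaleR_add_left sum.distrib
      scaleR_add_right scaleR_sum_right mult.left_commute)

lemma tensor_mult_Basis: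
  assumes "b \<in> Basis"
  shows "tensor_mult b (Poly_Mapping.single w c) = Poly_Mapping.single (b # w) c"
proof -
  have "tensor_mult b (Poly_Mapping.single w c)
      = c *\<^sub>R (\<Sum>a\<in>Basis. if a = b then Poly_Mapping.single (a # w) 1 else 0)"
    unfolding tensor_mult_def lin_extend_single
    by (intro arg_cong[where f = "scaleR c"] sum.cong) (use assms in \<open>auto simp: inner_Basis\<close>)
  also have "\<dots> = c *\<^sub>R Poly_Mapping.single (b # w) 1"
    using assms by simp
  also have "\<dots> = Poly_Mapping.single (b # w) c"
    by (rule poly_mapping_eqI) (simp add: lookup_single when_def)
  finally show ?thesis .
qed

lemma elementary_Basis:
  "set w \<subseteq> Basis \<Longrightarrow> elementary w = Poly_Mapping.single w 1"
  by (induction w) (auto simp: tensor_mult_Basis)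

lemma subspace_tensor_space: "subspace (tensor_space k)"
proof (rule subspaceI)
  show "0 \<in> tensor_space k" by (simp add: tensor_space_def)
next
  fix s t :: "'a tensor" assume "s \<in> tensor_space k" "t \<in> tensor_space k"
  then show "s + t \<in> tensor_space k"
    using Poly_Mapping.keys_add[of s t] by (auto simp: tensor_space_def)
next
  fix t :: "'a tensor" and c assume "t \<in> tensor_space k"
  then show "c *\<^sub>R t \<in> tensor_space k"
    by (auto simp: tensor_space_def in_keys_iff)
qed

lemma tensor_mult_in_tensor_space:
  assumes "t \<in> tensor_space k"
  shows "tensor_mult x t \<in> tensor_space (Suc k)"
  unfolding tensor_mult_def lin_extend_def
  by (intro subspace_sum subspace_scale subspace_tensor_space)
    (use assms in \<open>auto simp: tensor_space_def\<close>)

lemma elementary_in_tensor_space: "elementary xs \<in> tensor_space (length xs)"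
  by (induction xs) (auto simp: tensor_mult_in_tensor_space, simp add: tensor_space_def)

lemma tensor_space_eq_span: "tensor_space k = span (elementary ` {xs. length xs = k})"
proof
  show "tensor_space k \<subseteq> span (elementary ` {xs::'a list. length xs = k})"
  proof
    fix t :: "'a tensor" assume t: "t \<in> tensor_space k"
    have "Poly_Mapping.lookup t w *\<^sub>R Poly_Mapping.single w 1
        \<in> span (elementary ` {xs::'a list. length xs = k})" if "w \<in> Poly_Mapping.keys t" for w
      using t that elementary_Basis[of w]
      by (intro span_scale span_base) (auto simp: tensor_space_def intro!: image_eqI[of _ _ w])
    then show "t \<in> span (elementary ` {xs. length xs = k})"
      by (subst tensor_expand[of t]) (rule span_sum)
  qed
  show "span (elementary ` {xs::'a list. length xs = k}) \<subseteq> tensor_space k"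
    by (rule span_minimal) (auto simp: subspace_tensor_space elementary_in_tensor_space)
qed

lemma linear_tensor_map: "linear (tensor_map P)"
  unfolding tensor_map_def by (rule linear_lin_extend)

lemma tensor_map_tensor_mult:
  assumes "linear P"
  shows "tensor_map P (tensor_mult x t) = tensor_mult (P x) (tensor_map P t)"
proof (rule linear_eq_on_words[where f = "\<lambda>t. tensor_map P (tensor_mult x t)"
        and g = "\<lambda>t. tensor_mult (P x) (tensor_map P t)"])
  show "linear (\<lambda>t. tensor_map P (tensor_mult x t))"
    using linear_compose[OF linear_tensor_mult_right linear_tensor_map] by (simp add: o_def)
  show "linear (\<lambda>t. tensor_mult (P x) (tensor_map P t))"
    using linear_compose[OF linear_tensor_map linear_tensor_mult_right] by (simp add: o_def)
next
  fix w
  have "tensor_map P (tensor_mult x (Poly_Mapping.single w 1))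
      = (\<Sum>b\<in>Basis. (x \<bullet> b) *\<^sub>R tensor_mult (P b) (elementary (map P w)))"
    by (simp add: tensor_mult_def linear_sum[OF linear_tensor_map] linear_scale[OF linear_tensor_map])
      (simp add: tensor_map_def tensor_mult_def)
  also have "\<dots> = tensor_mult (P (\<Sum>b\<in>Basis. (x \<bullet> b) *\<^sub>R b)) (elementary (map P w))"
    by (simp only: linear_sum[OF assms] linear_scale[OF assms]
        linear_sum[OF linear_tensor_mult_left] linear_scale[OF linear_tensor_mult_left])
  finally show "tensor_map P (tensor_mult x (Poly_Mapping.single w 1))
      = tensor_mult (P x) (tensor_map P (Poly_Mapping.single w 1))"
    by (simp add: euclidean_representation) (simp add: tensor_map_def)
qed

lemma tensor_map_elementary:
  "linear P \<Longrightarrow> tensor_map P (elementary xs) = elementary (map P xs)"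
  by (induction xs) (simp_all add: tensor_map_tensor_mult, simp add: tensor_map_def)

lemma norm_tensor:
  "norm (t::'a tensor) = (\<Sum>w\<in>Poly_Mapping.keys t. \<bar>Poly_Mapping.lookup t w\<bar>)"
  by (simp add: norm_poly_mapping_def dist_poly_mapping_def)

lemma bounded_linear_lin_extend:
  fixes g :: "'a list \<Rightarrow> real"
  assumes "\<And>w. \<bar>g w\<bar> \<le> K"
  shows "bounded_linear (lin_extend g)"
proof (rule bounded_linear_intro[where K = K])
  fix t
  have "norm (lin_extend g t) \<le> (\<Sum>w\<in>Poly_Mapping.keys t. \<bar>Poly_Mapping.lookup t w\<bar> * K)"
    unfolding lin_extend_def
    by (rule order_trans[OF norm_sum sum_mono]) (simp add: abs_mult mult_left_mono assms)
  then show "norm (lin_extend g t) \<le> norm t * K"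
    by (simp add: norm_tensor sum_distrib_right)
qed (simp_all add: linear_add[OF linear_lin_extend] linear_scale[OF linear_lin_extend])

lemma blinfun_apply_dual_mult:
  "blinfun_apply (dual_mult \<phi> \<psi>) = lin_extend (\<lambda>w. case w of [] \<Rightarrow> 0
     | b # v \<Rightarrow> if b \<in> Basis
               then blinfun_apply \<phi> b * blinfun_apply \<psi> (Poly_Mapping.single v 1) else 0)"
  unfolding dual_mult_def
proof (rule bounded_linear_Blinfun_apply, rule bounded_linear_lin_extend)
  fix w :: "'a list"
  have *: "\<bar>blinfun_apply \<phi> b * blinfun_apply \<psi> (Poly_Mapping.single v 1)\<bar> \<le> norm \<phi> * norm \<psi>"
    if "b \<in> Basis" for b v
    unfolding abs_mult
    using norm_blinfun[of \<phi> b] norm_blinfun[of \<psi> "Poly_Mapping.single v 1"] that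
    by (intro mult_mono) (simp_all add: norm_tensor)
  show "\<bar>case w of [] \<Rightarrow> 0 | b # v \<Rightarrow> if b \<in> Basis
       then blinfun_apply \<phi> b * blinfun_apply \<psi> (Poly_Mapping.single v 1) else 0\<bar>
     \<le> norm \<phi> * norm \<psi>"
    using * by (auto split: list.split)
qed

lemma dual_mult_tensor_mult:
  "blinfun_apply (dual_mult \<phi> \<psi>) (tensor_mult x t) = blinfun_apply \<phi> x * blinfun_apply \<psi> t"
proof (rule linear_eq_on_words[where f = "\<lambda>t. blinfun_apply (dual_mult \<phi> \<psi>) (tensor_mult x t)"
        and g = "\<lambda>t. blinfun_apply \<phi> x * blinfun_apply \<psi> t"])
  have lin: "linear (blinfun_apply \<eta>)" for \<eta> :: "'v::real_normed_vector \<Rightarrow>\<^sub>L real"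
    by (rule bounded_linear.linear[OF blinfun.bounded_linear_right])
  show "linear (\<lambda>t. blinfun_apply (dual_mult \<phi> \<psi>) (tensor_mult x t))"
    using linear_compose[OF linear_tensor_mult_right lin] by (simp add: o_def)
  show "linear (\<lambda>t. blinfun_apply \<phi> x * blinfun_apply \<psi> t)"
    by (rule linearI) (simp_all add: blinfun.add_right blinfun.scaleR_right algebra_simps)
  fix w
  have "blinfun_apply (dual_mult \<phi> \<psi>) (tensor_mult x (Poly_Mapping.single w 1))
      = (\<Sum>b\<in>Basis. (x \<bullet> b) * blinfun_apply \<phi> b) * blinfun_apply \<psi> (Poly_Mapping.single w 1)"
    by (simp add: tensor_mult_def blinfun.sum_right blinfun.scaleR_right)
      (simp add: blinfun_apply_dual_mult sum_distrib_right mult.assoc)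
  also have "(\<Sum>b\<in>Basis. (x \<bullet> b) * blinfun_apply \<phi> b)
      = blinfun_apply \<phi> (\<Sum>b\<in>Basis. (x \<bullet> b) *\<^sub>R b)"
    by (simp only: blinfun.sum_right blinfun.scaleR_right real_scaleR_def)
  finally show "blinfun_apply (dual_mult \<phi> \<psi>) (tensor_mult x (Poly_Mapping.single w 1))
      = blinfun_apply \<phi> x * blinfun_apply \<psi> (Poly_Mapping.single w 1)"
    by (simp add: euclidean_representation)
qed

end

theory Submission
  imports Defs
begin

text \<open>
  For two non-simplicial pointed cones there is a positive map \<open>R\<close> that is not
  entanglement breaking, certified by a linear functional \<open>R \<mapsto> tr (W\<^sup>T R)\<close> that is nonnegative on
  entanglement breaking maps. Such a pair \<open>(R, W)\<close> passes from an exposed face to the cone and from the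
  dual cones to the cones, so by induction on the dimension all exposed faces of both cones and of
  their duals may be assumed simplicial. A non-simplicial cone of this kind contains a kite
  \<open>k\<^sub>1 + k\<^sub>3 = k\<^sub>2 + k\<^sub>4\<close>, and its dual a kite \<open>f\<^sub>1 + f\<^sub>3 = f\<^sub>2 + f\<^sub>4\<close>, with \<open>f\<^sub>i k\<^sub>i = 0\<close>: the
  cone over a square is almost a retract of it. Combining the kites of the two cones gives \<open>R\<close> and \<open>W\<close>.

  Let \<open>e\<close> and \<open>f\<close> be order units of \<open>C\<^sub>2\<close> and of the dual of \<open>C\<^sub>1\<close>. On the half-line \<open>R + s f e\<close>
  there is a threshold \<open>s\<^sub>0 > 0\<close> for being entanglement breaking. A map \<open>P\<close> just below it is
  \<open>Q - \<eta> f e\<close> with \<open>Q\<close> entanglement breaking, \<open>c f e \<le> Q \<le> D f e\<close> on \<open>C\<^sub>1\<close>, and \<open>\<eta>\<close> as small as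
  desired while \<open>c = s\<^sub>0\<close> and \<open>D\<close> stay fixed. Contracting a tensor \<open>T\<close> of the maximal power with a
  positive functional lowers the power by one, so applying \<open>P\<close> to one tensor factor after the other
  shows that \<open>P\<^bsup>\<otimes>k\<^esup> T\<close> lies between \<open>(c/2)\<^sup>k\<close> and \<open>D\<^sup>k\<close> times \<open>f\<^bsup>\<otimes>k\<^esup>(T) e\<^bsup>\<otimes>k\<^esup>\<close> in the
  order of the minimal power: the loss \<open>\<eta> D\<^sup>j\<close> in each step is absorbed by the factor \<open>1/2\<close>.
\<close>

section \<open>Pointed cones and their duals\<close>

text \<open>Kites come from slices. Let \<open>f3\<close> expose a ray \<open>y\<close> of
  \<open>C\<close> and let \<open>f0\<close> support \<open>C\<close> at an \<open>x\<close> that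
  shares no supporting functional with \<open>y\<close>. In the slice around
  \<open>\<sigma> x + y\<close> on which \<open>f0\<close> and \<open>f3\<close> are constant, the
  largest antipodal copy touches the boundary; this yields two more points, supported by
  \<open>f2\<close> and \<open>f4\<close>, with \<open>f2 + f4 = a f3 + b f0\<close>. For suitable
  \<sigma> this is a kite unless \<open>b = 0\<close>, that is, unless \<open>f2\<close> and
  \<open>f4\<close> vanish at \<open>y\<close>. To handle this exception, simplicial normals at
  \<open>y\<close> are used: without a kite, the faces through \<open>y\<close> generate the tangent
  cone there, so that \<open>y\<close> and its neighbours form a basis of the span, and only the
  coordinate along \<open>y\<close> can be negative on \<open>C\<close>. When two kites are paired,
  the values of the functionals off the diagonal are unknown. They enter the trace only through a
  product of two differences, whose sign is reversed by reflecting one kite, and through a strictly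
  positive term, which the strict inequalities of the kites allow to be subtracted from the
  witness.\<close>

definition pointed_cone :: "'a::euclidean_space set \<Rightarrow> bool" where
  "pointed_cone C \<longleftrightarrow> convex_cone C \<and> closed C \<and> C \<inter> uminus ` C = {0}"

text \<open>Taken inside \<open>span C\<close> rather than in the whole space: the dual of a
  lower-dimensional cone, such as a face, is then again pointed, and its dimension does not exceed
  \<open>dim C\<close>.\<close>

definition span_dual :: "'a::euclidean_space set \<Rightarrow> 'a set" where
  "span_dual C = {f \<in> span C. \<forall>x\<in>C. 0 \<le> f \<bullet> x}"

text \<open>Also used with \<open>C\<close> a dual cone and \<open>f\<close> a point:
  \<open>exposed_by (span_dual C) x\<close> is the cone of functionals supporting \<open>C\<close>
  at \<open>x\<close>, its normals there.\<close>

definition exposed_by :: "'a::euclidean_space set \<Rightarrow> 'a \<Rightarrow> 'a set" where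
  "exposed_by C f = {x \<in> C. f \<bullet> x = 0}"

text \<open>The classical cones relative to their span; the empty \<open>B\<close> gives
  \<open>{0}\<close>.\<close>

definition simplicial_cone :: "'a::euclidean_space set \<Rightarrow> bool" where
  "simplicial_cone C \<longleftrightarrow> (\<exists>B. finite B \<and> independent B \<and> C = convex_cone hull B)"

lemma pointed_coneD:
  assumes "pointed_cone C"
  shows "closed C" "convex C" "convex_cone C"
  using assms unfolding pointed_cone_def convex_cone_def by auto

lemma pointed_cone_0: "pointed_cone C \<Longrightarrow> 0 \<in> C"
  by (simp add: pointed_cone_def convex_cone_contains_0)

lemma pointed_cone_add: "pointed_cone C \<Longrightarrow> x \<in> C \<Longrightarrow> y \<in> C \<Longrightarrow> x + y \<in> C"
  by (simp add: pointed_cone_def convex_cone_add)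

lemma pointed_cone_scale: "pointed_cone C \<Longrightarrow> x \<in> C \<Longrightarrow> 0 \<le> c \<Longrightarrow> c *\<^sub>R x \<in> C"
  by (simp add: pointed_cone_def convex_cone_def conic_mul)

lemma pointed_cone_antisym: "pointed_cone C \<Longrightarrow> x \<in> C \<Longrightarrow> - x \<in> C \<Longrightarrow> x = 0"
  unfolding pointed_cone_def by force

lemma span_dualD: "f \<in> span_dual C \<Longrightarrow> x \<in> C \<Longrightarrow> 0 \<le> f \<bullet> x" "f \<in> span_dual C \<Longrightarrow> f \<in> span C"
  by (auto simp: span_dual_def)

lemma span_dual_add: "f \<in> span_dual C \<Longrightarrow> g \<in> span_dual C \<Longrightarrow> f + g \<in> span_dual C"
  by (auto simp: span_dual_def span_add inner_add_left)

lemma span_dual_scale: "f \<in> span_dual C \<Longrightarrow> 0 \<le> c \<Longrightarrow> c *\<^sub>R f \<in> span_dual C"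
  by (auto simp: span_dual_def span_scale)

lemma span_dual_sum: "(\<And>i. i \<in> I \<Longrightarrow> f i \<in> span_dual C) \<Longrightarrow> sum f I \<in> span_dual C"
  by (auto simp: span_dual_def inner_sum_left intro!: span_sum sum_nonneg)

lemma zero_span_dual [simp]: "0 \<in> span_dual C"
  by (simp add: span_dual_def span_zero)

lemma convex_cone_span_dual: "convex_cone (span_dual C)"
  by (simp add: convex_cone_iff span_dual_add span_dual_scale)

lemma closed_span_dual: "closed (span_dual C)"
proof -
  have "span_dual C = span C \<inter> (\<Inter>x\<in>C. {f. 0 \<le> x \<bullet> f})"
    by (auto simp: span_dual_def inner_commute)
  then show ?thesis
    by (simp add: closed_Int closed_INT closed_subspace closed_halfspace_ge)
qed

lemma inner_zero_on_span: "f \<in> span C \<Longrightarrow> (\<And>x. x \<in> C \<Longrightarrow> f \<bullet> x = 0) \<Longrightarrow> f = 0"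
proof -
  assume f: "f \<in> span C" and z: "\<And>x. x \<in> C \<Longrightarrow> f \<bullet> x = 0"
  have "f \<bullet> v = 0" if "v \<in> span C" for v
    using that by (induction rule: span_induct_alt) (auto simp: z inner_add_right)
  then show "f = 0" using f by (metis inner_eq_zero_iff)
qed

lemma pointed_cone_span_dual: "pointed_cone (span_dual C)"
proof -
  have "f = 0" if "f \<in> span_dual C" "- f \<in> span_dual C" for f
    using that by (intro inner_zero_on_span[of f C]) (force simp: span_dual_def)+
  then show ?thesis
    by (force simp: pointed_cone_def convex_cone_span_dual closed_span_dual)
qed

lemma span_representative: "\<exists>f\<in>span C. \<forall>v\<in>span C. f \<bullet> v = (a::'a::euclidean_space) \<bullet> v"
proof -
  obtain y z where "y \<in> span C" "\<And>w. w \<in> span C \<Longrightarrow> orthogonal z w" "a = y + z"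
    using orthogonal_subspace_decomp_exists by blast
  then show ?thesis by (intro bexI[of _ y]) (auto simp: inner_add_left orthogonal_def)
qed

lemma convex_cone_hull_finite:
  assumes "finite B"
  shows "x \<in> convex_cone hull B \<longleftrightarrow> (\<exists>c. (\<forall>b\<in>B. 0 \<le> c b) \<and> x = (\<Sum>b\<in>B. c b *\<^sub>R b))"
proof
  let ?S = "{x. \<exists>c. (\<forall>b\<in>B. 0 \<le> c b) \<and> x = (\<Sum>b\<in>B. c b *\<^sub>R b)}"
  have "convex_cone ?S"
    unfolding convex_cone_iff
  proof safe
    show "\<exists>c. (\<forall>b\<in>B. 0 \<le> c b) \<and> 0 = (\<Sum>b\<in>B. c b *\<^sub>R b)"
      by (rule exI[of _ "\<lambda>_. 0"]) auto
  next
    fix c d assume "\<forall>b\<in>B. (0::real) \<le> c b" "\<forall>b\<in>B. (0::real) \<le> d b"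
    then show "\<exists>e. (\<forall>b\<in>B. 0 \<le> e b) \<and> (\<Sum>b\<in>B. c b *\<^sub>R b) + (\<Sum>b\<in>B. d b *\<^sub>R b) = (\<Sum>b\<in>B. e b *\<^sub>R b)"
      by (intro exI[of _ "\<lambda>b. c b + d b"]) (auto simp: scaleR_add_left sum.distrib)
  next
    fix c and r :: real assume "\<forall>b\<in>B. (0::real) \<le> c b" "0 \<le> r"
    then show "\<exists>e. (\<forall>b\<in>B. 0 \<le> e b) \<and> r *\<^sub>R (\<Sum>b\<in>B. c b *\<^sub>R b) = (\<Sum>b\<in>B. e b *\<^sub>R b)"
      by (intro exI[of _ "\<lambda>b. r * c b"]) (auto simp: scaleR_sum_right)
  qed
  moreover have "B \<subseteq> ?S"
  proof
    fix b assume b: "b \<in> B"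
    have "b = (\<Sum>a\<in>B. (if a = b then 1 else 0) *\<^sub>R a)"
      using assms b by (simp add: if_distrib[of "\<lambda>c. c *\<^sub>R _"] cong: if_cong)
    then show "b \<in> ?S" by (intro CollectI exI[of _ "\<lambda>a. if a = b then 1 else 0"]) auto
  qed
  ultimately have "convex_cone hull B \<subseteq> ?S" by (intro hull_minimal)
  then show "x \<in> convex_cone hull B \<Longrightarrow> \<exists>c. (\<forall>b\<in>B. 0 \<le> c b) \<and> x = (\<Sum>b\<in>B. c b *\<^sub>R b)"
    by auto
next
  assume "\<exists>c. (\<forall>b\<in>B. 0 \<le> c b) \<and> x = (\<Sum>b\<in>B. c b *\<^sub>R b)"
  then obtain c where "\<forall>b\<in>B. 0 \<le> c b" "x = (\<Sum>b\<in>B. c b *\<^sub>R b)" by blast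
  moreover have "sum g T \<in> convex_cone hull B" if "\<And>t. t \<in> T \<Longrightarrow> g t \<in> convex_cone hull B" for g and T :: "'a set"
    using that by (induction T rule: infinite_finite_induct) (auto intro: convex_cone_hull_add convex_cone_hull_contains_0)
  ultimately show "x \<in> convex_cone hull B"
    by (simp add: convex_cone_hull_mul hull_inc)
qed

section \<open>Separation, the bipolar theorem and strictly positive functionals\<close>

lemma convex_cone_separate_point:
  fixes K :: "'a::euclidean_space set"
  assumes "convex_cone K" "closed K" "v \<notin> K"
  shows "\<exists>h. (\<forall>x\<in>K. 0 \<le> h \<bullet> x) \<and> h \<bullet> v < 0"
proof -
  have K: "convex K" "0 \<in> K" "\<And>x c. x \<in> K \<Longrightarrow> 0 \<le> c \<Longrightarrow> c *\<^sub>R x \<in> K"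
    using assms(1) convex_cone_contains_0 by (auto simp: convex_cone_def conic_mul)
  obtain a b where ab: "a \<bullet> v < b" "\<And>x. x \<in> K \<Longrightarrow> b < a \<bullet> x"
    using separating_hyperplane_closed_point[OF K(1) assms(2,3)] by blast
  have b0: "b < 0" using ab(2)[OF K(2)] by simp
  \<comment> \<open>A point of \<open>K\<close> with a negative value could be scaled until its
    value is \<open>b\<close>, but \<open>a\<close> exceeds \<open>b\<close> on all of
    \<open>K\<close>.\<close>
  have "0 \<le> a \<bullet> x" if "x \<in> K" for x
  proof (rule ccontr)
    assume n: "\<not> 0 \<le> a \<bullet> x"
    have "b / (a \<bullet> x) \<ge> 0" using n b0 by (simp add: divide_nonpos_neg)
    from ab(2)[OF K(3)[OF that this]] n show False by simp
  qed
  then show ?thesis using ab b0 by (intro exI[of _ a]) auto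
qed

lemma convex_cone_separate_span:
  fixes C :: "'a::euclidean_space set"
  assumes "convex_cone K" "closed K" "v \<notin> K" "v \<in> span C" "K \<subseteq> span C"
  shows "\<exists>h\<in>span C. (\<forall>x\<in>K. 0 \<le> h \<bullet> x) \<and> h \<bullet> v < 0"
proof -
  obtain h where h: "\<forall>x\<in>K. 0 \<le> h \<bullet> x" "h \<bullet> v < 0"
    using convex_cone_separate_point[OF assms(1-3)] by blast
  obtain f where f: "f \<in> span C" "\<And>v. v \<in> span C \<Longrightarrow> f \<bullet> v = h \<bullet> v"
    using span_representative[of C h] by blast
  show ?thesis using h f assms(4,5) by (intro bexI[of _ f]) (auto simp: subset_iff)
qed

lemma span_dual_bipolar:
  assumes "pointed_cone C" "v \<in> span C" "\<And>f. f \<in> span_dual C \<Longrightarrow> 0 \<le> f \<bullet> v"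
  shows "v \<in> C"
proof (rule ccontr)
  assume "v \<notin> C"
  then obtain h where "h \<in> span C" "\<forall>x\<in>C. 0 \<le> h \<bullet> x" "h \<bullet> v < 0"
    using convex_cone_separate_span[of C v C] assms(1,2) by (auto simp: pointed_coneD span_superset)
  then show False using assms(3)[of h] by (auto simp: span_dual_def)
qed

text \<open>Separates 0 from the convex hull of the unit vectors of \<open>C\<close>. The hull
  misses 0: otherwise one term of a vanishing convex combination would be the negative of the sum of
  the others, against pointedness.\<close>

lemma strictly_positive_functional:
  assumes "pointed_cone C"
  obtains q where "q \<in> span_dual C" "\<And>x. x \<in> C \<Longrightarrow> x \<noteq> 0 \<Longrightarrow> 0 < q \<bullet> x"
proof -
  let ?K = "convex hull (C \<inter> sphere 0 1)"
  have cpt: "compact (C \<inter> sphere 0 1)"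
    using assms by (simp add: closed_Int_compact pointed_coneD)
  have *: "y \<in> C \<and> y \<noteq> 0" if "y \<in> ?K" for y
  proof -
    obtain q c where fin: "finite q" and q: "q \<subseteq> C \<inter> sphere 0 1" and c: "\<forall>v\<in>q. 0 \<le> c v" "sum c q = 1"
      and y: "(\<Sum>v\<in>q. c v *\<^sub>R v) = y"
      using \<open>y \<in> ?K\<close> unfolding convex_hull_explicit by blast
    have inC: "(\<Sum>v\<in>T. c v *\<^sub>R v) \<in> C" if "T \<subseteq> q" for T
    proof -
      have "finite T" using that fin finite_subset by blast
      then show ?thesis using that
        by (induction T) (use q c in \<open>auto intro!: pointed_cone_0[OF assms] pointed_cone_add[OF assms] pointed_cone_scale[OF assms]\<close>)
    qed
    have "\<exists>v\<in>q. c v \<noteq> 0" using c(2) by (metis sum.neutral zero_neq_one)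
    then obtain v where v: "v \<in> q" "c v > 0" using c(1) by force
    have "y \<noteq> 0"
    proof
      assume "y = 0"
      then have "c v *\<^sub>R v + (\<Sum>w\<in>q - {v}. c w *\<^sub>R w) = 0"
        using y fin v by (simp add: sum.remove)
      then have "(\<Sum>w\<in>q - {v}. c w *\<^sub>R w) = - (c v *\<^sub>R v)" by (metis add_eq_0_iff)
      then have "- (c v *\<^sub>R v) \<in> C" using inC[of "q - {v}"] by auto
      moreover have "c v *\<^sub>R v \<in> C" using v q by (auto intro!: pointed_cone_0[OF assms] pointed_cone_add[OF assms] pointed_cone_scale[OF assms])
      ultimately have "c v *\<^sub>R v = 0" using pointed_cone_antisym[OF assms] by blast
      then show False using v q by auto
    qed
    then show ?thesis using inC[of q] y by auto
  qed
  have "0 \<notin> ?K" using * by blast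
  then obtain a b where ab: "b > 0" "\<And>x. x \<in> ?K \<Longrightarrow> b < a \<bullet> x"
    using separating_hyperplane_closed_0[of ?K] cpt
    by (auto simp: convex_convex_hull compact_convex_hull compact_imp_closed)
  obtain f where f: "f \<in> span C" "\<And>v. v \<in> span C \<Longrightarrow> f \<bullet> v = a \<bullet> v"
    using span_representative[of C a] by blast
  have pos: "0 < f \<bullet> x" if "x \<in> C" "x \<noteq> 0" for x
  proof -
    have "(1 / norm x) *\<^sub>R x \<in> C \<inter> sphere 0 1" using that by (auto intro!: pointed_cone_0[OF assms] pointed_cone_add[OF assms] pointed_cone_scale[OF assms])
    then have "b < a \<bullet> ((1 / norm x) *\<^sub>R x)" by (intro ab hull_inc)
    then have "0 < a \<bullet> x / norm x" using ab(1) by simp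
    then show ?thesis using that f(2)[of x] by (simp add: zero_less_divide_iff span_base)
  qed
  have "f \<in> span_dual C" using f pos by (force simp: span_dual_def less_imp_le)
  then show ?thesis using pos that by blast
qed

lemma positive_functional_norm_bound:
  assumes "pointed_cone C" "\<And>x. x \<in> C \<Longrightarrow> x \<noteq> 0 \<Longrightarrow> 0 < q \<bullet> x"
  obtains m where "m > 0" "\<And>x. x \<in> C \<Longrightarrow> m * norm x \<le> q \<bullet> x"
proof -
  let ?S = "C \<inter> sphere 0 1"
  have cpt: "compact ?S" using assms by (simp add: closed_Int_compact pointed_coneD)
  have "\<exists>m>0. \<forall>x\<in>?S. m \<le> q \<bullet> x"
  proof (cases "?S = {}")
    case False
    moreover have "continuous_on ?S (\<lambda>x. q \<bullet> x)" by (intro continuous_intros)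
    ultimately obtain x where "x \<in> ?S" "\<forall>y\<in>?S. q \<bullet> x \<le> q \<bullet> y"
      using continuous_attains_inf[OF cpt] by blast
    moreover from this have "x \<noteq> 0" by auto
    ultimately show ?thesis using assms(2)[of x] by blast
  qed (auto intro: exI[of _ 1])
  then obtain m where m: "m > 0" "\<And>x. x \<in> ?S \<Longrightarrow> m \<le> q \<bullet> x" by blast
  have "m * norm x \<le> q \<bullet> x" if "x \<in> C" for x
  proof (cases "x = 0")
    case False
    then have "(1 / norm x) *\<^sub>R x \<in> ?S" using that by (auto intro!: pointed_cone_scale[OF assms(1)])
    from m(2)[OF this] show ?thesis using False by (simp add: field_simps)
  qed auto
  then show ?thesis using m that by blast
qed

lemma exposed_by_pointed_cone: "pointed_cone C \<Longrightarrow> pointed_cone (exposed_by C f)"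
proof -
  assume C: "pointed_cone C"
  have "exposed_by C f = C \<inter> {x. f \<bullet> x = 0}" by (auto simp: exposed_by_def)
  then have "closed (exposed_by C f)"
    using C by (simp add: closed_Int closed_hyperplane pointed_coneD)
  then show ?thesis
    using pointed_cone_0[OF C] pointed_cone_add[OF C] pointed_cone_scale[OF C] pointed_cone_antisym[OF C]
    unfolding pointed_cone_def convex_cone_iff by (auto simp: exposed_by_def inner_add_right)
qed

lemma sum_in_cone:
  assumes "convex_cone C" "\<And>i. i \<in> I \<Longrightarrow> f i \<in> C"
  shows "sum f I \<in> C"
  using assms(2) assms(1)
  by (induction I rule: infinite_finite_induct) (auto simp: convex_cone_iff)

text \<open>A supporting hyperplane at \<open>z\<close> passes through 0, because the cone contains
  both 0 and \<open>2 z\<close>. Its normal stays nonzero when represented in the span, being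
  positive on the relative interior.\<close>

lemma boundary_functional:
  assumes C: "pointed_cone C" and z: "z \<in> C" "z \<notin> rel_interior C"
  obtains f where "f \<in> span_dual C" "f \<noteq> 0" "f \<bullet> z = 0"
proof -
  obtain a where a: "\<And>y. y \<in> C \<Longrightarrow> a \<bullet> z \<le> a \<bullet> y" "\<And>y. y \<in> rel_interior C \<Longrightarrow> a \<bullet> z < a \<bullet> y"
    using supporting_hyperplane_rel_boundary[OF pointed_coneD(2)[OF C] z] by metis
  obtain f where f: "f \<in> span C" "\<And>v. v \<in> span C \<Longrightarrow> f \<bullet> v = a \<bullet> v"
    using span_representative[of C a] by blast
  have "a \<bullet> z \<le> a \<bullet> 0" "a \<bullet> z \<le> a \<bullet> (2 *\<^sub>R z)"
    by (intro a(1) pointed_cone_0[OF C] pointed_cone_scale[OF C] z; simp)+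
  then have az: "a \<bullet> z = 0" by simp
  have "rel_interior C \<noteq> {}"
    using rel_interior_eq_empty[of C] pointed_coneD(2)[OF C] pointed_cone_0[OF C] by auto
  then obtain w where "w \<in> rel_interior C" by blast
  then have "f \<bullet> w > 0"
    using a(2)[of w] az f(2)[OF span_base, of w] rel_interior_subset[of C] by force
  then have "f \<noteq> 0" by auto
  moreover have "f \<in> span_dual C" using f a(1) az by (auto simp: span_dual_def span_base)
  moreover have "f \<bullet> z = 0" using f(2)[of z] az z by (simp add: span_base)
  ultimately show ?thesis using that by blast
qed

lemma interior_ball_span:
  assumes C: "pointed_cone C" and z: "z \<in> C" "\<And>f. f \<in> span_dual C \<Longrightarrow> f \<noteq> 0 \<Longrightarrow> f \<bullet> z \<noteq> 0"
  obtains r where "r > 0" "\<And>v. v \<in> span C \<Longrightarrow> norm v \<le> r \<Longrightarrow> z + v \<in> C"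
proof -
  have "z \<in> rel_interior C" using boundary_functional[OF C z(1)] z(2) by metis
  moreover have "affine hull C = span C"
    by (rule affine_hull_span_0) (simp add: C pointed_cone_0 hull_inc)
  ultimately obtain e where e: "e > 0" "ball z e \<inter> span C \<subseteq> C"
    unfolding mem_rel_interior_ball by auto
  have "z + v \<in> C" if "v \<in> span C" "norm v \<le> e / 2" for v
  proof -
    have "dist z (z + v) < e" using that e(1) by (simp add: dist_norm)
    then show ?thesis using e(2) that z by (auto simp: span_add span_base)
  qed
  then show ?thesis using that[of "e/2"] e by auto
qed

text \<open>Compactness: the unit triples \<open>(k, f, v)\<close> in which \<open>f\<close>
  supports \<open>C\<close> at \<open>k\<close> and vanishes at \<open>v\<close> form a compact set,
  on which \<theta> has a positive minimum. With a face as \<open>X\<close>, this later gives the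
  room in which the position of a slice is chosen.\<close>

lemma common_zero_bound:
  assumes C: "pointed_cone C" and X: "closed X" "\<And>v c. v \<in> X \<Longrightarrow> 0 \<le> c \<Longrightarrow> c *\<^sub>R v \<in> X"
    and pos: "\<And>k f v. k \<in> C \<Longrightarrow> f \<in> span_dual C \<Longrightarrow> v \<in> X \<Longrightarrow> k \<noteq> 0 \<Longrightarrow> f \<noteq> 0 \<Longrightarrow> v \<noteq> 0 \<Longrightarrow>
      f \<bullet> k = 0 \<Longrightarrow> f \<bullet> v = 0 \<Longrightarrow> 0 < \<theta> \<bullet> k"
  obtains \<rho> where "\<rho> > 0"
    "\<And>k f v. k \<in> C \<Longrightarrow> f \<in> span_dual C \<Longrightarrow> v \<in> X \<Longrightarrow> f \<noteq> 0 \<Longrightarrow> v \<noteq> 0 \<Longrightarrow>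
      f \<bullet> k = 0 \<Longrightarrow> f \<bullet> v = 0 \<Longrightarrow> \<rho> * norm k \<le> \<theta> \<bullet> k"
proof -
  let ?U = "sphere (0::'a) 1"
  define Z where "Z = ((C \<inter> ?U) \<times> (span_dual C \<inter> ?U) \<times> (X \<inter> ?U))
    \<inter> {p. fst (snd p) \<bullet> fst p = 0 \<and> fst (snd p) \<bullet> snd (snd p) = 0}"
  have "compact ((C \<inter> ?U) \<times> (span_dual C \<inter> ?U) \<times> (X \<inter> ?U))"
    by (intro compact_Times closed_Int_compact compact_sphere closed_span_dual X(1) pointed_coneD(1)[OF C])
  moreover have "closed {p::'a \<times> 'a \<times> 'a. fst (snd p) \<bullet> fst p = 0 \<and> fst (snd p) \<bullet> snd (snd p) = 0}"
    by (intro closed_Collect_conj closed_Collect_eq continuous_intros)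
  ultimately have cpt: "compact Z" unfolding Z_def by (rule compact_Int_closed)
  have "\<exists>\<rho>>0. \<forall>p\<in>Z. \<rho> \<le> \<theta> \<bullet> fst p"
  proof (cases "Z = {}")
    case False
    have "continuous_on Z (\<lambda>p. \<theta> \<bullet> fst p)" by (intro continuous_intros)
    then obtain p where p: "p \<in> Z" "\<forall>q\<in>Z. \<theta> \<bullet> fst p \<le> \<theta> \<bullet> fst q"
      using continuous_attains_inf[OF cpt False] by blast
    obtain k f v where kfv: "p = (k, f, v)" by (cases p) auto
    have "k \<noteq> 0" "f \<noteq> 0" "v \<noteq> 0" using p(1) unfolding Z_def kfv by auto
    then have "0 < \<theta> \<bullet> k" using pos[of k f v] p(1) unfolding Z_def kfv by auto
    then show ?thesis using p(2) kfv by (intro exI[of _ "\<theta> \<bullet> k"]) auto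
  qed (auto intro: exI[of _ 1])
  then obtain \<rho> where \<rho>: "\<rho> > 0" "\<And>p. p \<in> Z \<Longrightarrow> \<rho> \<le> \<theta> \<bullet> fst p" by blast
  have "\<rho> * norm k \<le> \<theta> \<bullet> k"
    if h: "k \<in> C" "f \<in> span_dual C" "v \<in> X" "f \<noteq> 0" "v \<noteq> 0" "f \<bullet> k = 0" "f \<bullet> v = 0" for k f v
  proof (cases "k = 0")
    case False
    have "((1 / norm k) *\<^sub>R k, (1 / norm f) *\<^sub>R f, (1 / norm v) *\<^sub>R v) \<in> Z"
      unfolding Z_def using h False by (simp add: pointed_cone_scale[OF C] span_dual_scale X(2))
    from \<rho>(2)[OF this] show ?thesis using False by (simp add: field_simps)
  qed simp
  then show ?thesis using that \<rho>(1) by blast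
qed

section \<open>Slices of a cone by two supporting functionals\<close>

lemma slice_decomposition:
  assumes "f0 \<bullet> x = 0" "f3 \<bullet> y = 0" "0 < f3 \<bullet> x" "0 < f0 \<bullet> y"
  shows "f0 \<bullet> (v - (f3 \<bullet> v / (f3 \<bullet> x)) *\<^sub>R x - (f0 \<bullet> v / (f0 \<bullet> y)) *\<^sub>R y) = 0"
    "f3 \<bullet> (v - (f3 \<bullet> v / (f3 \<bullet> x)) *\<^sub>R x - (f0 \<bullet> v / (f0 \<bullet> y)) *\<^sub>R y) = (0::real)"
  using assms by (auto simp: inner_diff_right)

text \<open>Subtracting its components along \<open>x\<close> and \<open>y\<close> moves a vector
  into the common kernel of \<open>f0\<close> and \<open>f3\<close>. If that is trivial in the span,
  \<open>C\<close> is the two-dimensional cone with edges \<open>x\<close> and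
  \<open>y\<close>.\<close>

lemma trivial_slice_imp_simplicial:
  assumes C: "pointed_cone C" and xy: "x \<in> C" "y \<in> C" and f: "f0 \<in> span_dual C" "f3 \<in> span_dual C"
    and z: "f0 \<bullet> x = 0" "f3 \<bullet> y = 0" "0 < f3 \<bullet> x" "0 < f0 \<bullet> y"
    and triv: "\<And>l. l \<in> span C \<Longrightarrow> f0 \<bullet> l = 0 \<Longrightarrow> f3 \<bullet> l = 0 \<Longrightarrow> l = 0"
  shows "simplicial_cone C"
  unfolding simplicial_cone_def
proof (intro exI conjI)
  have ne: "x \<noteq> y" using z by auto
  show "finite {x, y}" by simp
  show "independent {x, y}"
  proof (rule independent_if_scalars_zero)
    fix c v assume s: "(\<Sum>v\<in>{x,y}. c v *\<^sub>R v) = 0" and v: "v \<in> {x, y}"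
    have "c x *\<^sub>R x + c y *\<^sub>R y = 0" using s ne by simp
    then have "f3 \<bullet> (c x *\<^sub>R x + c y *\<^sub>R y) = 0" "f0 \<bullet> (c x *\<^sub>R x + c y *\<^sub>R y) = 0" by simp_all
    then show "c v = 0" using z v by (auto simp: inner_add_right)
  qed simp
  show "C = convex_cone hull {x, y}"
  proof
    show "convex_cone hull {x, y} \<subseteq> C" by (rule hull_minimal) (use xy C in \<open>auto simp: pointed_coneD\<close>)
    show "C \<subseteq> convex_cone hull {x, y}"
    proof
      fix v assume v: "v \<in> C"
      have "v - (f3 \<bullet> v / (f3 \<bullet> x)) *\<^sub>R x - (f0 \<bullet> v / (f0 \<bullet> y)) *\<^sub>R y = 0"
        by (intro triv slice_decomposition[OF z] span_diff span_scale span_base v xy)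
      then have "v = (f3 \<bullet> v / (f3 \<bullet> x)) *\<^sub>R x + (f0 \<bullet> v / (f0 \<bullet> y)) *\<^sub>R y" by (simp add: algebra_simps)
      also have "\<dots> \<in> convex_cone hull {x, y}"
        using z span_dualD(1)[OF f(1) v] span_dualD(1)[OF f(2) v]
        by (intro convex_cone_hull_add convex_cone_hull_mul hull_inc) auto
      finally show "v \<in> convex_cone hull {x, y}" .
    qed
  qed
qed

text \<open>The point \<open>x + y\<close> is taken as the centre of the slice \<open>A\<close> of \<open>C\<close> on which \<open>f0\<close> and \<open>f3\<close> are
  constant. For the largest \<open>\<tau>\<close> such that \<open>- \<tau> A \<subseteq> A\<close> the two sets touch; the point of
  contact and its antipode have parallel supporting hyperplanes.\<close>

lemma antipodal_supports:
  assumes C: "pointed_cone C" and x: "x \<in> C" and y: "y \<in> C"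
    and f0: "f0 \<in> span_dual C" and f3: "f3 \<in> span_dual C"
    and z: "f0 \<bullet> x = 0" "f3 \<bullet> y = 0" "0 < f3 \<bullet> x" "0 < f0 \<bullet> y"
    and pos: "\<And>v. v \<in> C \<Longrightarrow> v \<noteq> 0 \<Longrightarrow> 0 < f0 \<bullet> v + f3 \<bullet> v"
    and int: "\<And>f. f \<in> span_dual C \<Longrightarrow> f \<noteq> 0 \<Longrightarrow> 0 < f \<bullet> x + f \<bullet> y"
    and l0: "l0 \<in> span C" "l0 \<noteq> 0" "f0 \<bullet> l0 = 0" "f3 \<bullet> l0 = 0"
  obtains \<tau> k2 k4 f2 f4 a b where "0 < \<tau>" "k2 \<in> C" "k4 \<in> C" "f2 \<in> span_dual C" "f4 \<in> span_dual C"
    "f2 \<noteq> 0" "f4 \<noteq> 0" "0 \<le> a" "0 \<le> b" "k2 + k4 = (1 + \<tau>) *\<^sub>R (x + y)"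
    "f2 \<bullet> k2 = 0" "f4 \<bullet> k4 = 0" "f2 + f4 = a *\<^sub>R f3 + b *\<^sub>R f0"
    "f0 \<bullet> k2 = f0 \<bullet> y" "f3 \<bullet> k2 = f3 \<bullet> x" "f0 \<bullet> k4 = \<tau> * (f0 \<bullet> y)" "f3 \<bullet> k4 = \<tau> * (f3 \<bullet> x)"
proof -
  define zz where "zz = x + y"
  have zC: "zz \<in> C" unfolding zz_def by (intro pointed_cone_add C x y)
  have fz: "f0 \<bullet> zz = f0 \<bullet> y" "f3 \<bullet> zz = f3 \<bullet> x" using z by (auto simp: zz_def inner_add_right)
  have zpos: "0 < f \<bullet> zz" if "f \<in> span_dual C" "f \<noteq> 0" for f
    using int[OF that] by (simp add: zz_def inner_add_right)
  have zne: "f \<bullet> zz \<noteq> 0" if "f \<in> span_dual C" "f \<noteq> 0" for f using zpos[OF that] by simp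
  define L where "L = {l \<in> span C. f0 \<bullet> l = 0 \<and> f3 \<bullet> l = 0}"
  have L0: "0 \<in> L" by (simp add: L_def span_zero)
  have Ladd: "l + l' \<in> L" if "l \<in> L" "l' \<in> L" for l l' using that by (simp add: L_def span_add inner_add_right)
  have Lscale: "c *\<^sub>R l \<in> L" if "l \<in> L" for l c using that by (simp add: L_def span_scale)
  \<comment> \<open>The slice, translated so that its centre \<open>zz\<close> becomes 0: a compact
    neighbourhood of 0 in \<open>L\<close>.\<close>
  define A where "A = {l \<in> L. zz + l \<in> C}"
  obtain r where r: "r > 0" "\<And>v. v \<in> span C \<Longrightarrow> norm v \<le> r \<Longrightarrow> zz + v \<in> C"
    using interior_ball_span[OF C zC zne] by blast
  have Aball: "l \<in> A" if "l \<in> L" "norm l \<le> r" for l using that r(2) by (simp add: A_def L_def)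
  have Lclosed: "closed L"
  proof -
    have "L = span C \<inter> {l. f0 \<bullet> l = 0} \<inter> {l. f3 \<bullet> l = 0}" by (auto simp: L_def)
    then show ?thesis by (simp add: closed_Int closed_subspace closed_hyperplane)
  qed
  have Aclosed: "closed A"
  proof -
    have "A = L \<inter> (\<lambda>l. l + zz) -` C" by (auto simp: A_def add.commute)
    moreover have "closed ((\<lambda>l. l + zz) -` C)"
      by (intro closed_vimage pointed_coneD C continuous_intros)
    ultimately show ?thesis using Lclosed by (simp add: closed_Int)
  qed
  obtain m where m: "m > 0" "\<And>v. v \<in> C \<Longrightarrow> m * norm v \<le> (f0 + f3) \<bullet> v"
    using positive_functional_norm_bound[OF C pos[folded inner_add_left]] by blast
  define R where "R = (f0 \<bullet> zz + f3 \<bullet> zz) / m + norm zz"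
  have Abound: "norm l \<le> R" if "l \<in> A" for l
  proof -
    have "m * norm (zz + l) \<le> f0 \<bullet> zz + f3 \<bullet> zz"
      using m(2)[of "zz + l"] that by (simp add: A_def L_def inner_add_left inner_add_right)
    then have "norm (zz + l) \<le> (f0 \<bullet> zz + f3 \<bullet> zz) / m" using m(1) by (simp add: field_simps)
    then show ?thesis using norm_triangle_ineq4[of "zz + l" zz] by (simp add: R_def)
  qed
  have Rpos: "R > 0" using fz z m(1) by (auto simp: R_def intro!: add_pos_nonneg divide_pos_pos)
  have Acompact: "compact A"
    using Aclosed Abound by (auto simp: compact_eq_bounded_closed bounded_iff)
  define T where "T = {t. 0 \<le> t \<and> (\<forall>l\<in>A. - (t *\<^sub>R l) \<in> A)}"
  have Tr: "r / R \<in> T"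
    unfolding T_def
  proof (intro CollectI conjI ballI)
    fix l assume l: "l \<in> A"
    have "norm (- ((r / R) *\<^sub>R l)) \<le> r" using Abound[OF l] Rpos r(1) by (simp add: field_simps)
    then show "- ((r / R) *\<^sub>R l) \<in> A"
      using Lscale[of l "- (r / R)"] l by (intro Aball) (auto simp: A_def)
  qed (use r Rpos in auto)
  define l1 where "l1 = (r / norm l0) *\<^sub>R l0"
  have l1: "l1 \<in> A" "norm l1 = r" using l0 r(1) by (auto simp: l1_def L_def span_scale intro!: Aball)
  have Tle: "t \<le> R / r" if "t \<in> T" for t
  proof -
    have "norm (- (t *\<^sub>R l1)) \<le> R" using that l1(1) by (intro Abound) (simp add: T_def)
    then show ?thesis using that l1(2) r(1) by (simp add: T_def field_simps)
  qed
  have Tbdd: "bdd_above T" using Tle by (rule bdd_aboveI)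
  have Tclosed: "closed T"
  proof -
    have "T = {0..} \<inter> (\<Inter>l\<in>A. (\<lambda>t. - (t *\<^sub>R l)) -` A)" by (auto simp: T_def)
    moreover have "closed ((\<lambda>t. - (t *\<^sub>R l)) -` A)" for l
      by (intro closed_vimage Aclosed continuous_intros)
    ultimately show ?thesis by (simp add: closed_Int closed_INT)
  qed
  define \<tau> where "\<tau> = Sup T"
  have \<tau>T: "\<tau> \<in> T" unfolding \<tau>_def using closed_contains_Sup[OF _ Tbdd Tclosed] Tr by blast
  have "r / R \<le> \<tau>" unfolding \<tau>_def by (intro cSup_upper Tr Tbdd)
  then have \<tau>pos: "0 < \<tau>" using r(1) Rpos by (smt (verit) divide_pos_pos)
  have \<tau>A: "- (\<tau> *\<^sub>R l) \<in> A" if "l \<in> A" for l using \<tau>T that by (simp add: T_def)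
  \<comment> \<open>These points leave \<open>A\<close> under a factor slightly above \<tau>; for a
    limit \<open>a0\<close> of them, the image \<open>b0 = - \<tau> a0\<close> is a boundary
    point.\<close>
  have "\<exists>l\<in>A. - ((\<tau> + 1 / real (Suc n)) *\<^sub>R l) \<notin> A" for n
  proof (rule ccontr)
    assume "\<not> (\<exists>l\<in>A. - ((\<tau> + 1 / real (Suc n)) *\<^sub>R l) \<notin> A)"
    then have "\<tau> + 1 / real (Suc n) \<in> T" using \<tau>pos by (auto simp: T_def)
    then have "\<tau> + 1 / real (Suc n) \<le> \<tau>" unfolding \<tau>_def by (intro cSup_upper Tbdd)
    then show False by simp
  qed
  then obtain s where s: "\<And>n. s n \<in> A" "\<And>n. - ((\<tau> + 1 / real (Suc n)) *\<^sub>R s n) \<notin> A" by metis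
  obtain a0 \<phi> where a0: "a0 \<in> A" "strict_mono \<phi>" "(s \<circ> \<phi>) \<longlonglongrightarrow> a0"
    using Acompact s(1) unfolding compact_def by metis
  define b0 where "b0 = - (\<tau> *\<^sub>R a0)"
  have b0A: "b0 \<in> A" unfolding b0_def by (intro \<tau>A a0)
  define k2 where "k2 = zz + b0"
  have k2C: "k2 \<in> C" using b0A by (simp add: k2_def A_def)
  \<comment> \<open>Otherwise \<open>C\<close> contains a ball around \<open>k2\<close> within the
    span, and with it some of the points that were chosen outside \<open>A\<close>.\<close>
  have "\<exists>f\<in>span_dual C. f \<noteq> 0 \<and> f \<bullet> k2 = 0"
  proof (rule ccontr)
    assume "\<not> ?thesis"
    then have kne: "f \<bullet> k2 \<noteq> 0" if "f \<in> span_dual C" "f \<noteq> 0" for f using that by blast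
    obtain e where e: "e > 0" "\<And>v. v \<in> span C \<Longrightarrow> norm v \<le> e \<Longrightarrow> k2 + v \<in> C"
      using interior_ball_span[OF C k2C kne] by blast
    define g where "g n = - ((\<tau> + 1 / real (Suc (\<phi> n))) *\<^sub>R s (\<phi> n))" for n
    have "(\<lambda>n. 1 / real (Suc n)) \<longlonglongrightarrow> 0" using LIMSEQ_inverse_real_of_nat by (simp add: inverse_eq_divide)
    from LIMSEQ_subseq_LIMSEQ[OF this a0(2)]
    have inv: "(\<lambda>n. 1 / real (Suc (\<phi> n))) \<longlonglongrightarrow> 0" by (simp add: o_def)
    have lim: "(\<lambda>n. s (\<phi> n)) \<longlonglongrightarrow> a0" using a0(3) by (simp add: o_def)
    have "g \<longlonglongrightarrow> - ((\<tau> + 0) *\<^sub>R a0)"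
      unfolding g_def by (intro tendsto_minus tendsto_scaleR tendsto_add tendsto_const inv lim)
    then have "g \<longlonglongrightarrow> b0" by (simp only: add_0_right b0_def)
    then obtain n where n: "dist (g n) b0 < e"
      using e(1) unfolding lim_sequentially by blast
    have sL: "s (\<phi> n) \<in> L" using s(1)[of "\<phi> n"] by (simp add: A_def)
    have gL: "g n \<in> L"
      using Lscale[OF sL, of "- (\<tau> + 1 / real (Suc (\<phi> n)))"] unfolding g_def scaleR_minus_left .
    have b0L: "b0 \<in> L" using b0A by (simp add: A_def)
    have "g n - b0 \<in> L"
      using Ladd[OF gL Lscale[OF b0L, of "-1"]] by (simp only: scaleR_minus1_left add_uminus_conv_diff)
    then have "k2 + (g n - b0) \<in> C" using n by (intro e(2)) (auto simp: L_def dist_norm)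
    then have "zz + g n \<in> C" by (simp add: k2_def)
    then have "g n \<in> A" using gL by (simp add: A_def)
    then have "- ((\<tau> + 1 / real (Suc (\<phi> n))) *\<^sub>R s (\<phi> n)) \<in> A" unfolding g_def .
    then show False using s(2) by blast
  qed
  then obtain f2 where f2: "f2 \<in> span_dual C" "f2 \<noteq> 0" "f2 \<bullet> k2 = 0" by blast
  have f2z: "f2 \<bullet> zz > 0" by (intro zpos f2)
  have f2b: "f2 \<bullet> b0 = - (f2 \<bullet> zz)" using f2(3) by (simp add: k2_def inner_add_right)
  \<comment> \<open>\<open>f2\<close> is nonnegative on the antipodal image of the slice and
    vanishes at that of \<open>a0\<close>, so on \<open>A\<close> it is largest at
    \<open>a0\<close>.\<close>
  have a0max: "f2 \<bullet> l \<le> f2 \<bullet> a0" if "l \<in> A" for l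
  proof -
    have "0 \<le> f2 \<bullet> (zz + - (\<tau> *\<^sub>R l))" using \<tau>A[OF that] by (intro span_dualD(1)[OF f2(1)]) (simp add: A_def)
    then have "\<tau> * (f2 \<bullet> l) \<le> \<tau> * (f2 \<bullet> a0)" using f2b by (simp add: inner_add_right inner_diff_right b0_def)
    then show ?thesis using \<tau>pos by simp
  qed
  have "0 < \<tau> * (f2 \<bullet> a0)" using f2b f2z by (simp add: b0_def)
  then have f2a: "0 < f2 \<bullet> a0" using \<tau>pos by (rule zero_less_mult_pos)
  \<comment> \<open>For \<open>c > 0\<close> these are the multiples of the points
    \<open>zz + l\<close> strictly beyond the hyperplane through \<open>a0\<close> parallel to
    \<open>f2\<close>. Separating them from \<open>C\<close> gives the parallel support at
    \<open>zz + a0\<close>.\<close>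
  define Y where "Y = {c *\<^sub>R zz + l | c l. l \<in> L \<and> c * (f2 \<bullet> a0) < f2 \<bullet> l}"
  \<comment> \<open>Adding the orthogonal complement of the span forces the separating functional
    into the span.\<close>
  define C' where "C' = {v + w | v w. v \<in> C \<and> (\<forall>u\<in>span C. w \<bullet> u = 0)}"
  have C'I: "v + w \<in> C'" if "v \<in> C" "\<And>u. u \<in> span C \<Longrightarrow> w \<bullet> u = 0" for v w using that by (auto simp: C'_def)
  have YI: "c *\<^sub>R zz + l \<in> Y" if "l \<in> L" "c * (f2 \<bullet> a0) < f2 \<bullet> l" for c l using that by (auto simp: Y_def)
  have Yspan: "u \<in> span C" if "u \<in> Y" for u
    using that span_base[OF zC] by (auto simp: Y_def L_def span_add span_scale)
  have "C \<inter> Y = {}"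
  proof (rule ccontr)
    assume "C \<inter> Y \<noteq> {}"
    then obtain c l where cl: "l \<in> L" "c * (f2 \<bullet> a0) < f2 \<bullet> l" "c *\<^sub>R zz + l \<in> C" by (auto simp: Y_def)
    have "0 \<le> f0 \<bullet> (c *\<^sub>R zz + l)" by (rule span_dualD(1)[OF f0 cl(3)])
    then have "0 \<le> c * (f0 \<bullet> y)" using cl(1) fz by (simp add: L_def inner_add_right)
    then have c0: "0 \<le> c" using z by (simp add: zero_le_mult_iff)
    show False
    proof (cases "c = 0")
      case True
      then have "l \<in> C" using cl by simp
      then have "l = 0" using pos[of l] cl(1) by (auto simp: L_def)
      then show False using cl(2) True by simp
    next
      case False
      then have cp: "c > 0" using c0 by simp
      have "(1 / c) *\<^sub>R (c *\<^sub>R zz + l) \<in> C" using cp by (intro pointed_cone_scale[OF C] cl) simp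
      then have "zz + (1 / c) *\<^sub>R l \<in> C" using cp by (simp add: scaleR_add_right)
      then have "(1 / c) *\<^sub>R l \<in> A" using Lscale cl(1) by (simp add: A_def)
      from a0max[OF this] show False using cl(2) cp by (simp add: field_simps)
    qed
  qed
  then have disj: "C' \<inter> Y = {}"
  proof (rule contrapos_pp)
    assume "C' \<inter> Y \<noteq> {}"
    then obtain v w where vw: "v \<in> C" "\<forall>u\<in>span C. w \<bullet> u = 0" "v + w \<in> Y" by (auto simp: C'_def)
    have "w \<in> span C" using span_diff[OF Yspan[OF vw(3)] span_base[OF vw(1)]] by simp
    then have "w = 0" using vw(2) by (metis inner_eq_zero_iff)
    then show "C \<inter> Y \<noteq> {}" using vw by auto
  qed
  have "convex C'"
  proof (rule convexI)
    fix p q and u v :: real assume pq: "p \<in> C'" "q \<in> C'" and uv: "0 \<le> u" "0 \<le> v" "u + v = 1"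
    obtain v1 w1 where 1: "p = v1 + w1" "v1 \<in> C" "\<forall>u\<in>span C. w1 \<bullet> u = 0" using pq by (auto simp: C'_def)
    obtain v2 w2 where 2: "q = v2 + w2" "v2 \<in> C" "\<forall>u\<in>span C. w2 \<bullet> u = 0" using pq by (auto simp: C'_def)
    have "(u *\<^sub>R v1 + v *\<^sub>R v2) + (u *\<^sub>R w1 + v *\<^sub>R w2) \<in> C'"
      by (intro C'I pointed_cone_add[OF C] pointed_cone_scale[OF C] 1 2 uv)
        (simp add: 1 2 inner_add_left)
    then show "u *\<^sub>R p + v *\<^sub>R q \<in> C'" by (simp add: 1 2 algebra_simps)
  qed
  moreover have "convex Y"
    unfolding convex_def
  proof (intro ballI allI impI)
    fix p q and u v :: real assume pq: "p \<in> Y" "q \<in> Y" and uv: "0 \<le> u" "0 \<le> v" "u + v = 1"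
    obtain c1 l1 where 1: "p = c1 *\<^sub>R zz + l1" "l1 \<in> L" "c1 * (f2 \<bullet> a0) < f2 \<bullet> l1" using pq by (auto simp: Y_def)
    obtain c2 l2 where 2: "q = c2 *\<^sub>R zz + l2" "l2 \<in> L" "c2 * (f2 \<bullet> a0) < f2 \<bullet> l2" using pq by (auto simp: Y_def)
    have "u * (c1 * (f2 \<bullet> a0)) + v * (c2 * (f2 \<bullet> a0)) < u * (f2 \<bullet> l1) + v * (f2 \<bullet> l2)"
    proof (cases "u = 0")
      case False
      then show ?thesis using uv 1 2 by (intro add_less_le_mono) (auto intro: mult_left_mono)
    qed (use uv 2 in auto)
    then have "(u * c1 + v * c2) *\<^sub>R zz + (u *\<^sub>R l1 + v *\<^sub>R l2) \<in> Y"
      by (intro YI Ladd Lscale 1 2) (simp add: inner_add_right algebra_simps)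
    then show "u *\<^sub>R p + v *\<^sub>R q \<in> Y" by (simp add: 1 2 algebra_simps)
  qed
  moreover have "C' \<noteq> {}" using C'I[of 0 0] pointed_cone_0[OF C] by auto
  moreover have "Y \<noteq> {}" using YI[of a0 0] a0(1) f2a by (auto simp: A_def)
  ultimately obtain h d where h: "h \<noteq> 0" "\<And>v. v \<in> C' \<Longrightarrow> h \<bullet> v \<le> d" "\<And>v. v \<in> Y \<Longrightarrow> d \<le> h \<bullet> v"
    using separating_hyperplane_sets[of C' Y] disj by metis
  have d0: "0 \<le> d" using h(2)[of 0] C'I[of 0 0] pointed_cone_0[OF C] by auto
  have conic: "h \<bullet> v \<le> 0" if v: "\<And>c. 0 < c \<Longrightarrow> c *\<^sub>R v \<in> C'" for v
  proof (rule ccontr)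
    assume n: "\<not> ?thesis"
    then have "h \<bullet> (((d + 1) / (h \<bullet> v)) *\<^sub>R v) \<le> d" using d0 by (intro h(2) v) (simp add: divide_pos_pos)
    then show False using n by simp
  qed
  have hC: "h \<bullet> v \<le> 0" if "v \<in> C" for v
  proof (rule conic)
    fix c :: real assume "0 < c"
    then have "c *\<^sub>R v + 0 \<in> C'" by (intro C'I pointed_cone_scale[OF C] that) auto
    then show "c *\<^sub>R v \<in> C'" by simp
  qed
  have "h \<bullet> w = 0" if "\<forall>u\<in>span C. w \<bullet> u = 0" for w
  proof -
    have 0: "0 + c *\<^sub>R w \<in> C'" "0 + c *\<^sub>R (- w) \<in> C'" for c
      by (rule C'I; use that pointed_cone_0[OF C] in simp)+
    have "h \<bullet> w \<le> 0" "h \<bullet> (- w) \<le> 0" by (rule conic; use 0 in simp)+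
    then show ?thesis by simp
  qed
  note * = this
  have hspan: "h \<in> span C"
  proof -
    obtain p q where pq: "p \<in> span C" "\<And>w. w \<in> span C \<Longrightarrow> orthogonal q w" "h = p + q"
      using orthogonal_subspace_decomp_exists by blast
    then have "h \<bullet> q = 0" by (intro *) (auto simp: orthogonal_def)
    moreover have "p \<bullet> q = 0" using pq by (auto simp: orthogonal_def inner_commute)
    ultimately have "q \<bullet> q = 0" using pq(3) by (simp add: inner_add_left)
    then show ?thesis using pq by simp
  qed
  define f4 where "f4 = - h"
  have f4: "f4 \<in> span_dual C" "f4 \<noteq> 0"
    using hspan hC h(1) by (auto simp: span_dual_def f4_def span_neg)
  have Yneg: "f4 \<bullet> v \<le> 0" if "v \<in> Y" for v using h(3)[OF that] d0 by (simp add: f4_def)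
  \<comment> \<open>The inequality passes to the boundary of \<open>Y\<close>, since adding a small
    positive multiple of \<open>a0\<close> to \<open>l\<close> makes the defining condition
    strict.\<close>
  have Yclos: "f4 \<bullet> (c *\<^sub>R zz + l) \<le> 0" if l: "l \<in> L" "c * (f2 \<bullet> a0) \<le> f2 \<bullet> l" for c l
  proof (rule ccontr)
    assume n: "\<not> ?thesis"
    have a0L: "a0 \<in> L" using a0(1) by (simp add: A_def)
    have *: "f4 \<bullet> (c *\<^sub>R zz + l) + e * (f4 \<bullet> a0) \<le> 0" if "e > 0" for e
    proof -
      have "0 < e * (f2 \<bullet> a0)" using f2a \<open>e > 0\<close> by simp
      then have "c *\<^sub>R zz + (l + e *\<^sub>R a0) \<in> Y" using l(2)
        by (intro YI Ladd Lscale l(1) a0L) (simp add: inner_add_right)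
      from Yneg[OF this] show ?thesis by (simp add: inner_add_right)
    qed
    define P where "P = f4 \<bullet> (c *\<^sub>R zz + l)"
    have P: "P > 0" using n by (simp add: P_def)
    have "P + (P / (2 * (\<bar>f4 \<bullet> a0\<bar> + 1))) * (f4 \<bullet> a0) \<le> 0"
      unfolding P_def by (rule *) (use P in \<open>simp add: P_def[symmetric]\<close>)
    moreover have "- (P / 2) \<le> (P / (2 * (\<bar>f4 \<bullet> a0\<bar> + 1))) * (f4 \<bullet> a0)"
    proof -
      have "\<bar>(P / (2 * (\<bar>f4 \<bullet> a0\<bar> + 1))) * (f4 \<bullet> a0)\<bar> = (P / 2) * (\<bar>f4 \<bullet> a0\<bar> / (\<bar>f4 \<bullet> a0\<bar> + 1))"
        using P by (simp add: abs_mult)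
      also have "\<dots> \<le> (P / 2) * 1" using P by (intro mult_left_mono) auto
      finally show ?thesis by linarith
    qed
    ultimately show False using P by linarith
  qed
  have f4k: "f4 \<bullet> (zz + a0) = 0"
  proof (rule antisym)
    show "f4 \<bullet> (zz + a0) \<le> 0" using Yclos[of a0 1] a0(1) by (simp add: A_def)
    show "0 \<le> f4 \<bullet> (zz + a0)" using a0(1) by (intro span_dualD(1)[OF f4(1)]) (simp add: A_def)
  qed
  have f4z: "0 < f4 \<bullet> zz" by (intro zpos f4)
  define c where "c = - (f4 \<bullet> a0) / (f2 \<bullet> a0)"
  have "f4 \<bullet> a0 < 0" using f4k f4z by (simp add: inner_add_right)
  then have cpos: "0 < c" using f2a by (simp add: c_def divide_neg_pos)
  \<comment> \<open>On the kernel of \<open>f2\<close> in \<open>L\<close>, \<open>Yclos\<close>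
    applies to both signs, so \<open>f4\<close> vanishes there and is a multiple of
    \<open>f2\<close> on \<open>L\<close>; the factor is read off at \<open>a0\<close>.\<close>
  have f4L: "f4 \<bullet> l = - (c * (f2 \<bullet> l))" if l: "l \<in> L" for l
  proof -
    have a0L: "a0 \<in> L" using a0(1) by (simp add: A_def)
    define l' where "l' = l + (- (f2 \<bullet> l / (f2 \<bullet> a0))) *\<^sub>R a0"
    have l': "l' \<in> L" unfolding l'_def by (intro Ladd Lscale l a0L)
    have "f2 \<bullet> l' = 0" using f2a by (simp add: l'_def inner_diff_right)
    then have "f4 \<bullet> l' \<le> 0" "f4 \<bullet> ((-1) *\<^sub>R l') \<le> 0"
      using Yclos[of l' 0] Yclos[of "(-1) *\<^sub>R l'" 0] l' Lscale[OF l', of "-1"] by auto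
    then have "f4 \<bullet> l' = 0" by simp
    then show ?thesis by (simp add: l'_def inner_diff_right c_def)
  qed
  define f2' where "f2' = c *\<^sub>R f2"
  have f2': "f2' \<in> span_dual C" "f2' \<noteq> 0" "f2' \<bullet> k2 = 0"
    using f2 cpos by (auto simp: f2'_def span_dual_scale)
  \<comment> \<open>\<open>a\<close> and \<open>b\<close> match the two sides of the relation at
    \<open>x\<close> and at \<open>y\<close>. On \<open>L\<close> both sides vanish, because
    \<open>f4\<close> and \<open>f2'\<close> are opposite there.\<close>
  define a where "a = ((f2' + f4) \<bullet> x) / (f3 \<bullet> x)"
  define b where "b = ((f2' + f4) \<bullet> y) / (f0 \<bullet> y)"
  have s4: "f2' + f4 \<in> span_dual C" by (intro span_dual_add f2' f4)
  have ab: "0 \<le> a" "0 \<le> b"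
    using span_dualD(1)[OF s4 x] span_dualD(1)[OF s4 y] z by (auto simp: a_def b_def)
  have "f2' + f4 - a *\<^sub>R f3 - b *\<^sub>R f0 = 0"
  proof (rule inner_zero_on_span[of _ C])
    show "f2' + f4 - a *\<^sub>R f3 - b *\<^sub>R f0 \<in> span C"
      by (intro span_diff span_scale span_dualD(2)[OF s4] span_dualD(2)[OF f3] span_dualD(2)[OF f0])
    fix v assume v: "v \<in> C"
    let ?g = "f2' + f4 - a *\<^sub>R f3 - b *\<^sub>R f0"
    define l where "l = v - (f3 \<bullet> v / (f3 \<bullet> x)) *\<^sub>R x - (f0 \<bullet> v / (f0 \<bullet> y)) *\<^sub>R y"
    have l: "l \<in> L" unfolding L_def l_def
      by (intro CollectI conjI slice_decomposition[OF z] span_diff span_scale span_base v x y)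
    have "?g \<bullet> l = 0" using f4L[OF l] l by (simp add: L_def inner_diff_left inner_add_left f2'_def)
    moreover have "?g \<bullet> x = 0" "?g \<bullet> y = 0" using z by (auto simp: inner_diff_left a_def b_def)
    moreover have "v = l + (f3 \<bullet> v / (f3 \<bullet> x)) *\<^sub>R x + (f0 \<bullet> v / (f0 \<bullet> y)) *\<^sub>R y" by (simp add: l_def)
    ultimately show "?g \<bullet> v = 0" by (metis add.right_neutral inner_add_right inner_scaleR_right mult_zero_right)
  qed
  then have sum: "f2' + f4 = a *\<^sub>R f3 + b *\<^sub>R f0" by (simp add: algebra_simps)
  \<comment> \<open>The factor \<tau> makes the parts along \<open>a0\<close> cancel in
    \<open>k2 + k4\<close>.\<close>
  define k4 where "k4 = \<tau> *\<^sub>R (zz + a0)"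
  have k4C: "k4 \<in> C" unfolding k4_def using \<tau>pos a0(1) by (intro pointed_cone_scale[OF C]) (auto simp: A_def)
  have "f4 \<bullet> k4 = 0" using f4k by (simp add: k4_def)
  moreover have "k2 + k4 = (1 + \<tau>) *\<^sub>R (x + y)"
    by (simp add: k2_def k4_def b0_def zz_def algebra_simps)
  moreover have "f0 \<bullet> k2 = f0 \<bullet> y" "f3 \<bullet> k2 = f3 \<bullet> x" "f0 \<bullet> k4 = \<tau> * (f0 \<bullet> y)" "f3 \<bullet> k4 = \<tau> * (f3 \<bullet> x)"
    using a0(1) b0A fz by (auto simp: k2_def k4_def A_def L_def inner_add_right)
  ultimately show ?thesis using that \<tau>pos k2C k4C f2' f4 ab sum by blast
qed

section \<open>Kites\<close>

text \<open>The four pairs would make the cone over a square a retract of \<open>C\<close> if in addition the values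
  \<open>f\<^sub>i k\<^sub>j\<close> with \<open>i \<noteq> j\<close> were those of the square; the strict inequalities are what remains of this.\<close>

definition kite_sandwich :: "'a::euclidean_space set \<Rightarrow> bool" where
  "kite_sandwich C \<longleftrightarrow> (\<exists>k1\<in>C. \<exists>k2\<in>C. \<exists>k3\<in>C. \<exists>k4\<in>C.
     \<exists>f1\<in>span_dual C. \<exists>f2\<in>span_dual C. \<exists>f3\<in>span_dual C. \<exists>f4\<in>span_dual C.
       k1 + k3 = k2 + k4 \<and> f1 + f3 = f2 + f4 \<and>
       f1 \<bullet> k1 = 0 \<and> f2 \<bullet> k2 = 0 \<and> f3 \<bullet> k3 = 0 \<and> f4 \<bullet> k4 = 0 \<and>
       (\<forall>v\<in>C. v \<noteq> 0 \<longrightarrow> 0 < (f1 + f2) \<bullet> v \<and> 0 < (f1 + f4) \<bullet> v) \<and>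
       0 < f3 \<bullet> k2 \<and> 0 < f3 \<bullet> k4)"

definition exposes_ray :: "'a::euclidean_space set \<Rightarrow> 'a \<Rightarrow> 'a \<Rightarrow> bool" where
  "exposes_ray C f y \<longleftrightarrow> f \<in> span_dual C \<and> y \<in> C \<and> y \<noteq> 0 \<and> f \<bullet> y = 0 \<and>
     (\<forall>v\<in>C. f \<bullet> v = 0 \<longrightarrow> (\<exists>c. v = c *\<^sub>R y))"

text \<open>Multiples of \<open>x\<close> and \<open>y\<close>, with \<open>b f0\<close> and
  \<open>a f3\<close> as functionals, complete the antipodal pair to a kite once
  \<open>b > 0\<close>; \<open>b = 0\<close> means that \<open>f2\<close> and \<open>f4\<close>
  vanish at \<open>y\<close>, the second alternative. By \<open>avoid\<close>, a vector
  \<open>k\<close> over the slice, whose values under \<open>f0\<close> and \<open>f3\<close> are in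
  the ratio of those at \<open>\<sigma> x + y\<close>, shares no supporting functional with the face
  of \<open>f0\<close>. Hence \<open>f2\<close> and \<open>f4\<close> are positive on that face,
  which gives \<open>a > 0\<close> and the strict positivity demanded of a kite.\<close>

lemma sandwich_from_slice:
  assumes C: "pointed_cone C" "\<not> simplicial_cone C" and y: "exposes_ray C f3 y"
    and f0: "f0 \<in> span_dual C" "0 < f0 \<bullet> y" and x: "x \<in> C" "f0 \<bullet> x = 0" "0 < f3 \<bullet> x"
    and \<sigma>: "0 < \<sigma>"
    and int: "\<And>f. f \<in> span_dual C \<Longrightarrow> f \<noteq> 0 \<Longrightarrow> f \<bullet> x = 0 \<Longrightarrow> f \<bullet> y \<noteq> 0"
    and avoid: "\<And>k f v. k \<in> C \<Longrightarrow> f \<in> span_dual C \<Longrightarrow> v \<in> exposed_by C f0 \<Longrightarrow> f \<noteq> 0 \<Longrightarrow> v \<noteq> 0 \<Longrightarrow>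
      f \<bullet> k = 0 \<Longrightarrow> f \<bullet> v = 0 \<Longrightarrow> 0 < f0 \<bullet> k \<Longrightarrow> (f3 \<bullet> k) * (f0 \<bullet> y) \<noteq> \<sigma> * (f3 \<bullet> x) * (f0 \<bullet> k)"
  shows "kite_sandwich C \<or> (\<exists>\<tau>>0. \<exists>k2\<in>C. \<exists>k4\<in>C. \<exists>f2\<in>span_dual C. \<exists>f4\<in>span_dual C.
    f2 \<noteq> 0 \<and> f4 \<noteq> 0 \<and> f2 \<bullet> k2 = 0 \<and> f4 \<bullet> k4 = 0 \<and> f2 \<bullet> y = 0 \<and> f4 \<bullet> y = 0 \<and>
    k2 + k4 = (1 + \<tau>) *\<^sub>R (\<sigma> *\<^sub>R x + y) \<and> f0 \<bullet> k2 = f0 \<bullet> y \<and> f3 \<bullet> k2 = \<sigma> * (f3 \<bullet> x))"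
proof -
  have f3: "f3 \<in> span_dual C" and yC: "y \<in> C" and f3y: "f3 \<bullet> y = 0" and y0: "y \<noteq> 0"
    and ray: "\<And>v. v \<in> C \<Longrightarrow> f3 \<bullet> v = 0 \<Longrightarrow> \<exists>c. v = c *\<^sub>R y"
    using y by (auto simp: exposes_ray_def)
  have sx: "\<sigma> *\<^sub>R x \<in> C" using \<sigma> by (intro pointed_cone_scale[OF C(1)] x) simp
  have nn: "0 \<le> f \<bullet> v" if "f \<in> span_dual C" "v \<in> C" for f v using span_dualD(1)[OF that] .
  have z: "f0 \<bullet> (\<sigma> *\<^sub>R x) = 0" "f3 \<bullet> y = 0" "0 < f3 \<bullet> (\<sigma> *\<^sub>R x)" "0 < f0 \<bullet> y"
    using x f3y f0 \<sigma> by auto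
  obtain l0 where l0: "l0 \<in> span C" "f0 \<bullet> l0 = 0" "f3 \<bullet> l0 = 0" "l0 \<noteq> 0"
    using trivial_slice_imp_simplicial[OF C(1) sx yC f0(1) f3 z] C(2) by blast
  have pos: "0 < f0 \<bullet> v + f3 \<bullet> v" if v: "v \<in> C" "v \<noteq> 0" for v
  proof (cases "f3 \<bullet> v = 0")
    case True
    obtain c where c: "v = c *\<^sub>R y" using ray[OF v(1) True] by blast
    have "c * (f0 \<bullet> y) \<ge> 0" "c \<noteq> 0" using nn[OF f0(1) v(1)] v c by auto
    then show ?thesis using f0(2) c f3y by (simp add: zero_le_mult_iff)
  next
    case False
    then show ?thesis using nn[OF f0(1) v(1)] nn[OF f3 v(1)] by linarith
  qed
  have int': "0 < f \<bullet> (\<sigma> *\<^sub>R x) + f \<bullet> y" if f: "f \<in> span_dual C" "f \<noteq> 0" for f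
  proof (rule ccontr)
    assume n: "\<not> ?thesis"
    have "0 \<le> f \<bullet> (\<sigma> *\<^sub>R x)" "0 \<le> f \<bullet> y" by (intro nn f sx yC)+
    then have "f \<bullet> (\<sigma> *\<^sub>R x) = 0" "f \<bullet> y = 0" using n by linarith+
    then show False using int[OF f] \<sigma> by simp
  qed
  obtain \<tau> k2 k4 f2 f4 a b where *: "0 < \<tau>" "k2 \<in> C" "k4 \<in> C" "f2 \<in> span_dual C" "f4 \<in> span_dual C"
    "f2 \<noteq> 0" "f4 \<noteq> 0" "0 \<le> a" "0 \<le> b" "k2 + k4 = (1 + \<tau>) *\<^sub>R (\<sigma> *\<^sub>R x + y)"
    "f2 \<bullet> k2 = 0" "f4 \<bullet> k4 = 0" "f2 + f4 = a *\<^sub>R f3 + b *\<^sub>R f0"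
    "f0 \<bullet> k2 = f0 \<bullet> y" "f3 \<bullet> k2 = f3 \<bullet> (\<sigma> *\<^sub>R x)" "f0 \<bullet> k4 = \<tau> * (f0 \<bullet> y)" "f3 \<bullet> k4 = \<tau> * (f3 \<bullet> (\<sigma> *\<^sub>R x))"
    using antipodal_supports[OF C(1) sx yC f0(1) f3 z pos int' l0(1) l0(4) l0(2) l0(3)] by blast
  have f2pos: "0 < f2 \<bullet> v" if v: "v \<in> C" "v \<noteq> 0" "f0 \<bullet> v = 0" for v
  proof (rule ccontr)
    assume "\<not> ?thesis"
    then have "f2 \<bullet> v = 0" using nn[OF *(4) v(1)] by linarith
    then show False
      using avoid[OF *(2,4) _ *(6) v(2) *(11)] v f0(2) *(14,15) by (simp add: exposed_by_def)
  qed
  have f4pos: "0 < f4 \<bullet> v" if v: "v \<in> C" "v \<noteq> 0" "f0 \<bullet> v = 0" for v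
  proof (rule ccontr)
    assume "\<not> ?thesis"
    then have "f4 \<bullet> v = 0" using nn[OF *(5) v(1)] by linarith
    then show False
      using avoid[OF *(3,5) _ *(7) v(2) *(12)] v f0(2) *(1,16,17) by (simp add: exposed_by_def)
  qed
  have x0: "x \<noteq> 0" using x(3) by auto
  show ?thesis
  proof (cases "b = 0")
    case True
    have "(f2 + f4) \<bullet> y = 0" using *(13) True f3y by simp
    then have "f2 \<bullet> y = 0" "f4 \<bullet> y = 0"
      using nn[OF *(4) yC] nn[OF *(5) yC] by (auto simp: inner_add_left)
    moreover have "f3 \<bullet> k2 = \<sigma> * (f3 \<bullet> x)" using *(15) by simp
    ultimately show ?thesis using * by blast
  next
    case False
    then have b: "b > 0" using *(9) by simp
    have "(f2 + f4) \<bullet> x = a * (f3 \<bullet> x)" using *(13) x(2) by (simp add: inner_add_left)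
    moreover have "(f2 + f4) \<bullet> x > 0" using f2pos[OF x(1) x0 x(2)] f4pos[OF x(1) x0 x(2)] by (simp add: inner_add_left)
    ultimately have a: "a > 0" using x(3) by (simp add: zero_less_mult_iff)
    have F: "0 < (b *\<^sub>R f0 + f) \<bullet> v"
      if "v \<in> C" "v \<noteq> 0" "f \<in> span_dual C" "f0 \<bullet> v = 0 \<Longrightarrow> 0 < f \<bullet> v" for f v
    proof (cases "f0 \<bullet> v = 0")
      case False
      then have "0 < f0 \<bullet> v" using nn[OF f0(1) that(1)] by linarith
      then show ?thesis using b nn[OF that(3,1)] by (simp add: inner_add_left add_pos_nonneg)
    qed (use that in \<open>simp add: inner_add_left\<close>)
    have "kite_sandwich C"
      unfolding kite_sandwich_def
    proof (intro bexI conjI ballI impI)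
      show "(1 + \<tau>) *\<^sub>R (\<sigma> *\<^sub>R x) + (1 + \<tau>) *\<^sub>R y = k2 + k4" using *(10) by (simp add: scaleR_add_right)
      show "b *\<^sub>R f0 + a *\<^sub>R f3 = f2 + f4" using *(13) by (simp add: add.commute)
      show "0 < (b *\<^sub>R f0 + f2) \<bullet> v" if "v \<in> C" "v \<noteq> 0" for v using F[OF that *(4)] f2pos[OF that] by blast
      show "0 < (b *\<^sub>R f0 + f4) \<bullet> v" if "v \<in> C" "v \<noteq> 0" for v using F[OF that *(5)] f4pos[OF that] by blast
      show "0 < (a *\<^sub>R f3) \<bullet> k2" "0 < (a *\<^sub>R f3) \<bullet> k4" using a *(1,15,17) \<sigma> x(3) by auto
      show "(1 + \<tau>) *\<^sub>R (\<sigma> *\<^sub>R x) \<in> C" "(1 + \<tau>) *\<^sub>R y \<in> C"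
        by (rule pointed_cone_scale[OF C(1)]; use sx yC *(1) in simp)+
    qed (use * a b f0 f3 x f3y in \<open>auto simp: span_dual_scale\<close>)
    then show ?thesis by blast
  qed
qed

section \<open>Exposed rays and the cone generated around one of them\<close>

lemma exposed_ray_exists:
  assumes C: "pointed_cone C" "C \<noteq> {0}"
  obtains f y where "exposes_ray C f y"
proof -
  obtain q where q: "q \<in> span_dual C" "\<And>v. v \<in> C \<Longrightarrow> v \<noteq> 0 \<Longrightarrow> 0 < q \<bullet> v"
    using strictly_positive_functional[OF C(1)] by blast
  obtain m where m: "m > 0" "\<And>v. v \<in> C \<Longrightarrow> m * norm v \<le> q \<bullet> v"
    using positive_functional_norm_bound[OF C(1) q(2)] by blast
  define K where "K = C \<inter> {v. q \<bullet> v = 1}"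
  have "bounded K"
    unfolding bounded_iff
  proof (intro exI ballI)
    fix v assume "v \<in> K"
    then show "norm v \<le> 1 / m" using m(2)[of v] m(1) by (simp add: K_def field_simps)
  qed
  moreover have "closed K" unfolding K_def by (intro closed_Int closed_hyperplane pointed_coneD C)
  ultimately have cpt: "compact K" by (simp add: compact_eq_bounded_closed)
  have KI: "(1 / (q \<bullet> v)) *\<^sub>R v \<in> K" if "v \<in> C" "v \<noteq> 0" for v
    using q(2)[OF that] that unfolding K_def by (simp add: pointed_cone_scale[OF C(1)])
  obtain v0 where "v0 \<in> C" "v0 \<noteq> 0" using C pointed_cone_0[OF C(1)] by blast
  then have ne: "K \<noteq> {}" using KI by blast
  \<comment> \<open>A point of the base \<open>K\<close> farthest from the origin is exposed: the
    tangent hyperplane to the sphere through it meets \<open>K\<close> only there. \<open>f\<close>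
    is that hyperplane made homogeneous by means of \<open>q\<close>, which is 1 on
    \<open>K\<close>.\<close>
  have "continuous_on K (\<lambda>v. norm v)" by (intro continuous_intros)
  then obtain y where y: "y \<in> K" "\<And>v. v \<in> K \<Longrightarrow> norm v \<le> norm y"
    using continuous_attains_sup[OF cpt ne] by blast
  have yC: "y \<in> C" "q \<bullet> y = 1" using y(1) by (auto simp: K_def)
  define f where "f = (y \<bullet> y) *\<^sub>R q - y"
  have *: "0 \<le> f \<bullet> v \<and> (f \<bullet> v = 0 \<longrightarrow> v = (q \<bullet> v) *\<^sub>R y)" if v: "v \<in> C" "v \<noteq> 0" for v
  proof -
    define k where "k = (1 / (q \<bullet> v)) *\<^sub>R v"
    have qv: "0 < q \<bullet> v" by (rule q(2)[OF v])
    have k: "k \<in> K" unfolding k_def by (rule KI[OF v])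
    have vk: "v = (q \<bullet> v) *\<^sub>R k" using qv by (simp add: k_def)
    have fk: "f \<bullet> k = y \<bullet> y - y \<bullet> k" using k by (simp add: f_def K_def inner_diff_left)
    have "k \<bullet> k \<le> y \<bullet> y" using y(2)[OF k] by (simp add: norm_le)
    then have le: "(y - k) \<bullet> (y - k) \<le> 2 * (f \<bullet> k)"
      by (simp add: fk inner_diff_left inner_diff_right inner_commute)
    have ge: "0 \<le> (y - k) \<bullet> (y - k)" by (rule inner_ge_zero)
    have 1: "0 \<le> f \<bullet> k" using le ge by linarith
    have 2: "y = k" if "f \<bullet> k = 0"
    proof -
      have "(y - k) \<bullet> (y - k) = 0" using le ge that by linarith
      then show ?thesis by simp
    qed
    have "f \<bullet> v = (q \<bullet> v) * (f \<bullet> k)" by (subst vk) simp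
    then show ?thesis using 1 2 qv vk by auto
  qed
  have "exposes_ray C f y"
    unfolding exposes_ray_def
  proof (intro conjI ballI impI)
    have "f \<in> span C" unfolding f_def by (intro span_diff span_scale span_dualD(2)[OF q(1)] span_base yC)
    moreover have "0 \<le> f \<bullet> v" if "v \<in> C" for v using *[of v] that by (cases "v = 0") auto
    ultimately show "f \<in> span_dual C" by (simp add: span_dual_def)
    show "\<exists>c. v = c *\<^sub>R y" if "v \<in> C" "f \<bullet> v = 0" for v using *[of v] that by (cases "v = 0") (auto intro: exI[of _ 0])
    show "f \<bullet> y = 0" using yC by (simp add: f_def inner_diff_left)
  qed (use yC in auto)
  then show ?thesis using that by blast
qed

text \<open>The least \<open>t\<close> making \<open>h + t f3\<close> nonnegative on
  \<open>C\<close> is the maximum of \<open>- h / f3\<close> over the unit vectors with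
  \<open>h \<le> 0\<close>. There \<open>f3\<close> is positive, because it vanishes only on the ray
  of \<open>y\<close>, where \<open>h\<close> is positive. At a nonzero contact point
  \<open>f3\<close> is therefore positive and \<open>h\<close> negative.\<close>

lemma supporting_shift:
  assumes C: "pointed_cone C" and y: "exposes_ray C f3 y"
    and h: "h \<in> span C" "0 < h \<bullet> y" and c: "c \<in> C" "h \<bullet> c < 0"
  obtains t x where "0 < t" "x \<in> C" "x \<noteq> 0" "h + t *\<^sub>R f3 \<in> span_dual C" "(h + t *\<^sub>R f3) \<bullet> x = 0"
    "\<And>v. v \<in> C \<Longrightarrow> v \<noteq> 0 \<Longrightarrow> (h + t *\<^sub>R f3) \<bullet> v = 0 \<Longrightarrow> h \<bullet> v < 0 \<and> 0 < f3 \<bullet> v"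
proof -
  have f3: "f3 \<in> span_dual C" and ray: "\<And>v. v \<in> C \<Longrightarrow> f3 \<bullet> v = 0 \<Longrightarrow> \<exists>c. v = c *\<^sub>R y"
    and yC: "y \<in> C" "y \<noteq> 0" "f3 \<bullet> y = 0"
    using y by (auto simp: exposes_ray_def)
  have f3pos: "0 < f3 \<bullet> v" if v: "v \<in> C" "v \<noteq> 0" "h \<bullet> v \<le> 0" for v
  proof (rule ccontr)
    assume "\<not> ?thesis"
    then have "f3 \<bullet> v = 0" using span_dualD(1)[OF f3 v(1)] by linarith
    then obtain d where d: "v = d *\<^sub>R y" using ray[OF v(1)] by blast
    have "d * (h \<bullet> y) \<le> 0" using v(3) d by simp
    then have "d \<le> 0" using h(2) by (simp add: mult_le_0_iff)
    then have "- v \<in> C" using pointed_cone_scale[OF C yC(1), of "- d"] d by simp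
    then show False using pointed_cone_antisym[OF C v(1)] v(2) by blast
  qed
  define Z where "Z = (C \<inter> sphere 0 1) \<inter> {v. h \<bullet> v \<le> 0}"
  have cpt: "compact Z" unfolding Z_def
    by (intro compact_Int_closed closed_Int_compact closed_halfspace_le pointed_coneD C) simp
  have ZI: "(1 / norm v) *\<^sub>R v \<in> Z" if "v \<in> C" "v \<noteq> 0" "h \<bullet> v \<le> 0" for v
    using that by (simp add: Z_def pointed_cone_scale[OF C] divide_nonpos_pos)
  have "c \<noteq> 0" using c by auto
  then have ne: "Z \<noteq> {}" using ZI[OF c(1)] c(2) by auto
  have Z: "v \<in> C" "v \<noteq> 0" "h \<bullet> v \<le> 0" if "v \<in> Z" for v using that by (auto simp: Z_def)
  have Zpos: "0 < f3 \<bullet> v" "v \<in> C" "v \<noteq> 0" if "v \<in> Z" for v using Z[OF that] f3pos[of v] by auto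
  have "continuous_on Z (\<lambda>v. - (h \<bullet> v) / (f3 \<bullet> v))"
    by (intro continuous_intros) (use Zpos in force)
  then obtain x where x: "x \<in> Z" "\<And>v. v \<in> Z \<Longrightarrow> - (h \<bullet> v) / (f3 \<bullet> v) \<le> - (h \<bullet> x) / (f3 \<bullet> x)"
    using continuous_attains_sup[OF cpt ne] by blast
  define t where "t = - (h \<bullet> x) / (f3 \<bullet> x)"
  have bound: "- (h \<bullet> v) \<le> t * (f3 \<bullet> v)" if v: "v \<in> C" "v \<noteq> 0" "h \<bullet> v \<le> 0" for v
    using x(2)[OF ZI[OF v]] f3pos[OF v] v by (simp add: t_def field_simps)
  have "0 < t * (f3 \<bullet> c)" using bound[OF c(1) \<open>c \<noteq> 0\<close>] c(2) by linarith
  moreover have "0 < f3 \<bullet> c" using f3pos[OF c(1) \<open>c \<noteq> 0\<close>] c(2) by linarith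
  ultimately have t: "0 < t" by (simp add: zero_less_mult_iff)
  have val: "(h + t *\<^sub>R f3) \<bullet> v = h \<bullet> v + t * (f3 \<bullet> v)" for v by (simp add: inner_add_left)
  have ge: "0 \<le> h \<bullet> v + t * (f3 \<bullet> v)" if "v \<in> C" for v
  proof (cases "v \<noteq> 0 \<and> h \<bullet> v \<le> 0")
    case True
    then show ?thesis using bound[OF that] by linarith
  next
    case False
    then show ?thesis using t span_dualD(1)[OF f3 that] by (cases "v = 0") auto
  qed
  show ?thesis
  proof (rule that[of t x])
    show "h + t *\<^sub>R f3 \<in> span_dual C"
      using ge h(1) span_dualD(2)[OF f3] by (simp add: span_dual_def val span_add span_scale)
    show "(h + t *\<^sub>R f3) \<bullet> x = 0" using Zpos[OF x(1)] unfolding val by (simp add: t_def)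
    show "h \<bullet> v < 0 \<and> 0 < f3 \<bullet> v" if v: "v \<in> C" "v \<noteq> 0" "(h + t *\<^sub>R f3) \<bullet> v = 0" for v
    proof -
      have e: "h \<bullet> v + t * (f3 \<bullet> v) = 0" using v(3) val by simp
      have "0 \<le> t * (f3 \<bullet> v)" using t span_dualD(1)[OF f3 v(1)] by simp
      then have "h \<bullet> v \<le> 0" using e by linarith
      from f3pos[OF v(1,2) this] show ?thesis using e t by (smt (verit) mult_pos_pos)
    qed
  qed (use t Zpos[OF x(1)] in auto)
qed

lemma exposes_ray_nonzero:
  assumes "pointed_cone C" "\<not> simplicial_cone C" "exposes_ray C f y"
  shows "f \<noteq> 0"
proof
  assume "f = 0"
  then have *: "\<exists>c. v = c *\<^sub>R y" if "v \<in> C" for v using assms(3) that by (auto simp: exposes_ray_def)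
  have y: "y \<in> C" "y \<noteq> 0" using assms(3) by (auto simp: exposes_ray_def)
  have "C = convex_cone hull {y}"
  proof
    show "convex_cone hull {y} \<subseteq> C" by (rule hull_minimal) (use y assms in \<open>auto simp: pointed_coneD\<close>)
    show "C \<subseteq> convex_cone hull {y}"
    proof
      fix v assume v: "v \<in> C"
      then obtain c where c: "v = c *\<^sub>R y" using * by blast
      have "0 \<le> c"
      proof (rule ccontr)
        assume n: "\<not> 0 \<le> c"
        then have "- v \<in> C" using pointed_cone_scale[OF assms(1) y(1), of "- c"] c by simp
        then show False using pointed_cone_antisym[OF assms(1) v] c n y(2) by simp
      qed
      then show "v \<in> convex_cone hull {y}" unfolding c by (intro convex_cone_hull_mul hull_inc) auto
    qed
  qed
  then have "simplicial_cone C"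
    unfolding simplicial_cone_def using y(2) by (intro exI[of _ "{y}"]) auto
  then show False using assms(2) by blast
qed

text \<open>The normals at \<open>y\<close> are nonnegative combinations of \<open>B\<close>, and a
  vanishing sum of nonnegative terms vanishes term by term. So the points sharing a supporting
  functional with \<open>y\<close>, its star, lie in the faces exposed by \<open>B\<close>.\<close>

lemma normal_in_generated_face:
  assumes B: "finite B" "exposed_by (span_dual C) y = convex_cone hull B"
    and f: "f \<in> span_dual C" "f \<noteq> 0" "f \<bullet> y = 0" and k: "k \<in> C" "f \<bullet> k = 0"
  obtains g where "g \<in> B" "k \<in> exposed_by C g"
proof -
  have gC: "g \<in> span_dual C" if "g \<in> B" for g
    using hull_inc[OF that, of convex_cone] B(2) by (auto simp: exposed_by_def)
  have "f \<in> convex_cone hull B" using f B(2) by (auto simp: exposed_by_def inner_commute)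
  then obtain c where c: "\<And>g. g \<in> B \<Longrightarrow> 0 \<le> c g" "f = (\<Sum>g\<in>B. c g *\<^sub>R g)"
    using convex_cone_hull_finite[OF B(1)] by blast
  have "\<exists>g\<in>B. c g \<noteq> 0" using c(2) f(2) by (metis (no_types, lifting) scale_zero_left sum.neutral)
  then obtain g where g: "g \<in> B" "c g \<noteq> 0" by blast
  have s0: "(\<Sum>g\<in>B. c g * (g \<bullet> k)) = 0" using k(2) c(2) by (simp add: inner_sum_left)
  have nn: "0 \<le> c g * (g \<bullet> k)" if "g \<in> B" for g
    using c(1)[OF that] span_dualD(1)[OF gC[OF that] k(1)] by simp
  have "c g * (g \<bullet> k) = 0" by (rule sum_nonneg_0[OF B(1) nn s0 g(1)])
  then show ?thesis using that g k by (auto simp: exposed_by_def)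
qed

text \<open>A functional \<open>h\<close> separating some \<open>c\<close> from the generated cone
  vanishes at \<open>y\<close>, as \<open>y\<close> and \<open>- y\<close> both belong to that cone,
  and is nonnegative on the star of \<open>y\<close>. A perturbed and shifted \<open>h\<close>
  supports \<open>C\<close> at an \<open>x\<close> outside the star. Without a kite, the slice
  argument then gives \<open>k2\<close> and \<open>k4\<close> in the star whose sum is a multiple of
  \<open>\<sigma> x + y\<close>, although \<open>h\<close> is negative at \<open>x\<close>.\<close>

lemma cone_subset_star_cone:
  assumes C: "pointed_cone C" "\<not> simplicial_cone C" "\<not> kite_sandwich C" and y: "exposes_ray C f3 y"
    and B: "finite B" "exposed_by (span_dual C) y = convex_cone hull B"
    and V: "finite V" "V \<subseteq> C" "\<And>g. g \<in> B \<Longrightarrow> exposed_by C g \<subseteq> convex_cone hull V"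
  shows "C \<subseteq> convex_cone hull (insert (- y) V)"
proof
  fix c assume cC: "c \<in> C"
  define E where "E = convex_cone hull (insert (- y) V)"
  have f3: "f3 \<in> span_dual C" "f3 \<noteq> 0" and ray: "\<And>v. v \<in> C \<Longrightarrow> f3 \<bullet> v = 0 \<Longrightarrow> \<exists>c. v = c *\<^sub>R y"
    and yC: "y \<in> C" "y \<noteq> 0" "f3 \<bullet> y = 0"
    using y exposes_ray_nonzero[OF C(1,2) y] by (auto simp: exposes_ray_def)
  have E: "convex_cone E" "closed E" unfolding E_def
    using V(1) by (auto intro: convex_cone_convex_cone_hull closed_convex_cone_hull)
  have star: "k \<in> E" if fk: "f \<in> span_dual C" "f \<noteq> 0" "f \<bullet> y = 0" "k \<in> C" "f \<bullet> k = 0" for f k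
  proof -
    obtain g where "g \<in> B" "k \<in> exposed_by C g" by (rule normal_in_generated_face[OF B fk])
    then have "k \<in> convex_cone hull V" using V(3) by blast
    then show ?thesis using hull_mono[OF subset_insertI, of convex_cone V "- y"] by (auto simp: E_def)
  qed
  have yE: "y \<in> E" by (rule star[OF f3 yC(3,1,3)])
  have myE: "- y \<in> E" unfolding E_def by (rule hull_inc) simp
  have Espan: "E \<subseteq> span C"
    unfolding E_def by (rule hull_minimal)
      (use V(2) yC(1) in \<open>auto simp: convex_cone_span span_base span_neg\<close>)
  show "c \<in> convex_cone hull (insert (- y) V)"
  proof (rule ccontr)
    assume "c \<notin> convex_cone hull (insert (- y) V)"
    then have "c \<notin> E" by (simp add: E_def)
    then obtain h where h: "h \<in> span C" "\<And>v. v \<in> E \<Longrightarrow> 0 \<le> h \<bullet> v" "h \<bullet> c < 0"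
      using convex_cone_separate_span[OF E _ span_base[OF cC] Espan] by blast
    obtain q where q: "q \<in> span_dual C" "\<And>v. v \<in> C \<Longrightarrow> v \<noteq> 0 \<Longrightarrow> 0 < q \<bullet> v"
      using strictly_positive_functional[OF C(1)] by blast
    have c0: "c \<noteq> 0" using h(3) by auto
    \<comment> \<open>Chosen so that \<open>h'\<close> at \<open>c\<close> is still half of
      \<open>h\<close>, while the perturbation makes \<open>h'\<close> strictly positive on the
      star.\<close>
    define \<eta> where "\<eta> = - (h \<bullet> c) / (2 * (q \<bullet> c))"
    have \<eta>: "0 < \<eta>" using h(3) q(2)[OF cC c0] by (simp add: \<eta>_def divide_neg_pos)
    define h' where "h' = h + \<eta> *\<^sub>R q"
    have h'v: "h' \<bullet> v = h \<bullet> v + \<eta> * (q \<bullet> v)" for v by (simp add: h'_def inner_add_left)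
    have h'E: "0 < h' \<bullet> v" if "v \<in> E" "v \<in> C" "v \<noteq> 0" for v
      using h(2)[OF that(1)] q(2)[OF that(2,3)] \<eta> by (simp add: h'v add_nonneg_pos)
    have h'c: "h' \<bullet> c < 0" using h(3) q(2)[OF cC c0] by (simp add: h'v \<eta>_def field_simps)
    have h'y: "0 < h' \<bullet> y" by (rule h'E[OF yE yC(1,2)])
    have h's: "h' \<in> span C" unfolding h'_def by (intro span_add span_scale h span_dualD(2)[OF q(1)])
    obtain t x where tx: "0 < t" "x \<in> C" "x \<noteq> 0" "h' + t *\<^sub>R f3 \<in> span_dual C"
      "(h' + t *\<^sub>R f3) \<bullet> x = 0"
      "\<And>v. v \<in> C \<Longrightarrow> v \<noteq> 0 \<Longrightarrow> (h' + t *\<^sub>R f3) \<bullet> v = 0 \<Longrightarrow> h' \<bullet> v < 0 \<and> 0 < f3 \<bullet> v"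
      using supporting_shift[OF C(1) y h's h'y cC h'c] by blast
    define f0 where "f0 = h' + t *\<^sub>R f3"
    note f0 = tx(4,5,6)[folded f0_def]
    have f0y: "0 < f0 \<bullet> y" using h'y yC(3) by (simp add: f0_def inner_add_left)
    have xx: "h' \<bullet> x < 0" "0 < f3 \<bullet> x" using f0(3)[OF tx(2,3) f0(2)] by auto
    have notstar: False if "f \<in> span_dual C" "f \<noteq> 0" "f \<bullet> y = 0" "v \<in> C" "v \<noteq> 0" "f0 \<bullet> v = 0" "f \<bullet> v = 0" for f v
      using f0(3)[OF that(4,5,6)] h'E[OF star[OF that(1,2,3,4,7)] that(4,5)] by linarith
    have X: "closed (exposed_by C f0)" "\<And>v c. v \<in> exposed_by C f0 \<Longrightarrow> 0 \<le> c \<Longrightarrow> c *\<^sub>R v \<in> exposed_by C f0"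
      using exposed_by_pointed_cone[OF C(1)] by (auto simp: pointed_coneD pointed_cone_scale)
    have "0 < f3 \<bullet> k" if kfv: "k \<in> C" "f \<in> span_dual C" "v \<in> exposed_by C f0" "k \<noteq> 0" "f \<noteq> 0" "v \<noteq> 0"
      "f \<bullet> k = 0" "f \<bullet> v = 0" for k f v
    proof (rule ccontr)
      assume "\<not> ?thesis"
      then have "f3 \<bullet> k = 0" using span_dualD(1)[OF f3(1) that(1)] by linarith
      then obtain d where "k = d *\<^sub>R y" using ray[OF kfv(1)] by blast
      then have "f \<bullet> y = 0" using kfv by auto
      then show False using notstar[OF kfv(2,5)] kfv by (auto simp: exposed_by_def)
    qed
    then obtain \<rho> where \<rho>: "\<rho> > 0" "\<And>k f v. k \<in> C \<Longrightarrow> f \<in> span_dual C \<Longrightarrow> v \<in> exposed_by C f0 \<Longrightarrow>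
        f \<noteq> 0 \<Longrightarrow> v \<noteq> 0 \<Longrightarrow> f \<bullet> k = 0 \<Longrightarrow> f \<bullet> v = 0 \<Longrightarrow> \<rho> * norm k \<le> f3 \<bullet> k"
      using common_zero_bound[OF C(1) X, of f3] by blast
    \<comment> \<open>So small that a \<open>k\<close> over the slice, for which
      \<open>f3 k = \<sigma> (f3 x) (f0 k) / (f0 y)\<close>, violates the bound
      \<open>\<rho> |k| \<le> f3 k\<close>.\<close>
    define \<sigma> where "\<sigma> = \<rho> * (f0 \<bullet> y) / ((f3 \<bullet> x) * (norm f0 + 1))"
    have nf: "0 < norm f0 + 1" by (simp add: add_nonneg_pos)
    have \<sigma>: "0 < \<sigma>" using \<rho>(1) f0y xx(2) nf by (simp add: \<sigma>_def)
    have avoid: "(f3 \<bullet> k) * (f0 \<bullet> y) \<noteq> \<sigma> * (f3 \<bullet> x) * (f0 \<bullet> k)" if *: "k \<in> C" "f \<in> span_dual C" "v \<in> exposed_by C f0" "f \<noteq> 0" "v \<noteq> 0"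
      "f \<bullet> k = 0" "f \<bullet> v = 0" "0 < f0 \<bullet> k" for k f v
    proof
      assume eq: "(f3 \<bullet> k) * (f0 \<bullet> y) = \<sigma> * (f3 \<bullet> x) * (f0 \<bullet> k)"
      have k0: "0 < norm k" using *(8) by auto
      have "\<rho> * norm k * (f0 \<bullet> y) \<le> (f3 \<bullet> k) * (f0 \<bullet> y)"
        using \<rho>(2)[OF *(1-7)] f0y by (intro mult_right_mono) auto
      also have "\<dots> = \<rho> * (f0 \<bullet> y) * (f0 \<bullet> k) / (norm f0 + 1)" using eq xx(2) nf by (simp add: \<sigma>_def)
      also have "\<dots> \<le> \<rho> * (f0 \<bullet> y) * (norm f0 * norm k) / (norm f0 + 1)"
        using \<rho>(1) f0y nf norm_cauchy_schwarz[of f0 k] by (intro divide_right_mono mult_left_mono) auto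
      also have "\<dots> < \<rho> * (f0 \<bullet> y) * ((norm f0 + 1) * norm k) / (norm f0 + 1)"
        using \<rho>(1) f0y nf k0 by (intro divide_strict_right_mono mult_strict_left_mono) (auto simp: distrib_right)
      also have "\<dots> = \<rho> * norm k * (f0 \<bullet> y)" using nf by simp
      finally show False by simp
    qed
    have int: "f \<bullet> y \<noteq> 0" if "f \<in> span_dual C" "f \<noteq> 0" "f \<bullet> x = 0" for f
      using notstar[OF that(1,2) _ tx(2,3) f0(2) that(3)] by blast
    have "kite_sandwich C \<or> (\<exists>\<tau>>0. \<exists>k2\<in>C. \<exists>k4\<in>C. \<exists>f2\<in>span_dual C. \<exists>f4\<in>span_dual C.
      f2 \<noteq> 0 \<and> f4 \<noteq> 0 \<and> f2 \<bullet> k2 = 0 \<and> f4 \<bullet> k4 = 0 \<and> f2 \<bullet> y = 0 \<and> f4 \<bullet> y = 0 \<and>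
      k2 + k4 = (1 + \<tau>) *\<^sub>R (\<sigma> *\<^sub>R x + y) \<and> f0 \<bullet> k2 = f0 \<bullet> y \<and> f3 \<bullet> k2 = \<sigma> * (f3 \<bullet> x))"
      by (rule sandwich_from_slice[OF C(1,2) y f0(1) f0y tx(2) f0(2) xx(2) \<sigma>]; fact int avoid)
    then obtain \<tau> k2 k4 f2 f4 where *: "\<tau> > 0" "k2 \<in> C" "k4 \<in> C" "f2 \<in> span_dual C" "f4 \<in> span_dual C"
      "f2 \<noteq> 0" "f4 \<noteq> 0" "f2 \<bullet> k2 = 0" "f4 \<bullet> k4 = 0" "f2 \<bullet> y = 0" "f4 \<bullet> y = 0"
      "k2 + k4 = (1 + \<tau>) *\<^sub>R (\<sigma> *\<^sub>R x + y)"
      using C(3) by blast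
    have "k2 \<in> E" "k4 \<in> E" using star[OF *(4,6,10,2,8)] star[OF *(5,7,11,3,9)] by auto
    then have "0 \<le> h \<bullet> (k2 + k4)" using h(2) by (simp add: inner_add_right)
    then have "0 \<le> (1 + \<tau>) * (\<sigma> * (h \<bullet> x) + h \<bullet> y)" by (simp add: *(12) inner_add_right)
    moreover have "h \<bullet> y = 0" using h(2)[OF yE] h(2)[OF myE] by simp
    ultimately have "0 \<le> (1 + \<tau>) * \<sigma> * (h \<bullet> x)" by (simp add: mult.assoc)
    moreover have "0 < (1 + \<tau>) * \<sigma>" using *(1) \<sigma> by simp
    ultimately have "0 \<le> h \<bullet> x" by (metis mult_less_0_iff not_le)
    moreover have "0 < \<eta> * (q \<bullet> x)" using q(2)[OF tx(2,3)] \<eta> by simp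
    then have "h \<bullet> x < 0" using xx(1) by (simp add: h'v)
    ultimately show False by simp
  qed
qed

text \<open>\<open>w\<close> is the component of \<open>b\<close> orthogonal to the span of the
  other elements.\<close>

lemma dual_vector:
  fixes B :: "'a::euclidean_space set"
  assumes "independent B" "b \<in> B"
  obtains w where "w \<in> span B" "0 < w \<bullet> b" "\<And>a. a \<in> B \<Longrightarrow> a \<noteq> b \<Longrightarrow> w \<bullet> a = 0"
proof -
  obtain p w where pw: "p \<in> span (B - {b})" "\<And>u. u \<in> span (B - {b}) \<Longrightarrow> orthogonal w u" "b = p + w"
    using orthogonal_subspace_decomp_exists[of "B - {b}" b] by blast
  have "b \<notin> span (B - {b})" using assms by (auto simp: dependent_def)
  then have "w \<noteq> 0" using pw by auto
  moreover have "w \<bullet> p = 0" using pw by (auto simp: orthogonal_def)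
  ultimately have "0 < w \<bullet> b" by (simp add: pw(3) inner_add_right)
  moreover have "w \<bullet> a = 0" if "a \<in> B" "a \<noteq> b" for a
    using pw(2)[OF span_base, of a] that by (simp add: orthogonal_def)
  moreover have "w \<in> span B"
  proof -
    have "b - p \<in> span B"
      by (rule span_diff) (use assms(2) pw(1) span_mono[of "B - {b}" B] in \<open>auto simp: span_base\<close>)
    then show ?thesis using pw(3) by simp
  qed
  ultimately show ?thesis using that by blast
qed

definition extreme_ray :: "'a::euclidean_space set \<Rightarrow> 'a \<Rightarrow> bool" where
  "extreme_ray C e \<longleftrightarrow> e \<in> C \<and> e \<noteq> 0 \<and> (\<forall>u\<in>C. \<forall>w\<in>C. e = u + w \<longrightarrow> (\<exists>c. u = c *\<^sub>R e))"

lemma exposed_sum: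
  assumes "f \<in> span_dual C" "u \<in> C" "w \<in> C" "f \<bullet> (u + w) = 0"
  shows "f \<bullet> u = 0" "f \<bullet> w = 0"
  using span_dualD(1)[OF assms(1,2)] span_dualD(1)[OF assms(1,3)] assms(4) by (auto simp: inner_add_right)

lemma exposes_ray_extreme: "exposes_ray C f y \<Longrightarrow> extreme_ray C y"
  unfolding exposes_ray_def extreme_ray_def using exposed_sum(1)[of f C] by metis

lemma simplicial_face_extreme_ray:
  assumes g: "g \<in> span_dual C" and B: "finite B" "independent B" "exposed_by C g = convex_cone hull B"
    and b: "b \<in> B"
  shows "extreme_ray C b"
  unfolding extreme_ray_def
proof (intro conjI ballI impI)
  have bF: "b \<in> exposed_by C g" unfolding B(3) by (rule hull_inc[OF b])
  then show "b \<in> C" by (simp add: exposed_by_def)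
  show "b \<noteq> 0" using B(2) b dependent_zero by blast
  fix u w assume uw: "u \<in> C" "w \<in> C" "b = u + w"
  have "u \<in> exposed_by C g" "w \<in> exposed_by C g"
    using exposed_sum[OF g uw(1,2)] bF uw by (auto simp: exposed_by_def)
  then have "\<exists>c. (\<forall>a\<in>B. 0 \<le> c a) \<and> u = (\<Sum>a\<in>B. c a *\<^sub>R a)"
    "\<exists>d. (\<forall>a\<in>B. 0 \<le> d a) \<and> w = (\<Sum>a\<in>B. d a *\<^sub>R a)"
    unfolding B(3) convex_cone_hull_finite[OF B(1)] .
  then obtain c d where c: "\<And>a. a \<in> B \<Longrightarrow> 0 \<le> c a" "u = (\<Sum>a\<in>B. c a *\<^sub>R a)"
    and d: "\<And>a. a \<in> B \<Longrightarrow> 0 \<le> d a" "w = (\<Sum>a\<in>B. d a *\<^sub>R a)"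
    by metis
  have "c a = 0" if a: "a \<in> B" "a \<noteq> b" for a
  proof -
    obtain z where z: "0 < z \<bullet> a" "\<forall>a'\<in>B. a' \<noteq> a \<longrightarrow> z \<bullet> a' = 0"
      by (rule dual_vector[OF B(2) a(1)]) blast
    have eval: "z \<bullet> (\<Sum>a'\<in>B. e a' *\<^sub>R a') = e a * (z \<bullet> a)" for e
    proof -
      have "z \<bullet> (\<Sum>a'\<in>B. e a' *\<^sub>R a') = (\<Sum>a'\<in>B. if a' = a then e a * (z \<bullet> a) else 0)"
        unfolding inner_sum_right by (rule sum.cong) (use z(2) in auto)
      then show ?thesis using B(1) a(1) by simp
    qed
    have "z \<bullet> b = 0" using z(2) b a by auto
    then have "(c a + d a) * (z \<bullet> a) = 0" using uw(3) eval c(2) d(2) by (simp add: inner_add_right algebra_simps)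
    then show ?thesis using z(1) c(1)[OF a(1)] d(1)[OF a(1)] by auto
  qed
  then have "u = (\<Sum>a\<in>B. if a = b then c b *\<^sub>R b else 0)"
    unfolding c(2) by (intro sum.cong) auto
  then show "\<exists>c. u = c *\<^sub>R b" using B(1) b by auto
qed

lemma extreme_ray_in_simplicial_face:
  assumes C: "pointed_cone C" and B: "finite B" "B \<subseteq> C"
    and e: "extreme_ray C e" "e \<in> convex_cone hull B"
  obtains b c where "b \<in> B" "0 < c" "e = c *\<^sub>R b"
proof -
  obtain c where c: "\<And>b. b \<in> B \<Longrightarrow> 0 \<le> c b" "e = (\<Sum>b\<in>B. c b *\<^sub>R b)"
    using e(2) convex_cone_hull_finite[OF B(1)] by blast
  have e0: "e \<noteq> 0" "e \<in> C" using e(1) by (auto simp: extreme_ray_def)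
  then have "\<exists>b\<in>B. c b *\<^sub>R b \<noteq> 0" using c(2) by (metis (no_types, lifting) sum.neutral)
  then obtain b where b: "b \<in> B" "c b *\<^sub>R b \<noteq> 0" by blast
  have cb: "c b > 0" "c b *\<^sub>R b \<in> C"
    using b c(1)[OF b(1)] B(2) by (auto simp: less_le intro!: pointed_cone_scale[OF C])
  have rest: "(\<Sum>a\<in>B - {b}. c a *\<^sub>R a) \<in> C"
    by (intro sum_in_cone pointed_coneD(3)[OF C] pointed_cone_scale[OF C]) (use c(1) B(2) in auto)
  have "e = c b *\<^sub>R b + (\<Sum>a\<in>B - {b}. c a *\<^sub>R a)" using c(2) b(1) B(1) by (simp add: sum.remove)
  then obtain d where d: "c b *\<^sub>R b = d *\<^sub>R e" using e(1) cb(2) rest unfolding extreme_ray_def by blast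
  have "d > 0"
  proof (rule ccontr)
    assume n: "\<not> d > 0"
    then have "(- d) *\<^sub>R e \<in> C" using e0 by (intro pointed_cone_scale[OF C]) auto
    then have "- (c b *\<^sub>R b) \<in> C" using d by simp
    then show False using pointed_cone_antisym[OF C cb(2)] b(2) by blast
  qed
  have "(c b / d) *\<^sub>R b = (1 / d) *\<^sub>R (c b *\<^sub>R b)" by simp
  also have "\<dots> = e" unfolding d using \<open>d > 0\<close> by simp
  finally have "e = (c b / d) *\<^sub>R b" by simp
  then show ?thesis using that b(1) cb(1) \<open>d > 0\<close> by (metis divide_pos_pos)
qed

section \<open>Cones with simplicial exposed faces\<close>

text \<open>The situation at a vertex: \<open>B\<close> generates the normals at \<open>y\<close>,
  and \<open>v g\<close> is a neighbour of \<open>y\<close> that lies on the face of every normal in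
  \<open>B\<close> except \<open>g\<close>. With \<open>null\<close>, this makes \<open>y\<close>
  and the \<open>v g\<close> a basis of the span in which the \<open>g\<close>, up to scale, are
  coordinates.\<close>

locale vertex_frame =
  fixes C :: "'a::euclidean_space set" and y :: 'a and B :: "'a set" and v :: "'a \<Rightarrow> 'a"
  assumes C: "pointed_cone C" and yC: "y \<in> C" "y \<noteq> 0"
    and finB: "finite B" and normals: "exposed_by (span_dual C) y = convex_cone hull B"
    and vC: "\<And>g. g \<in> B \<Longrightarrow> v g \<in> C" and vpos: "\<And>g. g \<in> B \<Longrightarrow> 0 < g \<bullet> v g"
    and vzero: "\<And>g g'. g \<in> B \<Longrightarrow> g' \<in> B \<Longrightarrow> g' \<noteq> g \<Longrightarrow> g' \<bullet> v g = 0"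
    and null: "\<And>w. w \<in> span C \<Longrightarrow> (\<And>g. g \<in> B \<Longrightarrow> g \<bullet> w = 0) \<Longrightarrow> \<exists>c. w = c *\<^sub>R y"
begin

lemma BC: "g \<in> B \<Longrightarrow> g \<in> span_dual C" and By: "g \<in> B \<Longrightarrow> g \<bullet> y = 0"
  using hull_inc[of g B convex_cone] normals by (auto simp: exposed_by_def inner_commute)

text \<open>The coordinate along \<open>y\<close>: the functional \<open>y\<close>, corrected by
  multiples of the \<open>g\<close>, which vanish at \<open>y\<close>, so as to vanish at every
  \<open>v g\<close>, and scaled to 1 at \<open>y\<close>.\<close>

definition \<phi> :: 'a where
  "\<phi> = (1 / (y \<bullet> y)) *\<^sub>R (y - (\<Sum>g\<in>B. ((y \<bullet> v g) / (g \<bullet> v g)) *\<^sub>R g))"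

lemma \<phi>_span: "\<phi> \<in> span C"
proof -
  have "g \<in> span C" if "g \<in> B" for g by (rule span_dualD(2)[OF BC[OF that]])
  moreover have "y \<in> span C" by (rule span_base[OF yC(1)])
  ultimately show ?thesis unfolding \<phi>_def by (simp add: span_scale span_diff span_sum)
qed

lemma \<phi>_y: "\<phi> \<bullet> y = 1"
proof -
  have "(\<Sum>g\<in>B. ((y \<bullet> v g) / (g \<bullet> v g)) * (g \<bullet> y)) = 0" by (rule sum.neutral) (simp add: By)
  then show ?thesis using yC(2) by (simp add: \<phi>_def inner_diff_left inner_sum_left)
qed

lemma \<phi>_v: assumes "g \<in> B" shows "\<phi> \<bullet> v g = 0"
proof -
  have "(\<Sum>g'\<in>B. ((y \<bullet> v g') / (g' \<bullet> v g')) * (g' \<bullet> v g)) = (\<Sum>g'\<in>B. if g' = g then y \<bullet> v g else 0)"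
  proof (rule sum.cong)
    fix g' assume "g' \<in> B"
    then show "((y \<bullet> v g') / (g' \<bullet> v g')) * (g' \<bullet> v g) = (if g' = g then y \<bullet> v g else 0)"
      using vpos[OF assms] vzero[OF assms, of g'] by simp
  qed simp
  also have "\<dots> = y \<bullet> v g" using assms finB by simp
  finally show ?thesis by (simp add: \<phi>_def inner_diff_left inner_sum_left)
qed

lemma coordinates:
  assumes "w \<in> span C"
  shows "w = (\<phi> \<bullet> w) *\<^sub>R y + (\<Sum>g\<in>B. ((g \<bullet> w) / (g \<bullet> v g)) *\<^sub>R v g)"
proof -
  define s where "s = (\<Sum>g\<in>B. ((g \<bullet> w) / (g \<bullet> v g)) *\<^sub>R v g)"
  have "s \<in> span C" unfolding s_def by (intro span_sum span_scale span_base vC)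
  then have ws: "w - s \<in> span C" by (intro span_diff assms)
  have "g \<bullet> (w - s) = 0" if g: "g \<in> B" for g
  proof -
    have "g \<bullet> s = (\<Sum>g'\<in>B. if g' = g then g \<bullet> w else 0)"
      unfolding s_def inner_sum_right
    proof (rule sum.cong)
      fix g' assume "g' \<in> B"
      then show "g \<bullet> (((g' \<bullet> w) / (g' \<bullet> v g')) *\<^sub>R v g') = (if g' = g then g \<bullet> w else 0)"
        using vpos[OF g] vzero[OF _ g, of g'] by simp
    qed simp
    then show ?thesis using g finB by (simp add: inner_diff_right)
  qed
  then obtain c where c: "w - s = c *\<^sub>R y" using null[OF ws] by blast
  have "\<phi> \<bullet> s = 0" unfolding s_def inner_sum_right by (rule sum.neutral) (simp add: \<phi>_v)
  then have "\<phi> \<bullet> w = \<phi> \<bullet> (w - s)" by (simp add: inner_diff_right)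
  also have "\<dots> = c" unfolding c by (simp add: \<phi>_y)
  finally have "w - s = (\<phi> \<bullet> w) *\<^sub>R y" using c by simp
  then show ?thesis unfolding s_def by (simp add: algebra_simps)
qed

text \<open>\<open>y\<close> and the \<open>v g'\<close> with \<open>g' \<noteq> g\<close> are
  extreme rays inside the simplicial face of \<open>g\<close>, hence generators of it up to scale.
  The coordinate of that face along \<open>y\<close> is nonnegative, and on the face it is a
  positive multiple of \<phi>.\<close>

lemma facet_coordinate_nonneg:
  assumes g: "g \<in> B" and D: "finite D" "independent D" "exposed_by C g = convex_cone hull D"
    and ext: "extreme_ray C y" "\<And>g. g \<in> B \<Longrightarrow> extreme_ray C (v g)"
    and k: "k \<in> C" "g \<bullet> k = 0"
  shows "0 \<le> \<phi> \<bullet> k"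
proof -
  have DC: "D \<subseteq> C" using hull_subset[of D convex_cone] D(3) by (auto simp: exposed_by_def)
  have inD: "u \<in> convex_cone hull D" if "u \<in> C" "g \<bullet> u = 0" for u
    using that by (simp add: D(3)[symmetric] exposed_by_def)
  obtain b d where b: "b \<in> D" "0 < d" "y = d *\<^sub>R b"
    by (rule extreme_ray_in_simplicial_face[OF C D(1) DC ext(1) inD[OF yC(1) By[OF g]]])
  obtain w where w: "0 < w \<bullet> b" "\<forall>a\<in>D. a \<noteq> b \<longrightarrow> w \<bullet> a = 0"
    by (rule dual_vector[OF D(2) b(1)]) blast
  have wy: "0 < w \<bullet> y" using w(1) b by simp
  have wv: "w \<bullet> v g' = 0" if g': "g' \<in> B" "g' \<noteq> g" for g'
  proof -
    have "g \<bullet> v g' = 0" using vzero[OF g'(1) g] g'(2) by blast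
    then obtain b' d' where b': "b' \<in> D" "0 < d'" "v g' = d' *\<^sub>R b'"
      by (rule extreme_ray_in_simplicial_face[OF C D(1) DC ext(2)[OF g'(1)] inD[OF vC[OF g'(1)]]])
    have "b' \<noteq> b"
    proof
      assume "b' = b"
      then have "g' \<bullet> b' = 0" using By[OF g'(1)] b by simp
      then show False using vpos[OF g'(1)] b' by simp
    qed
    then show ?thesis using w(2) b' by simp
  qed
  obtain c where c: "\<forall>a\<in>D. 0 \<le> c a" "k = (\<Sum>a\<in>D. c a *\<^sub>R a)"
    using inD[OF k] convex_cone_hull_finite[OF D(1)] by blast
  have "w \<bullet> k = (\<Sum>a\<in>D. c a * (w \<bullet> a))" by (simp add: c(2) inner_sum_right)
  also have "\<dots> \<ge> 0"
  proof (rule sum_nonneg)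
    fix a assume a: "a \<in> D"
    have "0 \<le> w \<bullet> a" using w a by (cases "a = b") auto
    then show "0 \<le> c a * (w \<bullet> a)" using c(1) a by simp
  qed
  finally have "0 \<le> w \<bullet> k" .
  also have "w \<bullet> k = (\<phi> \<bullet> k) * (w \<bullet> y) + (\<Sum>g'\<in>B. ((g' \<bullet> k) / (g' \<bullet> v g')) * (w \<bullet> v g'))"
    by (subst coordinates[OF span_base[OF k(1)]]) (simp add: inner_add_right inner_sum_right)
  also have "(\<Sum>g'\<in>B. ((g' \<bullet> k) / (g' \<bullet> v g')) * (w \<bullet> v g')) = 0"
  proof (rule sum.neutral, rule ballI)
    fix g' assume "g' \<in> B"
    then show "((g' \<bullet> k) / (g' \<bullet> v g')) * (w \<bullet> v g') = 0" using k(2) wv by (cases "g' = g") auto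
  qed
  finally show ?thesis using wy by (simp add: zero_le_mult_iff)
qed

lemma coordinate_nonneg_imp_simplicial:
  assumes "\<And>k. k \<in> C \<Longrightarrow> 0 \<le> \<phi> \<bullet> k"
  shows "simplicial_cone C"
  unfolding simplicial_cone_def
proof (intro exI conjI)
  let ?D = "insert y (v ` B)"
  show "finite ?D" using finB by simp
  have inj: "inj_on v B"
  proof (rule inj_onI, rule ccontr)
    fix g g' assume g: "g \<in> B" "g' \<in> B" and eq: "v g = v g'" and "g \<noteq> g'"
    then have "g \<bullet> v g' = 0" using vzero[OF g(2,1)] by blast
    then show False using vpos[OF g(1)] eq by simp
  qed
  have yv: "y \<notin> v ` B"
  proof
    assume "y \<in> v ` B"
    then obtain g where "g \<in> B" "y = v g" by blast
    then show False using By[of g] vpos[of g] by simp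
  qed
  show "independent ?D"
  proof (rule independent_if_scalars_zero)
    fix c u assume s: "(\<Sum>u\<in>?D. c u *\<^sub>R u) = 0" and u: "u \<in> ?D"
    have s': "c y *\<^sub>R y + (\<Sum>g\<in>B. c (v g) *\<^sub>R v g) = 0"
      using s finB yv by (simp add: sum.reindex[OF inj])
    have "(\<Sum>g\<in>B. c (v g) * (\<phi> \<bullet> v g)) = 0" by (rule sum.neutral) (simp add: \<phi>_v)
    then have "\<phi> \<bullet> (c y *\<^sub>R y + (\<Sum>g\<in>B. c (v g) *\<^sub>R v g)) = c y"
      by (simp add: inner_add_right inner_sum_right \<phi>_y)
    then have cy: "c y = 0" using s' by simp
    have "c (v g) = 0" if g: "g \<in> B" for g
    proof -
      have "g \<bullet> (\<Sum>g\<in>B. c (v g) *\<^sub>R v g) = (\<Sum>g'\<in>B. if g' = g then c (v g) * (g \<bullet> v g) else 0)"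
        unfolding inner_sum_right
      proof (rule sum.cong)
        fix g' assume "g' \<in> B"
        then show "g \<bullet> (c (v g') *\<^sub>R v g') = (if g' = g then c (v g) * (g \<bullet> v g) else 0)"
          using vzero[OF _ g, of g'] by simp
      qed simp
      then have "c (v g) * (g \<bullet> v g) = 0" using s' cy g finB by simp
      then show ?thesis using vpos[OF g] by simp
    qed
    then show "c u = 0" using u cy by auto
  qed (use finB in simp)
  show "C = convex_cone hull ?D"
  proof
    show "convex_cone hull ?D \<subseteq> C" by (rule hull_minimal) (use yC vC C in \<open>auto simp: pointed_coneD\<close>)
    show "C \<subseteq> convex_cone hull ?D"
    proof
      fix k assume k: "k \<in> C"
      have "k = (\<phi> \<bullet> k) *\<^sub>R y + (\<Sum>g\<in>B. ((g \<bullet> k) / (g \<bullet> v g)) *\<^sub>R v g)"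
        by (rule coordinates[OF span_base[OF k]])
      also have "\<dots> \<in> convex_cone hull ?D"
        by (intro convex_cone_hull_add convex_cone_hull_mul hull_inc sum_in_cone
            convex_cone_convex_cone_hull divide_nonneg_pos assms k vpos span_dualD(1)[OF BC k]) auto
      finally show "k \<in> convex_cone hull ?D" .
    qed
  qed
qed

lemma exposes_ray_sum:
  assumes "\<And>g. g \<in> B \<Longrightarrow> 0 < c g"
  shows "exposes_ray C (\<Sum>g\<in>B. c g *\<^sub>R g) y"
  unfolding exposes_ray_def
proof (intro conjI ballI impI yC)
  show "(\<Sum>g\<in>B. c g *\<^sub>R g) \<in> span_dual C"
    by (intro span_dual_sum span_dual_scale BC) (use assms in \<open>auto simp: less_imp_le\<close>)
  show "(\<Sum>g\<in>B. c g *\<^sub>R g) \<bullet> y = 0" by (simp add: inner_sum_left By)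
  fix k assume k: "k \<in> C" and z: "(\<Sum>g\<in>B. c g *\<^sub>R g) \<bullet> k = 0"
  have s0: "(\<Sum>g\<in>B. c g * (g \<bullet> k)) = 0" using z by (simp add: inner_sum_left)
  have nn: "0 \<le> c g * (g \<bullet> k)" if "g \<in> B" for g
    using assms[OF that] span_dualD(1)[OF BC[OF that] k] by simp
  have "g \<bullet> k = 0" if g: "g \<in> B" for g
    using sum_nonneg_0[OF finB nn s0 g] assms[OF g] by simp
  then show "\<exists>c. k = c *\<^sub>R y" by (rule null[OF span_base[OF k]])
qed

end

lemma kite_sandwichI:
  assumes "k1 \<in> C" "k2 \<in> C" "k3 \<in> C" "k4 \<in> C"
    and "f1 \<in> span_dual C" "f2 \<in> span_dual C" "f3 \<in> span_dual C" "f4 \<in> span_dual C"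
    and "k1 + k3 = k2 + k4" "f1 + f3 = f2 + f4"
    and "f1 \<bullet> k1 = 0" "f2 \<bullet> k2 = 0" "f3 \<bullet> k3 = 0" "f4 \<bullet> k4 = 0"
    and "\<And>v. v \<in> C \<Longrightarrow> v \<noteq> 0 \<Longrightarrow> 0 < (f1 + f2) \<bullet> v" "\<And>v. v \<in> C \<Longrightarrow> v \<noteq> 0 \<Longrightarrow> 0 < (f1 + f4) \<bullet> v"
    and "0 < f3 \<bullet> k2" "0 < f3 \<bullet> k4"
  shows "kite_sandwich C"
  unfolding kite_sandwich_def
  by (rule bexI[OF _ assms(1)], rule bexI[OF _ assms(2)], rule bexI[OF _ assms(3)], rule bexI[OF _ assms(4)],
      rule bexI[OF _ assms(5)], rule bexI[OF _ assms(6)], rule bexI[OF _ assms(7)], rule bexI[OF _ assms(8)])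
    (simp add: assms(9-18))

context vertex_frame
begin

lemma facet_normals_pos:
  assumes facets: "\<forall>g\<in>B. \<forall>k\<in>C. g \<bullet> k = 0 \<longrightarrow> 0 \<le> \<phi> \<bullet> k"
    and k: "k \<in> C" "\<phi> \<bullet> k < 0" and g: "g \<in> B"
  shows "0 < g \<bullet> k"
  using span_dualD(1)[OF BC[OF g] k(1)] facets g k by force

lemma functional_expansion:
  assumes "k \<in> C"
  shows "f \<bullet> k = (\<phi> \<bullet> k) * (f \<bullet> y) + (\<Sum>g\<in>B. (g \<bullet> k) / (g \<bullet> v g) * (f \<bullet> v g))"
  by (subst coordinates[OF span_base[OF assms]]) (simp add: inner_add_right inner_sum_right)

text \<open>Here \<open>f\<close> supports \<open>C\<close> at \<open>v g1\<close> but not at \<open>y\<close>. The coefficients \<open>c\<close> of the functional \<open>F\<close>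
  exposing \<open>y\<close> are adjusted to \<open>f\<close>, so that \<open>f + (\<Sum>l\<in>B. l) = (f \<bullet> y) \<phi> + F\<close>.\<close>

lemma kite_sandwich_explicit:
  assumes facets: "\<forall>g\<in>B. \<forall>k\<in>C. g \<bullet> k = 0 \<longrightarrow> 0 \<le> \<phi> \<bullet> k"
    and e: "e \<in> C" "\<phi> \<bullet> e < 0"
    and g: "g1 \<in> B" "g2 \<in> B" "g2 \<noteq> g1"
    and f: "f \<in> span_dual C" "f \<bullet> v g1 = 0" "f \<bullet> y \<noteq> 0"
  shows "kite_sandwich C"
proof -
  define c where "c l = (if l = g1 then 1 else f \<bullet> v l / (l \<bullet> v l) + 1)" for l
  define F where "F = (\<Sum>l\<in>B. c l *\<^sub>R l)"
  have nn: "0 \<le> f \<bullet> k" if "f \<in> span_dual C" "k \<in> C" for f k by (rule span_dualD(1)[OF that])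
  have fy: "0 < f \<bullet> y" using f(3) nn[OF f(1) yC(1)] by simp
  have c: "0 < c l" if "l \<in> B" for l
    using nn[OF f(1) vC[OF that]] vpos[OF that] by (simp add: c_def add_nonneg_pos)
  have exp: "exposes_ray C F y" unfolding F_def by (rule exposes_ray_sum[OF c])
  then have F: "F \<in> span_dual C" "F \<bullet> y = 0" by (auto simp: exposes_ray_def)
  have Fv: "F \<bullet> v l = c l * (l \<bullet> v l)" if l: "l \<in> B" for l
  proof -
    have "F \<bullet> v l = (\<Sum>l'\<in>B. if l' = l then c l * (l \<bullet> v l) else 0)"
      unfolding F_def inner_sum_left
    proof (rule sum.cong)
      fix l' assume "l' \<in> B"
      then show "(c l' *\<^sub>R l') \<bullet> v l = (if l' = l then c l * (l \<bullet> v l) else 0)"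
        using vzero[OF l, of l'] by simp
    qed simp
    then show ?thesis using l finB by simp
  qed
  have Fvpos: "0 < F \<bullet> v l" if "l \<in> B" for l using Fv[OF that] c[OF that] vpos[OF that] by simp
  have \<phi>y: "0 < \<phi> \<bullet> y" by (simp add: \<phi>_y)
  obtain t x where tx: "0 < t" "x \<in> C" "x \<noteq> 0" "\<phi> + t *\<^sub>R F \<in> span_dual C" "(\<phi> + t *\<^sub>R F) \<bullet> x = 0"
    "\<And>u. u \<in> C \<Longrightarrow> u \<noteq> 0 \<Longrightarrow> (\<phi> + t *\<^sub>R F) \<bullet> u = 0 \<Longrightarrow> \<phi> \<bullet> u < 0 \<and> 0 < F \<bullet> u"
    using supporting_shift[OF C exp \<phi>_span \<phi>y e] by blast
  define f0 where "f0 = \<phi> + t *\<^sub>R F"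
  note f0 = tx(4,5,6)[folded f0_def]
  have x: "\<phi> \<bullet> x < 0" "0 < F \<bullet> x" using f0(3)[OF tx(2,3) f0(2)] by auto
  have gpos: "0 < l \<bullet> u" if "l \<in> B" "u \<in> C" "u \<noteq> 0" "f0 \<bullet> u = 0" for l u
    using f0(3)[OF that(2-4)] facet_normals_pos[OF facets that(2) _ that(1)] by blast
  \<comment> \<open>Without \<open>g1\<close>, which becomes the fourth functional, this sum
    vanishes at \<open>v g1\<close>.\<close>
  define f2 where "f2 = f + (\<Sum>l\<in>B - {g1}. l)"
  have f2: "f2 \<in> span_dual C" unfolding f2_def by (intro span_dual_add f span_dual_sum BC) auto
  define b where "b = f \<bullet> y"
  \<comment> \<open>From \<open>f0 = \<phi> + t F\<close> and \<open>f2 + g1 = b \<phi> + F\<close>.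
    That \<open>a\<close> is positive is seen at the contact point \<open>x\<close>, where
    \<open>f0\<close> vanishes.\<close>
  define a where "a = 1 - b * t"
  have key: "f2 + g1 - b *\<^sub>R \<phi> - F = 0"
  proof (rule inner_zero_on_span[of _ C])
    show "f2 + g1 - b *\<^sub>R \<phi> - F \<in> span C"
      by (intro span_diff span_add span_scale \<phi>_span span_dualD(2)[OF f2] span_dualD(2)[OF BC[OF g(1)]] span_dualD(2)[OF F(1)])
    fix k assume k: "k \<in> C"
    have "(\<Sum>l\<in>B. (l \<bullet> k) / (l \<bullet> v l) * (f \<bullet> v l)) = (\<Sum>l\<in>B - {g1}. (l \<bullet> k) / (l \<bullet> v l) * (f \<bullet> v l))"
      using finB g(1) f(2) by (simp add: sum.remove)
    then have fk: "f \<bullet> k = b * (\<phi> \<bullet> k) + (\<Sum>l\<in>B - {g1}. (l \<bullet> k) / (l \<bullet> v l) * (f \<bullet> v l))"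
      using functional_expansion[OF k, of f] by (simp add: b_def)
    have "F \<bullet> k = g1 \<bullet> k + (\<Sum>l\<in>B - {g1}. c l * (l \<bullet> k))"
      unfolding F_def inner_sum_left using finB g(1) by (simp add: sum.remove c_def)
    also have "(\<Sum>l\<in>B - {g1}. c l * (l \<bullet> k))
        = (\<Sum>l\<in>B - {g1}. (l \<bullet> k) / (l \<bullet> v l) * (f \<bullet> v l)) + (\<Sum>l\<in>B - {g1}. l \<bullet> k)"
      unfolding sum.distrib[symmetric] by (rule sum.cong) (auto simp: c_def algebra_simps)
    finally show "(f2 + g1 - b *\<^sub>R \<phi> - F) \<bullet> k = 0"
      using fk by (simp add: f2_def inner_diff_left inner_add_left inner_sum_left)
  qed
  have rel: "f2 + g1 = b *\<^sub>R f0 + a *\<^sub>R F"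
    using key by (simp add: f0_def a_def algebra_simps)
  have g1C: "g1 \<in> span_dual C" by (rule BC[OF g(1)])
  have sumpos: "0 < (\<Sum>l\<in>B - {g1}. p l)" if "\<And>l. l \<in> B \<Longrightarrow> 0 < p l" for p :: "'a \<Rightarrow> real"
    by (rule sum_pos) (use finB g that in auto)
  have f2pos: "0 < f2 \<bullet> u" if u: "u \<in> C" "u \<noteq> 0" "f0 \<bullet> u = 0" for u
    using nn[OF f(1) u(1)] sumpos[of "\<lambda>l. l \<bullet> u"] gpos[OF _ u]
    by (simp add: f2_def inner_add_left inner_sum_left add_nonneg_pos)
  have "(f2 + g1) \<bullet> x = a * (F \<bullet> x)" using rel f0(2) by (simp add: inner_add_left)
  moreover have "0 < (f2 + g1) \<bullet> x"
    using f2pos[OF tx(2,3) f0(2)] gpos[OF g(1) tx(2,3) f0(2)] by (simp add: inner_add_left)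
  ultimately have a: "0 < a" using x(2) by (simp add: zero_less_mult_iff)
  define d where "d l = (l \<bullet> x) / (l \<bullet> v l)" for l
  have d: "0 < d l" if "l \<in> B" for l using gpos[OF that tx(2,3) f0(2)] vpos[OF that] by (simp add: d_def)
  define k4 where "k4 = (\<Sum>l\<in>B - {g1}. d l *\<^sub>R v l)"
  have k4C: "k4 \<in> C" unfolding k4_def
    by (intro sum_in_cone pointed_coneD(3)[OF C] pointed_cone_scale[OF C] vC) (use d in \<open>auto simp: less_imp_le\<close>)
  have posF: "0 < (b *\<^sub>R f0 + h) \<bullet> u"
    if "u \<in> C" "u \<noteq> 0" "h \<in> span_dual C" "f0 \<bullet> u = 0 \<Longrightarrow> 0 < h \<bullet> u" for h u
  proof (cases "f0 \<bullet> u = 0")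
    case False
    then have "0 < f0 \<bullet> u" using nn[OF f0(1) that(1)] by linarith
    then show ?thesis using fy nn[OF that(3,1)] by (simp add: inner_add_left add_pos_nonneg b_def)
  qed (use that in \<open>simp add: inner_add_left\<close>)
  show ?thesis
  proof (rule kite_sandwichI)
    \<comment> \<open>The expansion of \<open>x\<close> in the basis, its negative term along
      \<open>y\<close> moved to the other side, is the relation between the four points of the
      kite.\<close>
    have "x = (\<phi> \<bullet> x) *\<^sub>R y + (\<Sum>l\<in>B. d l *\<^sub>R v l)"
      using coordinates[OF span_base[OF tx(2)]] by (simp add: d_def)
    also have "(\<Sum>l\<in>B. d l *\<^sub>R v l) = d g1 *\<^sub>R v g1 + k4"
      unfolding k4_def using finB g(1) by (simp add: sum.remove)
    finally show "x + (- (\<phi> \<bullet> x)) *\<^sub>R y = d g1 *\<^sub>R v g1 + k4" by (simp add: algebra_simps)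
    show "b *\<^sub>R f0 + a *\<^sub>R F = f2 + g1" using rel by simp
    show "(b *\<^sub>R f0) \<bullet> x = 0" "(a *\<^sub>R F) \<bullet> ((- (\<phi> \<bullet> x)) *\<^sub>R y) = 0" using f0(2) F(2) by auto
    have "l \<bullet> v g1 = 0" if "l \<in> B - {g1}" for l using that vzero[OF g(1)] by auto
    then have "f2 \<bullet> v g1 = 0" using f(2) by (simp add: f2_def inner_add_left inner_sum_left)
    then show "f2 \<bullet> (d g1 *\<^sub>R v g1) = 0" by simp
    have "g1 \<bullet> v l = 0" if "l \<in> B - {g1}" for l using that vzero[OF _ g(1)] by auto
    then show "g1 \<bullet> k4 = 0" by (simp add: k4_def inner_sum_right)
    show "0 < (b *\<^sub>R f0 + f2) \<bullet> u" if "u \<in> C" "u \<noteq> 0" for u using posF[OF that f2] f2pos[OF that] by blast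
    show "0 < (b *\<^sub>R f0 + g1) \<bullet> u" if "u \<in> C" "u \<noteq> 0" for u using posF[OF that g1C] gpos[OF g(1) that] by blast
    show "0 < (a *\<^sub>R F) \<bullet> (d g1 *\<^sub>R v g1)" using a d[OF g(1)] Fvpos[OF g(1)] by simp
    have "0 < F \<bullet> k4"
      unfolding k4_def using sumpos[of "\<lambda>l. d l * (F \<bullet> v l)"] d Fvpos by (simp add: inner_sum_right)
    then show "0 < (a *\<^sub>R F) \<bullet> k4" using a by simp
    show "d g1 *\<^sub>R v g1 \<in> C" using d[OF g(1)] by (intro pointed_cone_scale[OF C] vC g) simp
    show "(- (\<phi> \<bullet> x)) *\<^sub>R y \<in> C" using x by (intro pointed_cone_scale[OF C] yC) simp
    show "b *\<^sub>R f0 \<in> span_dual C" using fy by (intro span_dual_scale f0) (simp add: b_def)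
    show "a *\<^sub>R F \<in> span_dual C" using a by (intro span_dual_scale F) simp
    show "x \<in> C" "k4 \<in> C" "f2 \<in> span_dual C" "g1 \<in> span_dual C" by (rule tx(2) k4C f2 g1C)+
  qed
qed

text \<open>Here every support at a neighbour of \<open>y\<close> passes through \<open>y\<close>
  too. The slice is placed just below \<open>\<phi> = 0\<close>, at
  \<open>\<phi> = - \<epsilon> f3\<close>. Points sharing a support with the face of
  \<open>f0\<close> have \<phi> below a negative multiple of their norm, so for small \<epsilon> the
  slice avoids them. In the second alternative of \<open>sandwich_from_slice\<close>,
  \<open>k2\<close> would lie on a face through \<open>y\<close>, where \<phi> is nonnegative, and
  yet over the slice, where it is negative.\<close>

lemma kite_sandwich_from_near_slice:
  assumes nonsimp: "\<not> simplicial_cone C" and exp: "exposes_ray C f3 y"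
    and facets: "\<forall>g\<in>B. \<forall>k\<in>C. g \<bullet> k = 0 \<longrightarrow> 0 \<le> \<phi> \<bullet> k"
    and e: "e \<in> C" "\<phi> \<bullet> e < 0"
    and sub: "\<forall>g\<in>B. \<forall>f\<in>span_dual C. f \<bullet> v g = 0 \<longrightarrow> f \<bullet> y = 0"
  shows "kite_sandwich C"
proof -
  have nn: "0 \<le> f \<bullet> k" if "f \<in> span_dual C" "k \<in> C" for f k by (rule span_dualD(1)[OF that])
  have f3: "f3 \<in> span_dual C" "f3 \<bullet> y = 0" using exp by (auto simp: exposes_ray_def)
  have \<phi>y: "0 < \<phi> \<bullet> y" by (simp add: \<phi>_y)
  obtain t x where tx: "0 < t" "x \<in> C" "x \<noteq> 0" "\<phi> + t *\<^sub>R f3 \<in> span_dual C" "(\<phi> + t *\<^sub>R f3) \<bullet> x = 0"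
    "\<And>u. u \<in> C \<Longrightarrow> u \<noteq> 0 \<Longrightarrow> (\<phi> + t *\<^sub>R f3) \<bullet> u = 0 \<Longrightarrow> \<phi> \<bullet> u < 0 \<and> 0 < f3 \<bullet> u"
    using supporting_shift[OF C exp \<phi>_span \<phi>y e] by blast
  define f0 where "f0 = \<phi> + t *\<^sub>R f3"
  note f0 = tx(4,5,6)[folded f0_def]
  have f0v: "f0 \<bullet> u = \<phi> \<bullet> u + t * (f3 \<bullet> u)" for u by (simp add: f0_def inner_add_left)
  have x: "\<phi> \<bullet> x < 0" "0 < f3 \<bullet> x" using f0(3)[OF tx(2,3) f0(2)] by auto
  have f0y: "f0 \<bullet> y = 1" by (simp add: f0v \<phi>_y f3)
  have gpos: "0 < l \<bullet> u" if "l \<in> B" "u \<in> C" "u \<noteq> 0" "f0 \<bullet> u = 0" for l u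
    using f0(3)[OF that(2-4)] facet_normals_pos[OF facets that(2) _ that(1)] by blast
  have notstar: False if h: "f \<in> span_dual C" "f \<noteq> 0" "f \<bullet> y = 0" "u \<in> C" "u \<noteq> 0" "f0 \<bullet> u = 0" "f \<bullet> u = 0" for f u
  proof -
    obtain g where "g \<in> B" "u \<in> exposed_by C g"
      by (rule normal_in_generated_face[OF finB normals h(1,2,3,4,7)])
    then show False using gpos[OF _ h(4,5,6), of g] by (simp add: exposed_by_def)
  qed
  have X: "closed (exposed_by C f0)" "\<And>v c. v \<in> exposed_by C f0 \<Longrightarrow> 0 \<le> c \<Longrightarrow> c *\<^sub>R v \<in> exposed_by C f0"
    using exposed_by_pointed_cone[OF C] by (auto simp: pointed_coneD pointed_cone_scale)
  have "0 < (- \<phi>) \<bullet> k" if h: "k \<in> C" "f \<in> span_dual C" "u \<in> exposed_by C f0" "k \<noteq> 0" "f \<noteq> 0" "u \<noteq> 0"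
    "f \<bullet> k = 0" "f \<bullet> u = 0" for k f u
  proof (rule ccontr)
    assume "\<not> ?thesis"
    then have \<phi>k: "0 \<le> \<phi> \<bullet> k" by simp
    \<comment> \<open>If \<open>\<phi> \<bullet> k\<close> is not negative, every term in the
      expansion of \<open>f \<bullet> k = 0\<close> vanishes. So \<open>f\<close> vanishes at
      \<open>y\<close>, or at some \<open>v g\<close> and then at \<open>y\<close> by
      \<open>sub\<close>, which puts \<open>u\<close> into the star of \<open>y\<close>.\<close>
    have s: "0 \<le> (g \<bullet> k) / (g \<bullet> v g) * (f \<bullet> v g)" if "g \<in> B" for g
      using nn[OF BC[OF that] h(1)] vpos[OF that] nn[OF h(2) vC[OF that]] by simp
    have p: "0 \<le> (\<phi> \<bullet> k) * (f \<bullet> y)" using \<phi>k nn[OF h(2) yC(1)] by simp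
    have tot: "(\<phi> \<bullet> k) * (f \<bullet> y) + (\<Sum>g\<in>B. (g \<bullet> k) / (g \<bullet> v g) * (f \<bullet> v g)) = 0"
      using functional_expansion[OF h(1), of f] h(7) by simp
    have S: "0 \<le> (\<Sum>g\<in>B. (g \<bullet> k) / (g \<bullet> v g) * (f \<bullet> v g))" by (rule sum_nonneg) (rule s)
    have z1: "(\<phi> \<bullet> k) * (f \<bullet> y) = 0" and z2: "(\<Sum>g\<in>B. (g \<bullet> k) / (g \<bullet> v g) * (f \<bullet> v g)) = 0"
      using p S tot by linarith+
    have fy: "f \<bullet> y = 0"
    proof (cases "\<phi> \<bullet> k = 0")
      case True
      have "\<exists>g\<in>B. g \<bullet> k \<noteq> 0"
      proof (rule ccontr)
        assume "\<not> (\<exists>g\<in>B. g \<bullet> k \<noteq> 0)"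
        then have "(\<Sum>g\<in>B. ((g \<bullet> k) / (g \<bullet> v g)) *\<^sub>R v g) = 0" by (intro sum.neutral) auto
        then have "k = 0" using coordinates[OF span_base[OF h(1)]] True by simp
        then show False using h(4) by blast
      qed
      then obtain g where g: "g \<in> B" "g \<bullet> k \<noteq> 0" by blast
      have "(g \<bullet> k) / (g \<bullet> v g) * (f \<bullet> v g) = 0" by (rule sum_nonneg_0[OF finB s z2 g(1)])
      then have "f \<bullet> v g = 0" using g vpos[OF g(1)] by simp
      then show ?thesis using sub g(1) h(2) by blast
    qed (use z1 in simp)
    show False using notstar[OF h(2,5) fy _ h(6) _ h(8)] h(3) by (auto simp: exposed_by_def)
  qed
  then obtain \<rho> where \<rho>: "\<rho> > 0" "\<And>k f u. k \<in> C \<Longrightarrow> f \<in> span_dual C \<Longrightarrow> u \<in> exposed_by C f0 \<Longrightarrow>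
      f \<noteq> 0 \<Longrightarrow> u \<noteq> 0 \<Longrightarrow> f \<bullet> k = 0 \<Longrightarrow> f \<bullet> u = 0 \<Longrightarrow> \<rho> * norm k \<le> (- \<phi>) \<bullet> k"
    using common_zero_bound[OF C X, of "- \<phi>"] by blast
  define \<epsilon> where "\<epsilon> = min (t / 2) (\<rho> / (norm f3 + 1))"
  have n3: "0 < norm f3 + 1" by (simp add: add_nonneg_pos)
  have \<epsilon>: "0 < \<epsilon>" "\<epsilon> < t" using tx(1) \<rho>(1) n3 by (auto simp: \<epsilon>_def)
  have "\<epsilon> \<le> \<rho> / (norm f3 + 1)" by (simp add: \<epsilon>_def)
  then have "\<epsilon> * (norm f3 + 1) \<le> \<rho>" using n3 by (simp add: pos_le_divide_eq)
  then have \<epsilon>\<rho>: "\<epsilon> * norm f3 < \<rho>" using \<epsilon>(1) by (simp add: distrib_left)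
  \<comment> \<open>Since \<open>f0 = \<phi> + t f3\<close> and \<open>f0 y = 1\<close>, this is the
    ratio for which the slice lies in \<open>\<phi> = - \<epsilon> f3\<close>.\<close>
  define \<sigma> where "\<sigma> = 1 / ((t - \<epsilon>) * (f3 \<bullet> x))"
  have \<sigma>: "0 < \<sigma>" using \<epsilon> x(2) by (simp add: \<sigma>_def)
  have \<sigma>x: "\<sigma> * (f3 \<bullet> x) = 1 / (t - \<epsilon>)" using x(2) by (simp add: \<sigma>_def)
  have slice: "\<phi> \<bullet> k = - (\<epsilon> * (f3 \<bullet> k))" if "f3 \<bullet> k = \<sigma> * (f3 \<bullet> x) * (f0 \<bullet> k)" for k
  proof -
    have "f0 \<bullet> k = (t - \<epsilon>) * (f3 \<bullet> k)" using that \<epsilon> unfolding \<sigma>x by simp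
    then show ?thesis by (simp add: f0v algebra_simps)
  qed
  have avoid: "(f3 \<bullet> k) * (f0 \<bullet> y) \<noteq> \<sigma> * (f3 \<bullet> x) * (f0 \<bullet> k)" if h: "k \<in> C" "f \<in> span_dual C" "u \<in> exposed_by C f0"
    "f \<noteq> 0" "u \<noteq> 0" "f \<bullet> k = 0" "f \<bullet> u = 0" "0 < f0 \<bullet> k" for k f u
  proof
    assume "(f3 \<bullet> k) * (f0 \<bullet> y) = \<sigma> * (f3 \<bullet> x) * (f0 \<bullet> k)"
    then have "\<phi> \<bullet> k = - (\<epsilon> * (f3 \<bullet> k))" by (intro slice) (simp add: f0y)
    then have "\<rho> * norm k \<le> \<epsilon> * (f3 \<bullet> k)" using \<rho>(2)[OF h(1-7)] by simp
    also have "\<dots> \<le> \<epsilon> * (norm f3 * norm k)" using \<epsilon> by (intro mult_left_mono norm_cauchy_schwarz) simp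
    also have "\<dots> = (\<epsilon> * norm f3) * norm k" by simp
    also have "\<dots> < \<rho> * norm k" using h(8) by (intro mult_strict_right_mono \<epsilon>\<rho>) auto
    finally show False by simp
  qed
  have int: "f \<bullet> y \<noteq> 0" if "f \<in> span_dual C" "f \<noteq> 0" "f \<bullet> x = 0" for f
    using notstar[OF that(1,2) _ tx(2,3) f0(2) that(3)] by blast
  have f0y': "0 < f0 \<bullet> y" by (simp add: f0y)
  have "kite_sandwich C \<or> (\<exists>\<tau>>0. \<exists>k2\<in>C. \<exists>k4\<in>C. \<exists>f2\<in>span_dual C. \<exists>f4\<in>span_dual C.
      f2 \<noteq> 0 \<and> f4 \<noteq> 0 \<and> f2 \<bullet> k2 = 0 \<and> f4 \<bullet> k4 = 0 \<and> f2 \<bullet> y = 0 \<and> f4 \<bullet> y = 0 \<and>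
      k2 + k4 = (1 + \<tau>) *\<^sub>R (\<sigma> *\<^sub>R x + y) \<and> f0 \<bullet> k2 = f0 \<bullet> y \<and> f3 \<bullet> k2 = \<sigma> * (f3 \<bullet> x))"
    by (rule sandwich_from_slice[OF C nonsimp exp f0(1) f0y' tx(2) f0(2) x(2) \<sigma>]; fact int avoid)
  then show ?thesis
  proof (rule disjE)
    assume "\<exists>\<tau>>0. \<exists>k2\<in>C. \<exists>k4\<in>C. \<exists>f2\<in>span_dual C. \<exists>f4\<in>span_dual C.
      f2 \<noteq> 0 \<and> f4 \<noteq> 0 \<and> f2 \<bullet> k2 = 0 \<and> f4 \<bullet> k4 = 0 \<and> f2 \<bullet> y = 0 \<and> f4 \<bullet> y = 0 \<and>
      k2 + k4 = (1 + \<tau>) *\<^sub>R (\<sigma> *\<^sub>R x + y) \<and> f0 \<bullet> k2 = f0 \<bullet> y \<and> f3 \<bullet> k2 = \<sigma> * (f3 \<bullet> x)"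
    then obtain k2 f2 where *: "k2 \<in> C" "f2 \<in> span_dual C" "f2 \<noteq> 0" "f2 \<bullet> k2 = 0" "f2 \<bullet> y = 0"
      "f0 \<bullet> k2 = f0 \<bullet> y" "f3 \<bullet> k2 = \<sigma> * (f3 \<bullet> x)" by blast
    obtain g where g: "g \<in> B" "k2 \<in> exposed_by C g"
      by (rule normal_in_generated_face[OF finB normals *(2,3,5,1,4)])
    then have "0 \<le> \<phi> \<bullet> k2" using facets *(1) by (simp add: exposed_by_def)
    moreover have "\<phi> \<bullet> k2 = - (\<epsilon> * (f3 \<bullet> k2))" by (rule slice) (simp add: *(6,7) f0y)
    moreover have "0 < \<epsilon> * (f3 \<bullet> k2)" using *(7) \<sigma> x(2) \<epsilon>(1) by simp
    ultimately have False by linarith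
    then show ?thesis ..
  qed
qed

end

text \<open>At an exposed ray \<open>y\<close>, the absence of a kite identifies the cone generated
  by \<open>- y\<close> and the faces through \<open>y\<close> with the tangent cone cut out by the
  normals \<open>B\<close>. Its finitely many generators provide the neighbours \<open>v g\<close>.
  As \<open>C\<close> is not simplicial, \<phi> is negative somewhere on \<open>C\<close>, and one
  of the two constructions above applies, according to whether some support at a neighbour misses
  \<open>y\<close>.\<close>

lemma kite_sandwich_exists:
  assumes C: "pointed_cone C" "\<not> simplicial_cone C"
    and faces: "\<And>f. f \<in> span_dual C \<Longrightarrow> f \<noteq> 0 \<Longrightarrow> simplicial_cone (exposed_by C f)"
    and dual_faces: "\<And>x. x \<in> C \<Longrightarrow> x \<noteq> 0 \<Longrightarrow> simplicial_cone (exposed_by (span_dual C) x)"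
  shows "kite_sandwich C"
proof (rule ccontr)
  assume K: "\<not> kite_sandwich C"
  have "simplicial_cone {0::'a}" unfolding simplicial_cone_def by (rule exI[of _ "{}"]) (simp add: independent_empty)
  then have "C \<noteq> {0}" using C(2) by auto
  then obtain f3 y where exp: "exposes_ray C f3 y" by (rule exposed_ray_exists[OF C(1)])
  have f30: "f3 \<noteq> 0" by (rule exposes_ray_nonzero[OF C exp])
  have f3: "f3 \<in> span_dual C" "f3 \<bullet> y = 0" and yC: "y \<in> C" "y \<noteq> 0"
    and ray: "\<And>v. v \<in> C \<Longrightarrow> f3 \<bullet> v = 0 \<Longrightarrow> \<exists>c. v = c *\<^sub>R y"
    using exp by (auto simp: exposes_ray_def)
  obtain B where B: "finite B" "independent B" "exposed_by (span_dual C) y = convex_cone hull B"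
    using dual_faces[OF yC] unfolding simplicial_cone_def by blast
  have BC: "g \<in> span_dual C" and By: "g \<bullet> y = 0" if "g \<in> B" for g
    using hull_inc[OF that, of convex_cone] B(3) by (auto simp: exposed_by_def inner_commute)
  have B0: "g \<noteq> 0" if "g \<in> B" for g using B(2) that dependent_zero by blast
  have "\<forall>g\<in>B. \<exists>D. finite D \<and> independent D \<and> exposed_by C g = convex_cone hull D"
    using faces[OF BC B0] unfolding simplicial_cone_def by blast
  then obtain D where D: "\<And>g. g \<in> B \<Longrightarrow> finite (D g)" "\<And>g. g \<in> B \<Longrightarrow> independent (D g)"
      "\<And>g. g \<in> B \<Longrightarrow> exposed_by C g = convex_cone hull (D g)"
    by metis
  define V where "V = (\<Union>g\<in>B. D g)"
  have Dexp: "D g \<subseteq> exposed_by C g" if "g \<in> B" for g using hull_subset[of "D g" convex_cone] D(3)[OF that] by simp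
  then have V: "finite V" "V \<subseteq> C" using B(1) D(1) by (auto simp: V_def exposed_by_def)
  have VD: "exposed_by C g \<subseteq> convex_cone hull V" if "g \<in> B" for g
    unfolding D(3)[OF that] by (rule hull_mono) (use that in \<open>auto simp: V_def\<close>)
  define E where "E = convex_cone hull (insert (- y) V)"
  have CE: "C \<subseteq> E" unfolding E_def by (rule cone_subset_star_cone[OF C K exp B(1,3) V VD])
  have E: "convex_cone E" "closed E" unfolding E_def
    using V(1) by (auto intro: convex_cone_convex_cone_hull closed_convex_cone_hull)
  have Espan: "E \<subseteq> span C"
    unfolding E_def by (rule hull_minimal)
      (use V(2) yC(1) in \<open>auto simp: convex_cone_span span_base span_neg\<close>)
  have myV: "- y \<notin> V" using V(2) pointed_cone_antisym[OF C(1) yC(1)] yC(2) by auto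
  have Erep: "\<exists>c d. (\<forall>u\<in>V. 0 \<le> c u) \<and> w = (\<Sum>u\<in>V. c u *\<^sub>R u) + d *\<^sub>R y" if w: "w \<in> E" for w
  proof -
    obtain c where c: "\<forall>u\<in>insert (- y) V. 0 \<le> c u" "w = (\<Sum>u\<in>insert (- y) V. c u *\<^sub>R u)"
      using w unfolding E_def convex_cone_hull_finite[OF finite.insertI[OF V(1)]] by blast
    then show ?thesis using V(1) myV
      by (intro exI[of _ c] exI[of _ "- c (- y)"]) simp
  qed
  \<comment> \<open>A functional nonnegative on \<open>E\<close> is nonnegative on \<open>C\<close>
    and vanishes at \<open>y\<close>, hence is a combination of \<open>B\<close>: the normals at
    \<open>y\<close> cut out \<open>E\<close>.\<close>
  have Ebip: "w \<in> E" if w: "w \<in> span C" "\<And>g. g \<in> B \<Longrightarrow> 0 \<le> g \<bullet> w" for w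
  proof (rule ccontr)
    assume "w \<notin> E"
    then obtain h where h: "h \<in> span C" "\<forall>v\<in>E. 0 \<le> h \<bullet> v" "h \<bullet> w < 0"
      using convex_cone_separate_span[OF E _ w(1) Espan] by blast
    have "h \<in> span_dual C" using h CE by (auto simp: span_dual_def)
    moreover have "h \<bullet> y = 0"
    proof (rule antisym)
      have "- y \<in> E" unfolding E_def by (rule hull_inc) simp
      then show "h \<bullet> y \<le> 0" using h(2) by fastforce
      show "0 \<le> h \<bullet> y" using h(2) CE yC(1) by blast
    qed
    ultimately have "h \<in> convex_cone hull B" by (simp add: B(3)[symmetric] exposed_by_def inner_commute)
    then obtain c where c: "\<forall>g\<in>B. 0 \<le> c g" "h = (\<Sum>g\<in>B. c g *\<^sub>R g)"
      using convex_cone_hull_finite[OF B(1)] by blast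
    have "0 \<le> (\<Sum>g\<in>B. c g * (g \<bullet> w))" by (rule sum_nonneg) (use c(1) w(2) in simp)
    then show False using h(3) c(2) by (simp add: inner_sum_left)
  qed
  have "f3 \<in> convex_cone hull B" using f3 by (simp add: B(3)[symmetric] exposed_by_def inner_commute)
  then obtain cf where cf: "f3 = (\<Sum>g\<in>B. cf g *\<^sub>R g)"
    using convex_cone_hull_finite[OF B(1)] by blast
  \<comment> \<open>Such a \<open>w\<close> lies in \<open>E\<close>, and \<open>f3\<close> vanishes
    at it, hence at every generator occurring in it; on \<open>C\<close> this happens only along
    \<open>y\<close>.\<close>
  have null: "\<exists>c. w = c *\<^sub>R y" if w: "w \<in> span C" "\<And>g. g \<in> B \<Longrightarrow> g \<bullet> w = 0" for w
  proof -
    obtain c d where cd: "\<forall>u\<in>V. 0 \<le> c u" "w = (\<Sum>u\<in>V. c u *\<^sub>R u) + d *\<^sub>R y"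
      using Erep[OF Ebip[OF w(1)]] w(2) by force
    have "f3 \<bullet> w = 0" using w(2) by (simp add: cf inner_sum_left)
    then have s0: "(\<Sum>u\<in>V. c u * (f3 \<bullet> u)) = 0" using cd(2) f3(2) by (simp add: inner_add_right inner_sum_right)
    have nn: "0 \<le> c u * (f3 \<bullet> u)" if "u \<in> V" for u
      using that cd(1) V(2) span_dualD(1)[OF f3(1), of u] by auto
    have "\<exists>e. c u *\<^sub>R u = e *\<^sub>R y" if u: "u \<in> V" for u
    proof (cases "c u = 0")
      case False
      have "c u * (f3 \<bullet> u) = 0" by (rule sum_nonneg_0[OF V(1) nn s0 u])
      then obtain e where "u = e *\<^sub>R y" using ray[of u] u V(2) False by auto
      then show ?thesis by (intro exI[of _ "c u * e"]) simp
    qed (auto intro: exI[of _ 0])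
    then obtain e where e: "\<And>u. u \<in> V \<Longrightarrow> c u *\<^sub>R u = e u *\<^sub>R y" by metis
    have "w = (\<Sum>u\<in>V. e u *\<^sub>R y) + d *\<^sub>R y" using cd(2) e by simp
    then show ?thesis by (intro exI[of _ "(\<Sum>u\<in>V. e u) + d"]) (simp add: scaleR_left.sum scaleR_add_left)
  qed
  \<comment> \<open>A dual vector of \<open>g\<close> lies in \<open>E\<close>. One of the
    generators in its representation is positive under \<open>g\<close>, and the other normals must
    vanish at that generator.\<close>
  have "\<exists>u\<in>V. 0 < g \<bullet> u \<and> (\<forall>g'\<in>B. g' \<noteq> g \<longrightarrow> g' \<bullet> u = 0)" if g: "g \<in> B" for g
  proof -
    obtain w where w: "w \<in> span B" "0 < w \<bullet> g" "\<forall>a\<in>B. a \<noteq> g \<longrightarrow> w \<bullet> a = 0"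
      by (rule dual_vector[OF B(2) g]) blast
    have wC: "w \<in> span C" using w(1) span_minimal[of B "span C"] BC span_dualD(2) by blast
    have wg: "0 < g \<bullet> w" "\<And>g'. g' \<in> B \<Longrightarrow> g' \<noteq> g \<Longrightarrow> g' \<bullet> w = 0" using w by (auto simp: inner_commute)
    have "w \<in> E"
    proof (rule Ebip[OF wC])
      fix g' assume "g' \<in> B"
      then show "0 \<le> g' \<bullet> w" using wg by (cases "g' = g") auto
    qed
    then obtain c d where cd: "\<forall>u\<in>V. 0 \<le> c u" "w = (\<Sum>u\<in>V. c u *\<^sub>R u) + d *\<^sub>R y" using Erep by blast
    have val: "g' \<bullet> w = (\<Sum>u\<in>V. c u * (g' \<bullet> u))" if "g' \<in> B" for g'
      by (simp add: cd(2) inner_add_right inner_sum_right By[OF that])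
    have "\<exists>u\<in>V. c u * (g \<bullet> u) \<noteq> 0" using val[OF g] wg(1) by (metis (no_types, lifting) less_irrefl sum.neutral)
    then obtain u where u: "u \<in> V" "c u * (g \<bullet> u) \<noteq> 0" by blast
    have uC: "u \<in> C" using u V by blast
    have "0 < g \<bullet> u" using span_dualD(1)[OF BC[OF g] uC] u(2) by (auto simp: less_le)
    moreover have "g' \<bullet> u = 0" if g': "g' \<in> B" "g' \<noteq> g" for g'
    proof -
      have nn: "0 \<le> c u * (g' \<bullet> u)" if "u \<in> V" for u
        using that cd(1) V(2) span_dualD(1)[OF BC[OF g'(1)], of u] by auto
      have s0: "(\<Sum>u\<in>V. c u * (g' \<bullet> u)) = 0" using val[OF g'(1)] wg(2)[OF g'] by simp
      have "c u * (g' \<bullet> u) = 0" by (rule sum_nonneg_0[OF V(1) nn s0 u(1)])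
      then show ?thesis using u(2) by auto
    qed
    ultimately show ?thesis using u(1) by blast
  qed
  then obtain v where v: "\<And>g. g \<in> B \<Longrightarrow> v g \<in> V" "\<And>g. g \<in> B \<Longrightarrow> 0 < g \<bullet> v g"
    "\<And>g g'. g \<in> B \<Longrightarrow> g' \<in> B \<Longrightarrow> g' \<noteq> g \<Longrightarrow> g' \<bullet> v g = 0" by metis
  note nonsimp = C(2)
  interpret vertex_frame C y B v
    by unfold_locales (use C yC B v V null in auto)
  have ext: "extreme_ray C y" by (rule exposes_ray_extreme[OF exp])
  have extv: "extreme_ray C (v g)" if g: "g \<in> B" for g
  proof -
    obtain g' where g': "g' \<in> B" "v g \<in> D g'" using v(1)[OF g] by (auto simp: V_def)
    show ?thesis by (rule simplicial_face_extreme_ray[OF BC[OF g'(1)] D(1)[OF g'(1)] D(2)[OF g'(1)] D(3)[OF g'(1)] g'(2)])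
  qed
  have "0 \<le> \<phi> \<bullet> k" if "g \<in> B" "k \<in> C" "g \<bullet> k = 0" for g k
    by (rule facet_coordinate_nonneg[OF that(1) D(1)[OF that(1)] D(2)[OF that(1)] D(3)[OF that(1)] ext extv that(2,3)])
  then have facets: "\<forall>g\<in>B. \<forall>k\<in>C. g \<bullet> k = 0 \<longrightarrow> 0 \<le> \<phi> \<bullet> k" by blast
  obtain e where e: "e \<in> C" "\<phi> \<bullet> e < 0"
    using coordinate_nonneg_imp_simplicial nonsimp by (meson not_le)
  show False
  proof (cases "\<exists>g\<in>B. \<exists>f\<in>span_dual C. f \<bullet> v g = 0 \<and> f \<bullet> y \<noteq> 0")
    case True
    then obtain g f where gf: "g \<in> B" "f \<in> span_dual C" "f \<bullet> v g = 0" "f \<bullet> y \<noteq> 0" by blast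
    \<comment> \<open>\<open>v g\<close> was taken from some face through \<open>y\<close>; the
      normal of that face cannot be \<open>g\<close> and serves as the second normal.\<close>
    obtain g' where g': "g' \<in> B" "v g \<in> D g'" using v(1)[OF gf(1)] by (auto simp: V_def)
    then have "g' \<bullet> v g = 0" using Dexp by (auto simp: exposed_by_def)
    then have "g' \<noteq> g" using v(2)[OF gf(1)] by auto
    then show False using kite_sandwich_explicit[OF facets e gf(1) g'(1) _ gf(2,3,4)] K by blast
  next
    case False
    then have sub: "\<forall>g\<in>B. \<forall>f\<in>span_dual C. f \<bullet> v g = 0 \<longrightarrow> f \<bullet> y = 0" by blast
    show False using kite_sandwich_from_near_slice[OF nonsimp exp facets e sub] K by blast
  qed
qed

section \<open>Positive maps detected as not entanglement breaking\<close>

text \<open>\<open>D\<close> plays the role of the dual of the domain cone, so \<open>P\<close> is positive from the dual of \<open>D\<close> to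
  \<open>C\<close>; the trace form with \<open>W\<close> is nonnegative on the rank-one maps \<open>v \<mapsto> (d \<bullet> v) c\<close> with \<open>d \<in> D\<close>,
  \<open>c \<in> C\<close>, but negative at \<open>P\<close>.\<close>

definition entangled :: "'a::euclidean_space set \<Rightarrow> 'b::euclidean_space set \<Rightarrow> bool" where
  "entangled D C \<longleftrightarrow> (\<exists>P W. linear P \<and> linear W \<and>
     (\<forall>f. (\<forall>d\<in>D. 0 \<le> f \<bullet> d) \<longrightarrow> P f \<in> C) \<and> (\<forall>d\<in>D. \<forall>c\<in>C. 0 \<le> W d \<bullet> c) \<and>
     (\<Sum>b\<in>Basis. W b \<bullet> P b) < 0)"

section \<open>Pairing two kites\<close>

lemma sum_Basis_inner_product:
  fixes u v :: "'a::euclidean_space"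
  shows "(\<Sum>b\<in>Basis. (u \<bullet> b) * (v \<bullet> b)) = u \<bullet> v"
  by (simp add: euclidean_inner[of u v])

lemma linear_rank_one: "linear (\<lambda>v. (u \<bullet> v) *\<^sub>R x)"
  by (rule linearI) (simp_all add: inner_add_right scaleR_add_left)

text \<open>The arguments are points of the cone over a square, given by their four facet values. If
  \<open>s2 \<le> s1\<close>, the two relations rewrite the form with nonnegative coefficients. The
  conditions on \<delta> keep each argument away from one corner of the square, which leaves room
  for a multiple of \<open>s3 t3\<close>.\<close>

lemma square_form_bound:
  fixes s1 s2 s3 s4 t1 t2 t3 t4 \<delta> :: real
  assumes s: "0 \<le> s1" "0 \<le> s2" "0 \<le> s3" "0 \<le> s4" "s1 + s3 = s2 + s4"
    and t: "0 \<le> t1" "0 \<le> t2" "0 \<le> t3" "0 \<le> t4" "t1 + t3 = t2 + t4"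
    and \<delta>: "0 < \<delta>" "\<delta> \<le> 1" "\<delta> * (s1 + s3) \<le> s1 + s4" "\<delta> * (t1 + t3) \<le> t1 + t2"
  shows "\<delta>\<^sup>2 / 4 * (s3 * t3) \<le> s1 * t1 + (s2 - s1) * t2 + s4 * t3"
proof -
  define \<epsilon> where "\<epsilon> = \<delta>\<^sup>2 / 4"
  have "\<delta>\<^sup>2 \<le> \<delta>" using \<delta> by (simp add: power2_eq_square mult_left_le)
  then have \<epsilon>: "0 \<le> \<epsilon>" "\<epsilon> \<le> \<delta> / 4" "\<epsilon> \<le> 1 / 4" using \<delta> by (auto simp: \<epsilon>_def)
  show ?thesis
  proof (cases "s2 \<le> s1")
    case True
    have "s1 * t1 + (s2 - s1) * t2 + s4 * t3 = s2 * t1 + (s1 - s2) * t4 + s3 * t3"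
    proof -
      have e: "s4 = s1 + s3 - s2" "t4 = t1 + t3 - t2" using s t by auto
      show ?thesis unfolding e by (simp add: algebra_simps)
    qed
    moreover have "0 \<le> s2 * t1" "0 \<le> (s1 - s2) * t4" "0 \<le> s3 * t3" using s t True by auto
    moreover have "\<epsilon> * (s3 * t3) \<le> 1 * (s3 * t3)" using \<epsilon> s t by (intro mult_right_mono) auto
    ultimately show ?thesis by (simp add: \<epsilon>_def)
  next
    case False
    define w where "w = s2 - s1"
    have w: "0 \<le> w" using False by (simp add: w_def)
    have s3: "s3 = w + s4" using s by (simp add: w_def)
    have "\<epsilon> * (s4 * t3) \<le> 1 * (s4 * t3)" using \<epsilon> s t by (intro mult_right_mono) auto
    \<comment> \<open>Either \<open>t2\<close> dominates \<open>\<epsilon> t3\<close>, or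
      \<open>t1\<close> is at least \<open>\<delta> t3 / 2\<close>. In the latter case
      \<open>\<delta> w \<le> s1 + s4\<close>, and the terms with \<open>s1\<close> and
      \<open>s4\<close> pay for \<open>w t3\<close>.\<close>
    have main: "\<epsilon> * ((w + s4) * t3) \<le> s1 * t1 + w * t2 + s4 * t3"
    proof (cases "\<epsilon> * t3 \<le> t2")
      case True
      have "w * (\<epsilon> * t3) \<le> w * t2" using True w by (intro mult_left_mono)
      moreover have "\<epsilon> * (s4 * t3) \<le> 1 * (s4 * t3)" using \<epsilon> s t by (intro mult_right_mono) auto
      moreover have "0 \<le> s1 * t1" using s t by simp
      ultimately show ?thesis by (simp add: algebra_simps)
    next
      case False
      have "\<delta> * t3 \<le> \<delta> * (t1 + t3)" using \<delta> t by (intro mult_left_mono) auto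
      moreover have "\<epsilon> * t3 \<le> \<delta> / 4 * t3" using \<epsilon> t by (intro mult_right_mono) auto
      moreover have "0 \<le> \<delta> * t3" using \<delta> t by simp
      ultimately have t1: "\<delta> / 2 * t3 \<le> t1" using False \<delta>(4) by linarith
      have "\<delta> * w \<le> \<delta> * (s1 + s3)" using \<delta> s w s3 by (intro mult_left_mono) auto
      then have sw: "\<delta> * w \<le> s1 + s4" using \<delta>(3) by linarith
      have "\<epsilon> * (w * t3) = \<delta> / 4 * (\<delta> * w * t3)" by (simp add: \<epsilon>_def power2_eq_square)
      also have "\<dots> \<le> \<delta> / 4 * ((s1 + s4) * t3)" using sw t \<delta> by (intro mult_left_mono mult_right_mono) auto
      finally have 1: "\<epsilon> * (w * t3) \<le> \<delta> / 4 * (s1 * t3) + \<delta> / 4 * (s4 * t3)" by (simp add: algebra_simps)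
      have 2: "s1 * (\<delta> / 2 * t3) \<le> s1 * t1" using t1 s by (intro mult_left_mono)
      have p: "0 \<le> s1 * t3" "0 \<le> s4 * t3" "0 \<le> w * t2" using s t w by auto
      have 3: "\<delta> / 4 * (s1 * t3) \<le> s1 * (\<delta> / 2 * t3)" using p(1) \<delta> by (simp add: field_simps)
      have 4: "\<delta> / 4 * (s4 * t3) \<le> 1 / 4 * (s4 * t3)" using p(2) \<delta> by (intro mult_right_mono) auto
      have 5: "\<epsilon> * (s4 * t3) \<le> 1 / 4 * (s4 * t3)" using p(2) \<epsilon> by (intro mult_right_mono) auto
      have "\<epsilon> * ((w + s4) * t3) = \<epsilon> * (w * t3) + \<epsilon> * (s4 * t3)" by (simp add: algebra_simps)
      then show ?thesis using 1 2 3 4 5 p by linarith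
    qed
    then show ?thesis by (simp add: \<epsilon>_def s3 w_def)
  qed
qed

text \<open>The trace of the pairing in \<open>entangled_if_kite_sandwiches\<close>; \<open>m i j\<close> and \<open>n i j\<close> stand for
  \<open>f\<^sub>i \<bullet> k\<^sub>j\<close> in the two cones.\<close>

lemma kite_trace:
  fixes m n :: "nat \<Rightarrow> nat \<Rightarrow> real"
  assumes "m 1 1 = 0" "m 2 2 = 0" "m 3 3 = 0" "m 4 4 = 0" "n 1 1 = 0" "n 2 2 = 0" "n 3 3 = 0" "n 4 4 = 0"
    and row: "\<And>i. m i 1 + m i 3 = m i 2 + m i 4" "\<And>i. n i 1 + n i 3 = n i 2 + n i 4"
    and col: "\<And>j. m 1 j + m 3 j = m 2 j + m 4 j" "\<And>j. n 1 j + n 3 j = n 2 j + n 4 j"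
  shows "m 1 1 * n 1 3 + (m 1 2 - m 1 1) * n 1 4 + m 1 4 * n 1 1
    + ((m 2 1 - m 1 1) * n 2 3 + ((m 2 2 - m 1 2) - (m 2 1 - m 1 1)) * n 2 4 + (m 2 4 - m 1 4) * n 2 1)
    + (m 4 1 * n 3 3 + (m 4 2 - m 4 1) * n 3 4 + m 4 4 * n 3 1)
    = - ((m 1 2 - m 4 3) * (n 1 2 - n 4 3))"
    "m 3 1 * n 3 3 + (m 3 2 - m 3 1) * n 3 4 + m 3 4 * n 3 1 = m 3 4 * n 3 2"
    "n 1 4 - n 2 3 = - (n 1 2 - n 4 3)"
proof -
  define a b c d where "a = m 1 2" "b = m 4 3" "c = m 1 4" "d = m 2 1"
  define p q r s where "p = n 1 2" "q = n 4 3" "r = n 1 4" "s = n 2 1"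
  have M: "m 1 2 = a" "m 4 3 = b" "m 1 4 = c" "m 2 1 = d" "m 1 3 = a + c" "m 2 3 = a + c - b"
    "m 2 4 = d + a + c - b" "m 3 4 = d + a - b" "m 4 1 + b = m 4 2" "m 3 2 = m 4 2 - a" "m 3 1 = d + m 4 1"
    using row(1)[of 1] row(1)[of 2] row(1)[of 4] col(1)[of 1] col(1)[of 2] col(1)[of 3] col(1)[of 4] assms(1-4)
    by (auto simp: a_b_c_d_def)
  have N: "n 1 2 = p" "n 4 3 = q" "n 1 4 = r" "n 2 1 = s" "n 1 3 = p + r" "n 2 3 = p + r - q"
    "n 2 4 = s + p + r - q" "n 3 4 = s + p - q" "n 4 1 + q = n 4 2" "n 3 2 = n 4 2 - p" "n 3 1 = s + n 4 1"
    using row(2)[of 1] row(2)[of 2] row(2)[of 4] col(2)[of 1] col(2)[of 2] col(2)[of 3] col(2)[of 4] assms(5-8)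
    by (auto simp: p_q_r_s_def)
  show "m 1 1 * n 1 3 + (m 1 2 - m 1 1) * n 1 4 + m 1 4 * n 1 1
    + ((m 2 1 - m 1 1) * n 2 3 + ((m 2 2 - m 1 2) - (m 2 1 - m 1 1)) * n 2 4 + (m 2 4 - m 1 4) * n 2 1)
    + (m 4 1 * n 3 3 + (m 4 2 - m 4 1) * n 3 4 + m 4 4 * n 3 1)
    = - ((m 1 2 - m 4 3) * (n 1 2 - n 4 3))"
    unfolding M(9)[symmetric] unfolding M(1-8,10,11) N(1-8,10,11) assms(1-8) by (simp add: algebra_simps)
  have e: "m 3 2 - m 3 1 = - m 3 4" "n 3 1 = n 3 2 + n 3 4"
    using row(1)[of 3] row(2)[of 3] assms(3,7) by simp_all
  show "m 3 1 * n 3 3 + (m 3 2 - m 3 1) * n 3 4 + m 3 4 * n 3 1 = m 3 4 * n 3 2"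
    unfolding e assms(7) by (simp add: algebra_simps)
  show "n 1 4 - n 2 3 = - (n 1 2 - n 4 3)" unfolding N(1-8) by simp
qed

lemma relative_positive_bound:
  assumes C: "pointed_cone C" and pos: "\<And>v. v \<in> C \<Longrightarrow> v \<noteq> 0 \<Longrightarrow> 0 < g \<bullet> v"
  obtains \<delta> where "0 < \<delta>" "\<delta> \<le> 1" "\<And>v. v \<in> C \<Longrightarrow> \<delta> * (h \<bullet> v) \<le> g \<bullet> v"
proof -
  obtain m where m: "m > 0" "\<And>v. v \<in> C \<Longrightarrow> m * norm v \<le> g \<bullet> v"
    using positive_functional_norm_bound[OF C pos] by blast
  define \<delta> where "\<delta> = min 1 (m / (norm h + 1))"
  have n: "0 < norm h + 1" by (simp add: add_nonneg_pos)
  have \<delta>: "0 < \<delta>" "\<delta> \<le> 1" "\<delta> * (norm h + 1) \<le> m"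
  proof -
    have "\<delta> \<le> m / (norm h + 1)" by (simp add: \<delta>_def)
    then show "\<delta> * (norm h + 1) \<le> m" using n by (simp add: pos_le_divide_eq)
  qed (use m n in \<open>auto simp: \<delta>_def\<close>)
  have "\<delta> * (h \<bullet> v) \<le> g \<bullet> v" if "v \<in> C" for v
  proof -
    have "\<delta> * (h \<bullet> v) \<le> \<delta> * (norm h * norm v)" using \<delta> by (intro mult_left_mono norm_cauchy_schwarz) simp
    also have "\<dots> \<le> (\<delta> * (norm h + 1)) * norm v" using \<delta>(1) by (simp add: algebra_simps)
    also have "\<dots> \<le> m * norm v" using \<delta>(3) by (intro mult_right_mono) auto
    also have "\<dots> \<le> g \<bullet> v" by (rule m(2)[OF that])
    finally show ?thesis .
  qed
  then show ?thesis using that \<delta> by blast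
qed

definition kite_data :: "'a::euclidean_space set \<Rightarrow> (nat \<Rightarrow> 'a) \<Rightarrow> (nat \<Rightarrow> 'a) \<Rightarrow> bool" where
  "kite_data C k f \<longleftrightarrow> (\<forall>i. k i \<in> C \<and> f i \<in> span_dual C) \<and> k 1 + k 3 = k 2 + k 4 \<and> f 1 + f 3 = f 2 + f 4 \<and>
     f 1 \<bullet> k 1 = 0 \<and> f 2 \<bullet> k 2 = 0 \<and> f 3 \<bullet> k 3 = 0 \<and> f 4 \<bullet> k 4 = 0 \<and>
     (\<forall>v\<in>C. v \<noteq> 0 \<longrightarrow> 0 < (f 1 + f 2) \<bullet> v \<and> 0 < (f 1 + f 4) \<bullet> v) \<and> 0 < f 3 \<bullet> k 2 \<and> 0 < f 3 \<bullet> k 4"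

text \<open>The conditions are symmetric under exchanging 2 and 4, so a kite comes with its
  reflection, which will supply the opposite sign in the trace.\<close>

lemma kite_dataI:
  assumes "pointed_cone C" "kite_sandwich C"
  obtains k f where "kite_data C k f" "kite_data C (k(2 := k 4, 4 := k 2)) (f(2 := f 4, 4 := f 2))"
proof -
  obtain k1 k2 k3 k4 f1 f2 f3 f4 where *: "k1 \<in> C" "k2 \<in> C" "k3 \<in> C" "k4 \<in> C"
    "f1 \<in> span_dual C" "f2 \<in> span_dual C" "f3 \<in> span_dual C" "f4 \<in> span_dual C"
    "k1 + k3 = k2 + k4 \<and> f1 + f3 = f2 + f4 \<and>
       f1 \<bullet> k1 = 0 \<and> f2 \<bullet> k2 = 0 \<and> f3 \<bullet> k3 = 0 \<and> f4 \<bullet> k4 = 0 \<and>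
       (\<forall>v\<in>C. v \<noteq> 0 \<longrightarrow> 0 < (f1 + f2) \<bullet> v \<and> 0 < (f1 + f4) \<bullet> v) \<and>
       0 < f3 \<bullet> k2 \<and> 0 < f3 \<bullet> k4"
    using assms(2) unfolding kite_sandwich_def by metis
  show ?thesis
    by (rule that[of "\<lambda>i. if i = 1 then k1 else if i = 2 then k2 else if i = 3 then k3 else k4"
          "\<lambda>i. if i = 1 then f1 else if i = 2 then f2 else if i = 3 then f3 else f4"])
      (use * in \<open>auto simp: kite_data_def add.commute\<close>)
qed

lemma kite_data_pairing:
  assumes "kite_data C k f"
  shows "f i \<bullet> k 1 + f i \<bullet> k 3 = f i \<bullet> k 2 + f i \<bullet> k 4" "f 1 \<bullet> k j + f 3 \<bullet> k j = f 2 \<bullet> k j + f 4 \<bullet> k j"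
    "f 1 \<bullet> v + f 3 \<bullet> v = f 2 \<bullet> v + f 4 \<bullet> v" "g \<bullet> k 1 + g \<bullet> k 3 = g \<bullet> k 2 + g \<bullet> k 4"
  using assms by (auto simp: kite_data_def inner_add_right[symmetric] inner_add_left[symmetric])

lemma entangled_from_kite_data:
  assumes D: "pointed_cone D" and C: "pointed_cone C" and kf: "kite_data D k f" and lg: "kite_data C l g"
    and sign: "0 \<le> (f 1 \<bullet> k 2 - f 4 \<bullet> k 3) * (g 1 \<bullet> l 2 - g 4 \<bullet> l 3)"
  shows "entangled D C"
proof -
  have kD: "k i \<in> D" "f i \<in> span_dual D" and lC: "l i \<in> C" "g i \<in> span_dual C" for i
    using kf lg by (auto simp: kite_data_def)
  obtain \<delta>1 where \<delta>1: "0 < \<delta>1" "\<delta>1 \<le> 1" "\<And>v. v \<in> D \<Longrightarrow> \<delta>1 * ((f 1 + f 3) \<bullet> v) \<le> (f 1 + f 4) \<bullet> v"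
    using relative_positive_bound[OF D, of "f 1 + f 4" "f 1 + f 3"] kf unfolding kite_data_def by blast
  obtain \<delta>2 where \<delta>2: "0 < \<delta>2" "\<delta>2 \<le> 1" "\<And>v. v \<in> C \<Longrightarrow> \<delta>2 * ((g 1 + g 3) \<bullet> v) \<le> (g 1 + g 2) \<bullet> v"
    using relative_positive_bound[OF C, of "g 1 + g 2" "g 1 + g 3"] lg unfolding kite_data_def by blast
  define \<delta> where "\<delta> = min \<delta>1 \<delta>2"
  have \<delta>: "0 < \<delta>" "\<delta> \<le> 1" using \<delta>1 \<delta>2 by (auto simp: \<delta>_def)
  define \<epsilon> where "\<epsilon> = \<delta>\<^sup>2 / 4"
  have \<epsilon>: "0 < \<epsilon>" using \<delta> by (simp add: \<epsilon>_def)
  \<comment> \<open>Both maps factor through the cone over a square, whose points are given by four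
    facet values with \<open>s1 + s3 = s2 + s4\<close>. On its rays \<open>(1,1,0,0)\<close>,
    \<open>(0,1,1,0)\<close>, \<open>(0,0,1,1)\<close>, \<open>(1,0,0,1)\<close>, \<open>P\<close>
    takes the values \<open>l 3\<close>, \<open>l 4\<close>, \<open>l 1\<close>, \<open>l 2\<close>,
    and the first three terms of \<open>W\<close> the values \<open>g 1\<close>, \<open>g 2\<close>,
    \<open>g 3\<close>, \<open>g 4\<close>; the two matchings differ by a half turn. The last term
    of \<open>W\<close> spends the slack of \<open>square_form_bound\<close> to push the trace below
    0.\<close>
  define P where "P v = (k 1 \<bullet> v) *\<^sub>R l 3 + ((k 2 - k 1) \<bullet> v) *\<^sub>R l 4 + (k 4 \<bullet> v) *\<^sub>R l 1" for v
  define W where "W v = (f 1 \<bullet> v) *\<^sub>R g 1 + ((f 2 - f 1) \<bullet> v) *\<^sub>R g 2 + (f 4 \<bullet> v) *\<^sub>R g 3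
    - \<epsilon> *\<^sub>R ((f 3 \<bullet> v) *\<^sub>R g 3)" for v
  have linP: "linear P"
    unfolding P_def[abs_def] by (rule linear_compose_add[OF linear_compose_add]; rule linear_rank_one)
  have linW: "linear W"
  proof -
    have "linear (\<lambda>v. (f 1 \<bullet> v) *\<^sub>R g 1 + ((f 2 - f 1) \<bullet> v) *\<^sub>R g 2 + (f 4 \<bullet> v) *\<^sub>R g 3)"
      by (rule linear_compose_add[OF linear_compose_add]; rule linear_rank_one)
    moreover have "linear (\<lambda>v. \<epsilon> *\<^sub>R ((f 3 \<bullet> v) *\<^sub>R g 3))"
      by (rule linear_compose_scale_right[OF linear_rank_one])
    ultimately show ?thesis unfolding W_def[abs_def] by (rule linear_compose_sub)
  qed
  have "P h \<in> C" if h: "\<forall>d\<in>D. 0 \<le> h \<bullet> d" for h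
  proof -
    have s: "0 \<le> k i \<bullet> h" for i using bspec[OF h kD(1)[of i]] unfolding inner_commute[of h] .
    have e: "k 1 \<bullet> h + k 3 \<bullet> h = k 2 \<bullet> h + k 4 \<bullet> h"
      using kite_data_pairing(4)[OF kf, of h] unfolding inner_commute[of h] .
    show ?thesis
    proof (cases "k 1 \<bullet> h \<le> k 2 \<bullet> h")
      case True
      then show ?thesis unfolding P_def using s
        by (intro pointed_cone_add[OF C] pointed_cone_scale[OF C] lC) (auto simp: inner_diff_left)
    next
      case False
      have l4: "l 4 = l 1 + l 3 - l 2" using lg by (simp add: kite_data_def)
      have "P h = (k 2 \<bullet> h) *\<^sub>R l 3 + (k 1 \<bullet> h - k 2 \<bullet> h) *\<^sub>R l 2 + (k 3 \<bullet> h) *\<^sub>R l 1"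
      proof -
        have k4: "k 4 \<bullet> h = k 1 \<bullet> h + k 3 \<bullet> h - k 2 \<bullet> h" using e by simp
        show ?thesis unfolding P_def l4 k4 by (simp add: inner_diff_left algebra_simps)
      qed
      also have "\<dots> \<in> C" using s False
        by (intro pointed_cone_add[OF C] pointed_cone_scale[OF C] lC) auto
      finally show ?thesis .
    qed
  qed
  moreover have "0 \<le> W d \<bullet> c" if d: "d \<in> D" and c: "c \<in> C" for d c
  proof -
    have s: "0 \<le> f i \<bullet> d" for i by (rule span_dualD(1)[OF kD(2) d])
    have t: "0 \<le> g i \<bullet> c" for i by (rule span_dualD(1)[OF lC(2) c])
    have "\<delta> * (f 1 \<bullet> d + f 3 \<bullet> d) \<le> \<delta>1 * ((f 1 + f 3) \<bullet> d)"
      unfolding inner_add_left using s by (intro mult_right_mono) (auto simp: \<delta>_def)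
    also have "\<dots> \<le> f 1 \<bullet> d + f 4 \<bullet> d" using \<delta>1(3)[OF d] by (simp add: inner_add_left)
    finally have 1: "\<delta> * (f 1 \<bullet> d + f 3 \<bullet> d) \<le> f 1 \<bullet> d + f 4 \<bullet> d" .
    have "\<delta> * (g 1 \<bullet> c + g 3 \<bullet> c) \<le> \<delta>2 * ((g 1 + g 3) \<bullet> c)"
      unfolding inner_add_left using t by (intro mult_right_mono) (auto simp: \<delta>_def)
    also have "\<dots> \<le> g 1 \<bullet> c + g 2 \<bullet> c" using \<delta>2(3)[OF c] by (simp add: inner_add_left)
    finally have 2: "\<delta> * (g 1 \<bullet> c + g 3 \<bullet> c) \<le> g 1 \<bullet> c + g 2 \<bullet> c" .
    have "\<delta>\<^sup>2 / 4 * ((f 3 \<bullet> d) * (g 3 \<bullet> c))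
        \<le> (f 1 \<bullet> d) * (g 1 \<bullet> c) + (f 2 \<bullet> d - f 1 \<bullet> d) * (g 2 \<bullet> c) + (f 4 \<bullet> d) * (g 3 \<bullet> c)"
      by (rule square_form_bound[OF s s s s kite_data_pairing(3)[OF kf] t t t t kite_data_pairing(3)[OF lg] \<delta> 1 2])
    then show ?thesis by (simp add: W_def \<epsilon>_def inner_add_left inner_diff_left)
  qed
  moreover have "(\<Sum>b\<in>Basis. W b \<bullet> P b) < 0"
  proof -
    define m where "m i j = f i \<bullet> k j" for i j
    define n where "n i j = g i \<bullet> l j" for i j
    have pr: "(\<Sum>b\<in>Basis. ((u \<bullet> b) *\<^sub>R x) \<bullet> P b)
      = (u \<bullet> k 1) * (x \<bullet> l 3) + (u \<bullet> k 2 - u \<bullet> k 1) * (x \<bullet> l 4) + (u \<bullet> k 4) * (x \<bullet> l 1)" for u x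
    proof -
      have "(\<Sum>b\<in>Basis. ((u \<bullet> b) *\<^sub>R x) \<bullet> P b) =
        (\<Sum>b\<in>Basis. ((u \<bullet> b) * (k 1 \<bullet> b)) * (x \<bullet> l 3) + ((u \<bullet> b) * ((k 2 - k 1) \<bullet> b)) * (x \<bullet> l 4)
          + ((u \<bullet> b) * (k 4 \<bullet> b)) * (x \<bullet> l 1))"
        by (rule sum.cong) (simp_all add: P_def inner_add_right algebra_simps)
      also have "\<dots> = (u \<bullet> k 1) * (x \<bullet> l 3) + (u \<bullet> (k 2 - k 1)) * (x \<bullet> l 4) + (u \<bullet> k 4) * (x \<bullet> l 1)"
        unfolding sum.distrib sum_distrib_right[symmetric] sum_Basis_inner_product ..
      finally show ?thesis by (simp add: inner_diff_right)
    qed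
    have "(\<Sum>b\<in>Basis. W b \<bullet> P b) = (\<Sum>b\<in>Basis. ((f 1 \<bullet> b) *\<^sub>R g 1) \<bullet> P b + (((f 2 - f 1) \<bullet> b) *\<^sub>R g 2) \<bullet> P b
        + ((f 4 \<bullet> b) *\<^sub>R g 3) \<bullet> P b - \<epsilon> * (((f 3 \<bullet> b) *\<^sub>R g 3) \<bullet> P b))"
      by (rule sum.cong) (simp_all add: W_def inner_add_left inner_diff_left)
    also have "\<dots> = (m 1 1 * n 1 3 + (m 1 2 - m 1 1) * n 1 4 + m 1 4 * n 1 1
      + ((m 2 1 - m 1 1) * n 2 3 + ((m 2 2 - m 1 2) - (m 2 1 - m 1 1)) * n 2 4 + (m 2 4 - m 1 4) * n 2 1)
      + (m 4 1 * n 3 3 + (m 4 2 - m 4 1) * n 3 4 + m 4 4 * n 3 1))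
      - \<epsilon> * (m 3 1 * n 3 3 + (m 3 2 - m 3 1) * n 3 4 + m 3 4 * n 3 1)"
      unfolding sum.distrib sum_subtractf sum_distrib_left[symmetric] pr
      by (simp add: m_def n_def inner_diff_left)
    also have "\<dots> = - ((m 1 2 - m 4 3) * (n 1 2 - n 4 3)) - \<epsilon> * (m 3 4 * n 3 2)"
    proof -
      have z: "m 1 1 = 0" "m 2 2 = 0" "m 3 3 = 0" "m 4 4 = 0" "n 1 1 = 0" "n 2 2 = 0" "n 3 3 = 0" "n 4 4 = 0"
        using kf lg by (auto simp: kite_data_def m_def n_def)
      have r: "m i 1 + m i 3 = m i 2 + m i 4" "n i 1 + n i 3 = n i 2 + n i 4"
        "m 1 j + m 3 j = m 2 j + m 4 j" "n 1 j + n 3 j = n 2 j + n 4 j" for i j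
        using kite_data_pairing[OF kf] kite_data_pairing[OF lg] by (auto simp: m_def n_def)
      show ?thesis using kite_trace(1,2)[OF z r] by simp
    qed
    also have "\<dots> < 0"
    proof -
      have "0 < m 3 4 * n 3 2" using kf lg by (simp add: kite_data_def m_def n_def)
      then have "0 < \<epsilon> * (m 3 4 * n 3 2)" using \<epsilon> by simp
      then show ?thesis using sign by (simp add: m_def n_def)
    qed
    finally show ?thesis .
  qed
  ultimately show ?thesis unfolding entangled_def using linP linW by blast
qed

text \<open>Reflecting the second kite reverses the sign of its factor in the trace, so the sign
  condition can always be met.\<close>

lemma entangled_if_kite_sandwiches:
  assumes D: "pointed_cone D" "kite_sandwich D" and C: "pointed_cone C" "kite_sandwich C"
  shows "entangled D C"
proof -
  obtain k f where kf: "kite_data D k f" by (rule kite_dataI[OF D])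
  obtain l g where lg: "kite_data C l g" "kite_data C (l(2 := l 4, 4 := l 2)) (g(2 := g 4, 4 := g 2))"
    by (rule kite_dataI[OF C])
  show ?thesis
  proof (cases "0 \<le> (f 1 \<bullet> k 2 - f 4 \<bullet> k 3) * (g 1 \<bullet> l 2 - g 4 \<bullet> l 3)")
    case True
    then show ?thesis by (rule entangled_from_kite_data[OF D(1) C(1) kf lg(1)])
  next
    case False
    have e: "g 1 \<bullet> l 4 - g 2 \<bullet> l 3 = - (g 1 \<bullet> l 2 - g 4 \<bullet> l 3)"
      using kite_data_pairing(1)[OF lg(1), of 1] kite_data_pairing(2)[OF lg(1), of 3] lg(1)
      by (simp add: kite_data_def)
    have "0 \<le> (f 1 \<bullet> k 2 - f 4 \<bullet> k 3) * (g 1 \<bullet> l 4 - g 2 \<bullet> l 3)"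
      using False unfolding e mult_minus_right by linarith
    then show ?thesis by (intro entangled_from_kite_data[OF D(1) C(1) kf lg(2)]) simp
  qed
qed

section \<open>Passage to transposes, faces and duals\<close>

lemma entangled_commute:
  assumes D: "pointed_cone D" and ent: "entangled D C"
  shows "entangled C D"
proof -
  obtain P W where PW': "linear P" "linear W" "\<forall>h. (\<forall>d\<in>D. 0 \<le> h \<bullet> d) \<longrightarrow> P h \<in> C"
    "\<forall>d\<in>D. \<forall>c\<in>C. 0 \<le> W d \<bullet> c" "(\<Sum>b\<in>Basis. W b \<bullet> P b) < 0"
    using ent unfolding entangled_def by (elim exE conjE)
  note PW = PW'(1,2) PW'(3)[THEN spec, THEN mp] PW'(4)[THEN bspec, THEN bspec] PW'(5)
  \<comment> \<open>The adjoints of \<open>P\<close> and \<open>W\<close> serve for the reversed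
    pair. By separation, \<open>D\<close> contains every vector on which all functionals nonnegative
    on \<open>D\<close> are nonnegative.\<close>
  have "adjoint P g \<in> D" if g: "\<forall>c\<in>C. 0 \<le> g \<bullet> c" for g
  proof (rule ccontr)
    assume "adjoint P g \<notin> D"
    then obtain f where f: "\<forall>d\<in>D. 0 \<le> f \<bullet> d" "f \<bullet> adjoint P g < 0"
      using convex_cone_separate_point[of D "adjoint P g"] pointed_coneD[OF D] by blast
    have "0 \<le> g \<bullet> P f" using g PW(3)[OF f(1)] by blast
    then show False using f(2) adjoint_works[OF PW(1), of f g] by (simp add: inner_commute)
  qed
  moreover have "0 \<le> adjoint W c \<bullet> d" if "c \<in> C" "d \<in> D" for c d
    using PW(4)[OF that(2,1)] adjoint_works[OF PW(2), of d c] by (simp add: inner_commute)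
  moreover have "(\<Sum>b\<in>Basis. adjoint W b \<bullet> adjoint P b) < 0"
  proof -
    have "(\<Sum>b\<in>Basis. adjoint W b \<bullet> adjoint P b) = (\<Sum>b\<in>Basis. \<Sum>a\<in>Basis. (W a \<bullet> b) * (P a \<bullet> b))"
    proof (rule sum.cong)
      fix b :: 'b
      have "adjoint W b \<bullet> adjoint P b = (\<Sum>a\<in>Basis. (adjoint W b \<bullet> a) * (adjoint P b \<bullet> a))"
        by (rule euclidean_inner)
      also have "\<dots> = (\<Sum>a\<in>Basis. (W a \<bullet> b) * (P a \<bullet> b))"
        using adjoint_works[OF PW(1)] adjoint_works[OF PW(2)] by (simp add: inner_commute)
      finally show "adjoint W b \<bullet> adjoint P b = (\<Sum>a\<in>Basis. (W a \<bullet> b) * (P a \<bullet> b))" .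
    qed simp
    also have "\<dots> = (\<Sum>a\<in>Basis. \<Sum>b\<in>Basis. (W a \<bullet> b) * (P a \<bullet> b))" by (rule sum.swap)
    also have "\<dots> = (\<Sum>a\<in>Basis. W a \<bullet> P a)" by (simp only: euclidean_inner[symmetric])
    finally show ?thesis using PW(5) by simp
  qed
  ultimately show ?thesis
    unfolding entangled_def using adjoint_linear[OF PW(1)] adjoint_linear[OF PW(2)] by blast
qed

lemma sum_Basis_rank_one:
  fixes P :: "'a::euclidean_space \<Rightarrow> 'b::euclidean_space"
  assumes "linear P"
  shows "(\<Sum>b\<in>Basis. ((e \<bullet> b) *\<^sub>R u) \<bullet> P b) = u \<bullet> P e"
proof -
  have "P e = P (\<Sum>b\<in>Basis. (e \<bullet> b) *\<^sub>R b)" by (simp add: euclidean_representation)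
  also have "\<dots> = (\<Sum>b\<in>Basis. (e \<bullet> b) *\<^sub>R P b)" by (simp add: linear_sum[OF assms] linear_scale[OF assms])
  finally show ?thesis by (simp add: inner_sum_right)
qed

text \<open>\<open>P\<close> can be kept, but \<open>W\<close> is nonnegative only against the face.
  A small multiple of the product of strictly positive functionals \<open>e\<close> and
  \<open>e'\<close> makes it positive near the face, and a large multiple of \<open>e\<close> times
  \<open>f\<close> repairs it elsewhere. The latter leaves the trace unchanged, since
  \<open>P e\<close> lies in the face, where \<open>f\<close> vanishes.\<close>

lemma entangled_face:
  assumes D: "pointed_cone D" and C: "pointed_cone C" and f: "\<And>c. c \<in> C \<Longrightarrow> 0 \<le> f \<bullet> c"
    and ent: "entangled D (exposed_by C f)"
  shows "entangled D C"
proof -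
  obtain P W where PW': "linear P" "linear W" "\<forall>h. (\<forall>d\<in>D. 0 \<le> h \<bullet> d) \<longrightarrow> P h \<in> exposed_by C f"
    "\<forall>d\<in>D. \<forall>c\<in>exposed_by C f. 0 \<le> W d \<bullet> c" "(\<Sum>b\<in>Basis. W b \<bullet> P b) < 0"
    using ent unfolding entangled_def by (elim exE conjE)
  note PW = PW'(1,2) PW'(3)[THEN spec, THEN mp] PW'(4)[THEN bspec, THEN bspec] PW'(5)
  obtain e where "e \<in> span_dual D" and e: "\<And>d. d \<in> D \<Longrightarrow> d \<noteq> 0 \<Longrightarrow> 0 < e \<bullet> d"
    using strictly_positive_functional[OF D] by blast
  obtain e' where "e' \<in> span_dual C" and e': "\<And>c. c \<in> C \<Longrightarrow> c \<noteq> 0 \<Longrightarrow> 0 < e' \<bullet> c"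
    using strictly_positive_functional[OF C] by blast
  have "\<forall>d\<in>D. 0 \<le> e \<bullet> d" using e by (metis inner_zero_right less_eq_real_def)
  from PW(3)[OF this] have fPe: "f \<bullet> P e = 0" by (simp add: exposed_by_def)
  define T where "T = (\<Sum>b\<in>Basis. W b \<bullet> P b)"
  have T: "T < 0" using PW(5) by (simp add: T_def)
  \<comment> \<open>With this value the added term raises the trace by at most
    \<open>- T / 2\<close>.\<close>
  define \<epsilon> where "\<epsilon> = - T / (2 * (\<bar>e' \<bullet> P e\<bar> + 1))"
  have \<epsilon>: "0 < \<epsilon>" using T by (simp add: \<epsilon>_def divide_neg_pos)
  have Teps: "T + \<epsilon> * (e' \<bullet> P e) < 0"
  proof -
    have "\<epsilon> * (e' \<bullet> P e) \<le> \<epsilon> * (\<bar>e' \<bullet> P e\<bar> + 1)" using \<epsilon> by (intro mult_left_mono) auto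
    also have "\<dots> = - T / 2"
    proof -
      have "\<bar>e' \<bullet> P e\<bar> + 1 \<noteq> 0" by linarith
      then show ?thesis by (simp add: \<epsilon>_def field_simps)
    qed
    finally show ?thesis using T by linarith
  qed
  define S where "S = (D \<inter> sphere 0 1) \<times> (C \<inter> sphere 0 1)"
  define h where "h p = W (fst p) \<bullet> snd p + \<epsilon> * ((e \<bullet> fst p) * (e' \<bullet> snd p))" for p
  define r where "r p = (e \<bullet> fst p) * (f \<bullet> snd p)" for p
  have cS: "compact S" unfolding S_def
    by (intro compact_Times closed_Int_compact compact_sphere pointed_coneD(1)[OF D] pointed_coneD(1)[OF C])
  have conth: "continuous_on UNIV h"
  proof -
    have "continuous_on UNIV (\<lambda>p. W (fst p))"
      by (rule continuous_on_compose2[of UNIV W UNIV fst])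
        (auto intro!: linear_continuous_on PW(2) continuous_intros simp: linear_conv_bounded_linear[symmetric])
    then show ?thesis unfolding h_def[abs_def] by (intro continuous_intros)
  qed
  have contr: "continuous_on X r" for X unfolding r_def[abs_def] by (intro continuous_intros)
  \<comment> \<open>The unit pairs at which the form is not yet positive. Their second component
    lies outside the face, so \<open>r\<close> is positive on this compact set and a multiple of it
    suffices.\<close>
  define Z where "Z = S \<inter> {p. h p \<le> 0}"
  have "closed {p. h p \<le> 0}" by (rule closed_Collect_le[OF conth continuous_on_const])
  then have cZ: "compact Z" unfolding Z_def by (rule compact_Int_closed[OF cS])
  have rZ: "0 < r p" if p: "p \<in> Z" for p
  proof -
    obtain d c where dc: "p = (d, c)" by (cases p)
    have d: "d \<in> D" "d \<noteq> 0" and c: "c \<in> C" "c \<noteq> 0" and hp: "h (d, c) \<le> 0"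
      using p by (auto simp: Z_def S_def dc)
    have "f \<bullet> c \<noteq> 0"
    proof
      assume "f \<bullet> c = 0"
      then have "0 \<le> W d \<bullet> c" using PW(4)[OF d(1), of c] c(1) by (simp add: exposed_by_def)
      moreover have "0 < \<epsilon> * ((e \<bullet> d) * (e' \<bullet> c))" using \<epsilon> e[OF d] e'[OF c] by simp
      ultimately show False using hp by (simp add: h_def)
    qed
    then show ?thesis using f[OF c(1)] e[OF d] by (simp add: r_def dc)
  qed
  have "\<exists>N\<ge>0. \<forall>p\<in>Z. 0 \<le> h p + N * r p"
  proof (cases "Z = {}")
    case False
    have "continuous_on Z (\<lambda>p. - h p / r p)"
      by (intro continuous_on_divide continuous_on_minus contr continuous_on_subset[OF conth]) (use rZ in force)+
    then obtain p0 where p0: "p0 \<in> Z" "\<And>p. p \<in> Z \<Longrightarrow> - h p / r p \<le> - h p0 / r p0"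
      using continuous_attains_sup[OF cZ False] by blast
    have "0 \<le> - h p0 / r p0" using p0(1) rZ[OF p0(1)] by (simp add: Z_def divide_nonpos_pos)
    moreover have "0 \<le> h p + (- h p0 / r p0) * r p" if "p \<in> Z" for p
      using mult_right_mono[OF p0(2)[OF that] less_imp_le[OF rZ[OF that]]] rZ[OF that] by simp
    ultimately show ?thesis by blast
  qed auto
  then obtain N where N: "0 \<le> N" "\<And>p. p \<in> Z \<Longrightarrow> 0 \<le> h p + N * r p" by blast
  have S: "0 \<le> h p + N * r p" if p: "p \<in> S" for p
  proof (cases "h p \<le> 0")
    case False
    obtain d c where dc: "p = (d, c)" by (cases p)
    have "d \<in> D" "d \<noteq> 0" "c \<in> C" using p by (auto simp: S_def dc)
    then have "0 \<le> r p" using e[of d] f[of c] by (simp add: r_def dc)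
    then show ?thesis using False N(1) by simp
  qed (use N(2) p in \<open>simp add: Z_def\<close>)
  define W' where "W' d = W d + ((\<epsilon> * (e \<bullet> d)) *\<^sub>R e' + (N * (e \<bullet> d)) *\<^sub>R f)" for d
  have W'v: "W' d \<bullet> c = h (d, c) + N * r (d, c)" for d c
    by (simp add: W'_def h_def r_def inner_add_left)
  have linW': "linear W'"
  proof -
    have "linear (\<lambda>d. ((\<epsilon> *\<^sub>R e) \<bullet> d) *\<^sub>R e' + ((N *\<^sub>R e) \<bullet> d) *\<^sub>R f)"
      by (rule linear_compose_add; rule linear_rank_one)
    from linear_compose_add[OF PW(2) this] show ?thesis by (simp add: W'_def[abs_def])
  qed
  moreover have "0 \<le> W' d \<bullet> c" if d: "d \<in> D" and c: "c \<in> C" for d c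
  proof (cases "d = 0 \<or> c = 0")
    case True
    then show ?thesis using linear_0[OF linW'] by auto
  next
    case False
    have "((1 / norm d) *\<^sub>R d, (1 / norm c) *\<^sub>R c) \<in> S"
      using d c False by (simp add: S_def pointed_cone_scale[OF D] pointed_cone_scale[OF C])
    from S[OF this] have "0 \<le> W' ((1 / norm d) *\<^sub>R d) \<bullet> ((1 / norm c) *\<^sub>R c)" unfolding W'v .
    then have "0 \<le> (W' d \<bullet> c) / (norm d * norm c)" by (simp add: linear_scale[OF linW'] field_simps)
    moreover have "0 < norm d * norm c" using False by simp
    ultimately show ?thesis by (simp only: zero_le_divide_iff) linarith
  qed
  moreover have "(\<Sum>b\<in>Basis. W' b \<bullet> P b) < 0"
  proof -
    have "(\<Sum>b\<in>Basis. W' b \<bullet> P b)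
        = T + (\<Sum>b\<in>Basis. (((\<epsilon> *\<^sub>R e) \<bullet> b) *\<^sub>R e') \<bullet> P b) + (\<Sum>b\<in>Basis. (((N *\<^sub>R e) \<bullet> b) *\<^sub>R f) \<bullet> P b)"
      unfolding T_def sum.distrib[symmetric] by (rule sum.cong) (simp_all add: W'_def inner_add_left)
    also have "\<dots> = T + \<epsilon> * (e' \<bullet> P e) + N * (f \<bullet> P e)"
      unfolding sum_Basis_rank_one[OF PW(1)] by (simp add: linear_scale[OF PW(1)])
    finally show ?thesis using Teps fPe by simp
  qed
  moreover have "P k \<in> C" if "\<forall>d\<in>D. 0 \<le> k \<bullet> d" for k using PW(3)[OF that] by (simp add: exposed_by_def)
  ultimately show ?thesis unfolding entangled_def using PW(1) by blast
qed

lemma span_projection: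
  fixes C :: "'a::euclidean_space set"
  obtains p where "linear p" "\<And>v. p v \<in> span C" "\<And>v u. u \<in> span C \<Longrightarrow> p v \<bullet> u = v \<bullet> u" "\<And>v w. p v \<bullet> w = v \<bullet> p w"
    "\<And>u. u \<in> span C \<Longrightarrow> p u = u"
proof -
  obtain p where p: "\<And>v. p v \<in> span C" "\<And>v u. u \<in> span C \<Longrightarrow> p v \<bullet> u = v \<bullet> u"
    using span_representative[of C] by metis
  have eq: "a = b" if "a \<in> span C" "b \<in> span C" "\<And>u. u \<in> span C \<Longrightarrow> a \<bullet> u = b \<bullet> u" for a b
  proof -
    have "(a - b) \<bullet> (a - b) = 0" using that span_diff[OF that(1,2)] by (simp add: inner_diff_left)
    then show ?thesis by simp
  qed
  have "linear p"
    by (rule linearI; rule eq) (simp_all add: p span_add span_scale inner_add_left)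
  moreover have "p v \<bullet> w = v \<bullet> p w" for v w
    using p(2)[OF p(1)[of w], of v] p(2)[OF p(1)[of v], of w] by (simp add: inner_commute)
  moreover have "p u = u" if "u \<in> span C" for u using that p by (intro eq) auto
  ultimately show ?thesis using that p by blast
qed

lemma trace_self_adjoint:
  fixes A B :: "'a::euclidean_space \<Rightarrow> 'b::euclidean_space"
  assumes "linear A" "linear B" and p: "\<And>v w. p v \<bullet> w = v \<bullet> p w"
  shows "(\<Sum>b\<in>Basis. A b \<bullet> B (p b)) = (\<Sum>b\<in>Basis. A (p b) \<bullet> B b)"
proof -
  have exp: "H v = (\<Sum>c\<in>Basis. (v \<bullet> c) *\<^sub>R H c)" if "linear H" for H :: "'a \<Rightarrow> 'b" and v
  proof -
    have "H v = H (\<Sum>c\<in>Basis. (v \<bullet> c) *\<^sub>R c)" by (simp add: euclidean_representation)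
    then show ?thesis by (simp add: linear_sum[OF that] linear_scale[OF that])
  qed
  have "(\<Sum>b\<in>Basis. A b \<bullet> B (p b)) = (\<Sum>b\<in>Basis. \<Sum>c\<in>Basis. (p b \<bullet> c) * (A b \<bullet> B c))"
    by (subst exp[OF assms(2), of "p _"]) (simp add: inner_sum_right)
  also have "\<dots> = (\<Sum>c\<in>Basis. \<Sum>b\<in>Basis. (p b \<bullet> c) * (A b \<bullet> B c))" by (rule sum.swap)
  also have "\<dots> = (\<Sum>c\<in>Basis. \<Sum>b\<in>Basis. (p c \<bullet> b) * (A b \<bullet> B c))"
  proof (intro sum.cong refl)
    fix b c
    show "(p b \<bullet> c) * (A b \<bullet> B c) = (p c \<bullet> b) * (A b \<bullet> B c)"
      using p[of b c] inner_commute[of b "p c"] by simp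
  qed
  also have "\<dots> = (\<Sum>c\<in>Basis. A (p c) \<bullet> B c)"
    by (subst exp[OF assms(1), of "p _"]) (simp add: inner_sum_left)
  finally show ?thesis .
qed

text \<open>The two maps exchange roles: the witness for the duals becomes a positive map by the
  bipolar theorem, and the positive map becomes the witness. The projections account for the dual
  cones seeing only the spans of \<open>C\<close> and \<open>D\<close>.\<close>

lemma entangled_dual:
  assumes D: "pointed_cone D" and C: "pointed_cone C" and ent: "entangled (span_dual D) (span_dual C)"
  shows "entangled D C"
proof -
  obtain P' W' where PW': "linear P'" "linear W'" "\<forall>h. (\<forall>d\<in>span_dual D. 0 \<le> h \<bullet> d) \<longrightarrow> P' h \<in> span_dual C"
    "\<forall>d\<in>span_dual D. \<forall>c\<in>span_dual C. 0 \<le> W' d \<bullet> c" "(\<Sum>b\<in>Basis. W' b \<bullet> P' b) < 0"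
    using ent unfolding entangled_def by (elim exE conjE)
  note PW = PW'(1,2) PW'(3)[THEN spec, THEN mp] PW'(4)[THEN bspec, THEN bspec] PW'(5)
  obtain pD where pD: "linear pD" "\<And>v. pD v \<in> span D" "\<And>v u. u \<in> span D \<Longrightarrow> pD v \<bullet> u = v \<bullet> u"
    "\<And>v w. pD v \<bullet> w = v \<bullet> pD w" "\<And>u. u \<in> span D \<Longrightarrow> pD u = u"
    using span_projection[of D] by metis
  obtain pC where pC: "linear pC" "\<And>v. pC v \<in> span C" "\<And>v u. u \<in> span C \<Longrightarrow> pC v \<bullet> u = v \<bullet> u"
    "\<And>v w. pC v \<bullet> w = v \<bullet> pC w" "\<And>u. u \<in> span C \<Longrightarrow> pC u = u"
    using span_projection[of C] by metis
  obtain q where "q \<in> span_dual (span_dual D)" and q: "\<And>d. d \<in> span_dual D \<Longrightarrow> d \<noteq> 0 \<Longrightarrow> 0 < q \<bullet> d"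
    using strictly_positive_functional[OF pointed_cone_span_dual[of D]] by blast
  obtain m where m: "m > 0" "\<And>d. d \<in> span_dual D \<Longrightarrow> m * norm d \<le> q \<bullet> d"
    using positive_functional_norm_bound[OF pointed_cone_span_dual q] by blast
  \<comment> \<open>Every \<open>w\<close> is a difference of two vectors that are nonnegative on
    \<open>span_dual D\<close>, and \<open>P'\<close> sends both into \<open>span C\<close>.\<close>
  have range: "P' w \<in> span C" for w
  proof -
    define N where "N = norm w / m"
    have N: "0 \<le> N" using m(1) by (simp add: N_def)
    have "0 \<le> (w + N *\<^sub>R q) \<bullet> d \<and> 0 \<le> (N *\<^sub>R q) \<bullet> d" if d: "d \<in> span_dual D" for d
    proof -
      have "norm w * norm d = N * (m * norm d)" using m(1) by (simp add: N_def)
      also have "\<dots> \<le> N * (q \<bullet> d)" using m(2)[OF d] N by (rule mult_left_mono)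
      finally have "norm w * norm d \<le> N * (q \<bullet> d)" .
      moreover have "\<bar>w \<bullet> d\<bar> \<le> norm w * norm d" by (rule Cauchy_Schwarz_ineq2)
      moreover have "0 \<le> norm w * norm d" by simp
      ultimately have "0 \<le> w \<bullet> d + N * (q \<bullet> d) \<and> 0 \<le> N * (q \<bullet> d)" by linarith
      then show ?thesis by (simp add: inner_add_left)
    qed
    then have "P' (w + N *\<^sub>R q) \<in> span_dual C" "P' (N *\<^sub>R q) \<in> span_dual C"
      by (intro PW(3) ballI; simp)+
    then have "P' (w + N *\<^sub>R q) \<in> span C" "P' (N *\<^sub>R q) \<in> span C"
      by (auto dest: span_dualD(2))
    then show ?thesis using span_diff[of "P' (w + N *\<^sub>R q)" C "P' (N *\<^sub>R q)"] by (simp add: linear_add[OF PW(1)])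
  qed
  \<comment> \<open>A vector orthogonal to \<open>span D\<close> and its negative are both
    nonnegative on \<open>span_dual D\<close>, so pointedness makes \<open>P'\<close> vanish on
    it.\<close>
  have Pp: "P' (pD b) = P' b" for b
  proof -
    have z: "(b - pD b) \<bullet> d = 0" if "d \<in> span_dual D" for d
      using pD(3)[OF span_dualD(2)[OF that]] by (simp add: inner_diff_left)
    have "P' (b - pD b) \<in> span_dual C" by (rule PW(3)) (simp add: z)
    moreover have "P' (- (b - pD b)) \<in> span_dual C" by (rule PW(3)) (simp add: z inner_minus_left del: minus_diff_eq)
    ultimately have "P' (b - pD b) = 0"
      using pointed_cone_antisym[OF pointed_cone_span_dual] by (metis linear_neg[OF PW(1)])
    then show ?thesis by (simp add: linear_diff[OF PW(1)])
  qed
  define P where "P v = pC (W' (pD v))" for v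
  have "linear P"
    using linear_compose[OF linear_compose[OF pD(1) PW(2)] pC(1)] by (simp add: P_def[abs_def] o_def)
  moreover have "P f \<in> C" if f: "\<forall>d\<in>D. 0 \<le> f \<bullet> d" for f
  proof (rule span_dual_bipolar[OF C])
    show "P f \<in> span C" unfolding P_def by (rule pC(2))
    have "pD f \<in> span_dual D" using f pD(2,3) by (simp add: span_dual_def span_base)
    then show "0 \<le> g \<bullet> P f" if "g \<in> span_dual C" for g
      using PW(4)[of "pD f" g] that pC(3)[OF span_dualD(2)[OF that]] by (simp add: P_def inner_commute)
  qed
  moreover have "0 \<le> P' d \<bullet> c" if "d \<in> D" "c \<in> C" for d c
    using span_dualD(1)[OF PW(3)[of d] that(2)] span_dualD(1)[OF _ that(1)] by (simp add: inner_commute)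
  moreover have "(\<Sum>b\<in>Basis. P' b \<bullet> P b) < 0"
  proof -
    have "P' b \<bullet> P b = P' b \<bullet> W' (pD b)" for b
      unfolding P_def using pC(3)[OF range, of "W' (pD b)" b] by (simp add: inner_commute)
    then have "(\<Sum>b\<in>Basis. P' b \<bullet> P b) = (\<Sum>b\<in>Basis. P' b \<bullet> W' (pD b))" by simp
    also have "\<dots> = (\<Sum>b\<in>Basis. P' (pD b) \<bullet> W' b)" by (rule trace_self_adjoint[OF PW(1,2) pD(4)])
    also have "\<dots> = (\<Sum>b\<in>Basis. W' b \<bullet> P' b)" by (simp add: Pp inner_commute)
    finally show ?thesis using PW(5) by simp
  qed
  ultimately show ?thesis unfolding entangled_def using PW(1) by blast
qed

text \<open>The vectors dual to the generators of \<open>span_dual C\<close> lie in \<open>C\<close>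
  by the bipolar theorem, and they generate it.\<close>

lemma simplicial_cone_span_dual:
  assumes C: "pointed_cone C" and s: "simplicial_cone (span_dual C)"
  shows "simplicial_cone C"
proof -
  obtain B where B: "finite B" "independent B" "span_dual C = convex_cone hull B"
    using s unfolding simplicial_cone_def by blast
  have BC: "g \<in> span_dual C" if "g \<in> B" for g using hull_inc[OF that, of convex_cone] B(3) by simp
  have bip: "v \<in> C" if v: "v \<in> span C" "\<And>g. g \<in> B \<Longrightarrow> 0 \<le> g \<bullet> v" for v
  proof (rule span_dual_bipolar[OF C v(1)])
    fix f assume "f \<in> span_dual C"
    then obtain c where c: "\<forall>g\<in>B. 0 \<le> c g" "f = (\<Sum>g\<in>B. c g *\<^sub>R g)"
      unfolding B(3) convex_cone_hull_finite[OF B(1)] by blast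
    have "0 \<le> (\<Sum>g\<in>B. c g * (g \<bullet> v))" by (rule sum_nonneg) (use c(1) v(2) in simp)
    then show "0 \<le> f \<bullet> v" by (simp add: c(2) inner_sum_left)
  qed
  have "\<exists>w\<in>span C. 0 < g \<bullet> w \<and> (\<forall>a\<in>B. a \<noteq> g \<longrightarrow> a \<bullet> w = 0)" if g: "g \<in> B" for g
  proof -
    obtain w where w: "w \<in> span B" "0 < w \<bullet> g" "\<forall>a\<in>B. a \<noteq> g \<longrightarrow> w \<bullet> a = 0"
      by (rule dual_vector[OF B(2) g]) blast
    have "B \<subseteq> span C" using BC span_dualD(2) by blast
    then have "w \<in> span C" using w(1) span_minimal[of B "span C"] by auto
    then show ?thesis using w by (auto simp: inner_commute)
  qed
  then obtain w where w: "\<And>g. g \<in> B \<Longrightarrow> w g \<in> span C" "\<And>g. g \<in> B \<Longrightarrow> 0 < g \<bullet> w g"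
    "\<And>g a. g \<in> B \<Longrightarrow> a \<in> B \<Longrightarrow> a \<noteq> g \<Longrightarrow> a \<bullet> w g = 0" by metis
  have wC: "w g \<in> C" if g: "g \<in> B" for g
  proof (rule bip[OF w(1)[OF g]])
    fix a assume "a \<in> B"
    then show "0 \<le> a \<bullet> w g" using w(2,3)[OF g] by (cases "a = g") auto
  qed
  have eval: "g \<bullet> (\<Sum>a\<in>B. c a *\<^sub>R w a) = c g * (g \<bullet> w g)" if g: "g \<in> B" for g c
  proof -
    have "g \<bullet> (\<Sum>a\<in>B. c a *\<^sub>R w a) = (\<Sum>a\<in>B. if a = g then c g * (g \<bullet> w g) else 0)"
      unfolding inner_sum_right
    proof (rule sum.cong)
      fix a assume "a \<in> B"
      then show "g \<bullet> (c a *\<^sub>R w a) = (if a = g then c g * (g \<bullet> w g) else 0)" using w(3)[OF _ g, of a] by simp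
    qed simp
    then show ?thesis using B(1) g by simp
  qed
  have inj: "inj_on w B"
  proof (rule inj_onI, rule ccontr)
    fix a b assume ab: "a \<in> B" "b \<in> B" "w a = w b" "a \<noteq> b"
    then have "a \<bullet> w b = 0" using w(3)[of b a] by blast
    then show False using w(2)[OF ab(1)] ab(3) by simp
  qed
  show ?thesis
    unfolding simplicial_cone_def
  proof (intro exI conjI)
    show fin: "finite (w ` B)" using B(1) by simp
    show "independent (w ` B)"
    proof (rule independent_if_scalars_zero[OF fin])
      fix c x assume s: "(\<Sum>x\<in>w ` B. c x *\<^sub>R x) = 0" and x: "x \<in> w ` B"
      obtain g where g: "g \<in> B" "x = w g" using x by blast
      have "(\<Sum>a\<in>B. c (w a) *\<^sub>R w a) = 0" using s by (simp add: sum.reindex[OF inj])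
      then have "c (w g) * (g \<bullet> w g) = 0" using eval[OF g(1), of "\<lambda>a. c (w a)"] by simp
      then show "c x = 0" using w(2)[OF g(1)] g(2) by simp
    qed
    show "C = convex_cone hull (w ` B)"
    proof
      show "convex_cone hull (w ` B) \<subseteq> C" by (rule hull_minimal) (use wC C in \<open>auto simp: pointed_coneD\<close>)
      show "C \<subseteq> convex_cone hull (w ` B)"
      proof
        fix v assume v: "v \<in> C"
        define u where "u = (\<Sum>g\<in>B. ((g \<bullet> v) / (g \<bullet> w g)) *\<^sub>R w g)"
        have u: "u \<in> convex_cone hull (w ` B)" unfolding u_def
          by (intro sum_in_cone convex_cone_convex_cone_hull convex_cone_hull_mul hull_inc imageI
              divide_nonneg_pos w span_dualD(1)[OF BC v])
        have us: "u \<in> span C" unfolding u_def by (intro span_sum span_scale w)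
        have d: "v - u \<in> span C" by (rule span_diff[OF span_base[OF v] us])
        have z: "g \<bullet> (v - u) = 0" if "g \<in> B" for g
          unfolding u_def using eval[OF that] w(2)[OF that] by (simp add: inner_diff_right)
        have "v - u \<in> C" by (rule bip[OF d]) (simp add: z)
        moreover have "- (v - u) \<in> C" by (rule bip[OF span_neg[OF d]]) (simp only: inner_minus_right z)
        ultimately have "v - u = 0" by (rule pointed_cone_antisym[OF C])
        then show "v \<in> convex_cone hull (w ` B)" using u by simp
      qed
    qed
  qed
qed

section \<open>Induction on the dimension\<close>

lemma dim_exposed_by_less:
  assumes "c \<in> C" "f \<bullet> c \<noteq> 0"
  shows "dim (exposed_by C f) < dim C"
proof (rule dim_psubset)
  have "span (exposed_by C f) \<subseteq> span C" by (rule span_mono) (auto simp: exposed_by_def)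
  moreover have "span (exposed_by C f) \<subseteq> {v. f \<bullet> v = 0}"
    by (rule span_minimal) (auto simp: exposed_by_def subspace_hyperplane)
  ultimately show "span (exposed_by C f) \<subset> span C" using assms span_base[OF assms(1)] by blast
qed

lemma dim_span_dual_le: "dim (span_dual C) \<le> dim C"
  by (rule dim_subset[of "span_dual C" "span C", simplified]) (auto dest: span_dualD(2))

lemma entangled_left_face:
  assumes "pointed_cone D" "pointed_cone C" "\<And>d. d \<in> D \<Longrightarrow> 0 \<le> f \<bullet> d" "entangled (exposed_by D f) C"
  shows "entangled D C"
  by (rule entangled_commute[OF assms(2)], rule entangled_face[OF assms(2,1,3)], assumption,
      rule entangled_commute[OF exposed_by_pointed_cone[OF assms(1)] assms(4)])

theorem nonsimplicial_cones_entangled: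
  fixes D :: "'a::euclidean_space set" and C :: "'b::euclidean_space set"
  assumes "pointed_cone D" "\<not> simplicial_cone D" "pointed_cone C" "\<not> simplicial_cone C"
  shows "entangled D C"
  using assms
proof (induction "dim D + dim C" arbitrary: D C rule: less_induct)
  case less
  note D = less.prems(1,2) and C = less.prems(3,4)
  have D': "pointed_cone (span_dual D)" "\<not> simplicial_cone (span_dual D)"
    and C': "pointed_cone (span_dual C)" "\<not> simplicial_cone (span_dual C)"
    using simplicial_cone_span_dual D C pointed_cone_span_dual by blast+
  have nz: "\<exists>c\<in>C. f \<bullet> c \<noteq> 0" if "f \<in> span_dual C" "f \<noteq> 0" for f and C :: "'c::euclidean_space set"
    using inner_zero_on_span[OF span_dualD(2)[OF that(1)]] that(2) by blast
  have nz': "\<exists>f\<in>span_dual C. x \<bullet> f \<noteq> 0" if C: "pointed_cone C" and "x \<in> C" "x \<noteq> 0" for x and C :: "'c::euclidean_space set"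
  proof -
    obtain q where "q \<in> span_dual C" "\<And>v. v \<in> C \<Longrightarrow> v \<noteq> 0 \<Longrightarrow> 0 < q \<bullet> v"
      using strictly_positive_functional[OF C] by blast
    then show ?thesis using that by (intro bexI[of _ q]) (force simp: inner_commute)+
  qed
  \<comment> \<open>A nonsimplicial exposed face of either cone or either dual has smaller dimension
    and is treated by induction; without one, both cones have kites. For a face of a dual, both
    cones are dualised at once, which does not increase their dimensions.\<close>
  consider f where "f \<in> span_dual C" "f \<noteq> 0" "\<not> simplicial_cone (exposed_by C f)"
    | x where "x \<in> C" "x \<noteq> 0" "\<not> simplicial_cone (exposed_by (span_dual C) x)"
    | f where "f \<in> span_dual D" "f \<noteq> 0" "\<not> simplicial_cone (exposed_by D f)"
    | x where "x \<in> D" "x \<noteq> 0" "\<not> simplicial_cone (exposed_by (span_dual D) x)"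
    | "kite_sandwich C" "kite_sandwich D"
    using kite_sandwich_exists[OF C] kite_sandwich_exists[OF D] by blast
  then show ?case
  proof cases
    case 1
    obtain c where c: "c \<in> C" "f \<bullet> c \<noteq> 0" using nz[OF 1(1,2)] by blast
    have "entangled D (exposed_by C f)"
      using dim_exposed_by_less[OF c] exposed_by_pointed_cone[OF C(1)] 1(3) D by (intro less.hyps) auto
    with entangled_face[OF D(1) C(1), of f] span_dualD(1)[OF 1(1)] show ?thesis by blast
  next
    case 2
    obtain f where f: "f \<in> span_dual C" "x \<bullet> f \<noteq> 0" using nz'[OF C(1) 2(1,2)] by blast
    have "dim (span_dual D) + dim (exposed_by (span_dual C) x) < dim D + dim C"
      using dim_exposed_by_less[OF f] dim_span_dual_le[of C] dim_span_dual_le[of D] by linarith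
    then have "entangled (span_dual D) (exposed_by (span_dual C) x)"
      by (rule less.hyps[OF _ D' exposed_by_pointed_cone[OF C'(1)] 2(3)])
    from entangled_face[OF D'(1) C'(1) _ this] have "entangled (span_dual D) (span_dual C)"
      using span_dualD(1)[OF _ 2(1)] by (simp add: inner_commute[of x])
    then show ?thesis by (rule entangled_dual[OF D(1) C(1)])
  next
    case 3
    obtain d where d: "d \<in> D" "f \<bullet> d \<noteq> 0" using nz[OF 3(1,2)] by blast
    have "entangled (exposed_by D f) C"
      using dim_exposed_by_less[OF d] exposed_by_pointed_cone[OF D(1)] 3(3) C by (intro less.hyps) auto
    with entangled_left_face[OF D(1) C(1), of f] span_dualD(1)[OF 3(1)] show ?thesis by blast
  next
    case 4
    obtain f where f: "f \<in> span_dual D" "x \<bullet> f \<noteq> 0" using nz'[OF D(1) 4(1,2)] by blast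
    have "dim (exposed_by (span_dual D) x) + dim (span_dual C) < dim D + dim C"
      using dim_exposed_by_less[OF f] dim_span_dual_le[of C] dim_span_dual_le[of D] by linarith
    then have "entangled (exposed_by (span_dual D) x) (span_dual C)"
      by (rule less.hyps[OF _ exposed_by_pointed_cone[OF D'(1)] 4(3) C'])
    from entangled_left_face[OF D'(1) C'(1) _ this] have "entangled (span_dual D) (span_dual C)"
      using span_dualD(1)[OF _ 4(1)] by (simp add: inner_commute[of x])
    then show ?thesis by (rule entangled_dual[OF D(1) C(1)])
  next
    case 5
    then show ?thesis by (intro entangled_if_kite_sandwiches D C)
  qed
qed

section \<open>The threshold for entanglement breaking\<close>

lemma proper_cone_pointed: "proper_cone C \<Longrightarrow> pointed_cone C"
  by (simp add: proper_cone_def pointed_cone_def)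

lemma proper_cone_span: "proper_cone C \<Longrightarrow> span C = UNIV"
proof -
  assume "proper_cone C"
  then have *: "{x - y | x y. x \<in> C \<and> y \<in> C} = UNIV" by (simp add: proper_cone_def)
  have "v \<in> span C" for v
  proof -
    have "v \<in> {x - y | x y. x \<in> C \<and> y \<in> C}" using * by simp
    then show ?thesis by (auto intro: span_diff span_base)
  qed
  then show ?thesis by auto
qed

lemma simplicial_cone_imp_classical:
  assumes "simplicial_cone C" and span: "span C = UNIV"
  shows "classical_cone C"
proof -
  obtain B where B: "finite B" "independent B" and C: "C = convex_cone hull B"
    using assms(1) unfolding simplicial_cone_def by blast
  note mem = convex_cone_hull_finite[OF B(1), folded C]
  have "C \<subseteq> span B"
    unfolding C by (rule hull_minimal) (auto simp: span_superset subspace_imp_convex_cone)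
  then have spB: "span B = UNIV" using span_minimal[of C "span B"] span by auto
  define n where "n = card B"
  obtain h where h: "bij_betw h {..<n} B"
    using ex_bij_betw_nat_finite[OF B(1)] by (auto simp: n_def atLeast0LessThan)
  define f where "f i v = representation B v (h i)" for i v
  define G where "G c = (\<Sum>i<n. c i *\<^sub>R h i)" for c
  have linf: "linear (f i)" for i
    by (rule linearI) (simp_all add: f_def representation_add[OF B(2)] representation_scale[OF B(2)] spB)
  have fG: "f j (G c) = c j" if j: "j < n" for j c
  proof -
    have "f j (h i) = (if i = j then 1 else 0)" if i: "i < n" for i
      using representation_basis[OF B(2), of "h i"] bij_betwE[OF h] bij_betw_imp_inj_on[OF h] i j
      by (auto simp: f_def inj_on_def)
    then have "f j (G c) = (\<Sum>i<n. c i * (if i = j then 1 else 0))"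
      by (simp add: G_def linear_sum[OF linf] linear_scale[OF linf])
    then show ?thesis using j by (simp add: if_distrib cong: if_cong)
  qed
  have Gf: "G (\<lambda>i\<in>{..<n}. f i v) = v" for v
  proof -
    have "G (\<lambda>i\<in>{..<n}. f i v) = (\<Sum>i<n. representation B v (h i) *\<^sub>R h i)"
      by (simp add: G_def f_def)
    also have "\<dots> = (\<Sum>b\<in>B. representation B v b *\<^sub>R b)" by (rule sum.reindex_bij_betw[OF h])
    also have "\<dots> = v" using sum_representation_eq[OF B(2) _ B(1) order.refl] spB by simp
    finally show ?thesis .
  qed
  have F: "(\<lambda>i\<in>{..<n}. f i (G c)) = c" if "c \<in> {..<n} \<rightarrow>\<^sub>E X" for c X
    using that by (auto simp: fun_eq_iff restrict_def fG PiE_def extensional_def)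
  have GC: "G c \<in> C" if "c \<in> {..<n} \<rightarrow>\<^sub>E {0..}" for c
  proof -
    have "h i \<in> C" if "i < n" for i using bij_betwE[OF h] that by (auto simp: C hull_inc)
    moreover have "0 \<le> c i" if "i < n" for i using PiE_mem[OF \<open>c \<in> _\<close>, of i] that by simp
    ultimately show ?thesis unfolding G_def C
      by (intro sum_in_cone convex_cone_convex_cone_hull convex_cone_hull_mul) auto
  qed
  have "f i v \<ge> 0" if v: "v \<in> C" and i: "i < n" for i v
  proof -
    obtain c where c: "\<forall>b\<in>B. 0 \<le> c b" "v = (\<Sum>b\<in>B. c b *\<^sub>R b)" using v mem by blast
    have "v = G (\<lambda>i. c (h i))" unfolding c(2) G_def by (rule sum.reindex_bij_betw[OF h, symmetric])
    then show ?thesis using fG[OF i] c(1) bij_betwE[OF h] i by simp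
  qed
  then have fC: "(\<lambda>i\<in>{..<n}. f i v) \<in> {..<n} \<rightarrow>\<^sub>E {0..}" if "v \<in> C" for v using that by auto
  have "bij_betw (\<lambda>x. \<lambda>i\<in>{..<n}. f i x) UNIV ({..<n} \<rightarrow>\<^sub>E UNIV)"
  proof (rule bij_betw_byWitness[where f' = G])
    show "(\<lambda>x. \<lambda>i\<in>{..<n}. f i x) ` UNIV \<subseteq> {..<n} \<rightarrow>\<^sub>E UNIV" by (simp add: image_subset_iff)
  qed (use Gf F in auto)
  moreover have "(\<lambda>x. \<lambda>i\<in>{..<n}. f i x) ` C = ({..<n} \<rightarrow>\<^sub>E {0..})"
  proof
    show "(\<lambda>x. \<lambda>i\<in>{..<n}. f i x) ` C \<subseteq> {..<n} \<rightarrow>\<^sub>E {0..}" using fC by blast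
    show "{..<n} \<rightarrow>\<^sub>E {0..} \<subseteq> (\<lambda>x. \<lambda>i\<in>{..<n}. f i x) ` C"
    proof
      fix c :: "nat \<Rightarrow> real" assume c: "c \<in> {..<n} \<rightarrow>\<^sub>E {0..}"
      show "c \<in> (\<lambda>x. \<lambda>i\<in>{..<n}. f i x) ` C" using GC[OF c] F[OF c] by (metis imageI)
    qed
  qed
  ultimately show ?thesis unfolding classical_cone_def using linf by blast
qed

lemma entanglement_breakingI:
  fixes C1 :: "'a::euclidean_space set" and C2 :: "'b::euclidean_space set"
  assumes "finite I" "\<And>i. i \<in> I \<Longrightarrow> x i \<in> C2" "\<And>i. i \<in> I \<Longrightarrow> d i \<in> span_dual C1"
  shows "entanglement_breaking C1 C2 (\<lambda>v. \<Sum>i\<in>I. (d i \<bullet> v) *\<^sub>R x i)"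
proof -
  obtain h where h: "bij_betw h {..<card I} I"
    using ex_bij_betw_nat_finite[OF assms(1)] by (auto simp: atLeast0LessThan)
  have "(\<lambda>v. \<Sum>i\<in>I. (d i \<bullet> v) *\<^sub>R x i)
      = (\<lambda>v. \<Sum>j<card I. blinfun_apply (blinfun_inner_right (d (h j))) v *\<^sub>R x (h j))"
    by (rule ext) (simp add: sum.reindex_bij_betw[OF h, of "\<lambda>i. (d i \<bullet> _) *\<^sub>R x i"])
  moreover have "x (h j) \<in> C2 \<and> blinfun_inner_right (d (h j)) \<in> dual_cone C1" if "j < card I" for j
  proof -
    have "h j \<in> I" using bij_betwE[OF h] that by simp
    then show ?thesis using assms(2) span_dualD(1)[OF assms(3)] by (simp add: dual_cone_def)
  qed
  ultimately show ?thesis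
    unfolding entanglement_breaking_def
    by (intro exI[of _ "card I"] exI[of _ "\<lambda>j. x (h j)"] exI[of _ "\<lambda>j. blinfun_inner_right (d (h j))"]) simp
qed

lemma entanglement_breakingE:
  fixes C1 :: "'a::euclidean_space set" and C2 :: "'b::euclidean_space set"
  assumes "entanglement_breaking C1 C2 P" and span: "span C1 = UNIV"
  obtains n x d where "\<forall>i<n. x i \<in> C2 \<and> d i \<in> span_dual C1" "P = (\<lambda>v. \<Sum>i<(n::nat). (d i \<bullet> v) *\<^sub>R x i)"
proof -
  obtain n :: nat and x \<phi> where *: "\<forall>i<n. x i \<in> C2 \<and> \<phi> i \<in> dual_cone C1"
    "P = (\<lambda>v. \<Sum>i<n. blinfun_apply (\<phi> i) v *\<^sub>R x i)"
    using assms(1) unfolding entanglement_breaking_def by blast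
  define d where "d i = (\<Sum>b\<in>Basis. blinfun_apply (\<phi> i) b *\<^sub>R b)" for i
  have d: "d i \<bullet> v = blinfun_apply (\<phi> i) v" for i v
  proof -
    have "blinfun_apply (\<phi> i) v = blinfun_apply (\<phi> i) (\<Sum>b\<in>Basis. (v \<bullet> b) *\<^sub>R b)"
      by (simp add: euclidean_representation)
    also have "\<dots> = (\<Sum>b\<in>Basis. (v \<bullet> b) * blinfun_apply (\<phi> i) b)"
      by (simp only: blinfun.sum_right blinfun.scaleR_right real_scaleR_def)
    finally show ?thesis unfolding d_def inner_sum_left by (simp add: inner_commute[of v] mult.commute)
  qed
  have "\<forall>i<n. x i \<in> C2 \<and> d i \<in> span_dual C1"
    using *(1) by (simp add: span_dual_def span d dual_cone_def)
  moreover have "P = (\<lambda>v. \<Sum>i<n. (d i \<bullet> v) *\<^sub>R x i)" by (simp add: *(2) d)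
  ultimately show ?thesis by (rule that)
qed

lemma entanglement_breaking_add:
  fixes C1 :: "'a::euclidean_space set" and C2 :: "'b::euclidean_space set"
  assumes span: "span C1 = UNIV" and P: "entanglement_breaking C1 C2 P" and Q: "entanglement_breaking C1 C2 Q"
  shows "entanglement_breaking C1 C2 (\<lambda>v. P v + Q v)"
proof -
  obtain n x d where P': "\<forall>i<n. x i \<in> C2 \<and> d i \<in> span_dual C1" "P = (\<lambda>v. \<Sum>i<(n::nat). (d i \<bullet> v) *\<^sub>R x i)"
    by (rule entanglement_breakingE[OF P span])
  obtain m y g where Q': "\<forall>i<m. y i \<in> C2 \<and> g i \<in> span_dual C1" "Q = (\<lambda>v. \<Sum>i<(m::nat). (g i \<bullet> v) *\<^sub>R y i)"
    by (rule entanglement_breakingE[OF Q span])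
  have "entanglement_breaking C1 C2 (\<lambda>v. \<Sum>i\<in>{..<n} <+> {..<m}. (case_sum d g i \<bullet> v) *\<^sub>R case_sum x y i)"
    by (rule entanglement_breakingI) (use P'(1) Q'(1) in auto)
  then show ?thesis by (simp add: sum.Plus o_def P'(2) Q'(2))
qed

lemma entanglement_breaking_rank_one:
  fixes C1 :: "'a::euclidean_space set" and C2 :: "'b::euclidean_space set"
  assumes "x \<in> C2" "d \<in> span_dual C1"
  shows "entanglement_breaking C1 C2 (\<lambda>v. (d \<bullet> v) *\<^sub>R x)"
  using entanglement_breakingI[of "{()}" "\<lambda>_. x" C2 "\<lambda>_. d" C1] assms by simp

text \<open>The trace form is linear in \<open>P\<close> and takes the value
  \<open>W d \<bullet> x\<close> on the rank-one map given by \<open>d\<close> and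
  \<open>x\<close>.\<close>

lemma entanglement_breaking_trace_nonneg:
  fixes C1 :: "'a::euclidean_space set" and C2 :: "'b::euclidean_space set"
  assumes span: "span C1 = UNIV" and P: "entanglement_breaking C1 C2 P"
    and W: "linear W" "\<forall>d\<in>span_dual C1. \<forall>c\<in>C2. 0 \<le> W d \<bullet> c"
  shows "0 \<le> (\<Sum>b\<in>Basis. W b \<bullet> P b)"
proof -
  obtain n x d where P': "\<forall>i<n. x i \<in> C2 \<and> d i \<in> span_dual C1" "P = (\<lambda>v. \<Sum>i<(n::nat). (d i \<bullet> v) *\<^sub>R x i)"
    by (rule entanglement_breakingE[OF P span])
  have W': "W z = (\<Sum>b\<in>Basis. (z \<bullet> b) *\<^sub>R W b)" for z
  proof -
    have "W z = W (\<Sum>b\<in>Basis. (z \<bullet> b) *\<^sub>R b)" by (simp add: euclidean_representation)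
    then show ?thesis by (simp add: linear_sum[OF W(1)] linear_scale[OF W(1)])
  qed
  have "(\<Sum>b\<in>Basis. W b \<bullet> P b) = (\<Sum>b\<in>Basis. \<Sum>i<n. (d i \<bullet> b) * (W b \<bullet> x i))"
    by (simp add: P'(2) inner_sum_right)
  also have "\<dots> = (\<Sum>i<n. \<Sum>b\<in>Basis. (d i \<bullet> b) * (W b \<bullet> x i))" by (rule sum.swap)
  also have "\<dots> = (\<Sum>i<n. W (d i) \<bullet> x i)" by (simp add: W' [of "d _"] inner_sum_left)
  also have "\<dots> \<ge> 0" using P'(1) W(2) by (intro sum_nonneg) auto
  finally show ?thesis .
qed

section \<open>Order units\<close>

lemma order_unit:
  assumes C: "pointed_cone C" and span: "span C = UNIV"
  obtains e m where "m > 0" "\<And>x. norm x \<le> m \<Longrightarrow> e + x \<in> C"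
proof -
  obtain q where "q \<in> span_dual (span_dual C)" and q: "\<And>d. d \<in> span_dual C \<Longrightarrow> d \<noteq> 0 \<Longrightarrow> 0 < q \<bullet> d"
    using strictly_positive_functional[OF pointed_cone_span_dual[of C]] by blast
  obtain m where m: "m > 0" "\<And>d. d \<in> span_dual C \<Longrightarrow> m * norm d \<le> q \<bullet> d"
    using positive_functional_norm_bound[OF pointed_cone_span_dual q] by blast
  \<comment> \<open>A strictly positive functional on the dual is an interior point of
    \<open>C\<close>: its values dominate the norm and hence absorb any small perturbation.\<close>
  have "q + x \<in> C" if x: "norm x \<le> m" for x
  proof (rule span_dual_bipolar[OF C])
    fix d assume d: "d \<in> span_dual C"
    have "norm d * norm x \<le> norm d * m" using x by (intro mult_left_mono) auto
    then show "0 \<le> d \<bullet> (q + x)"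
      using Cauchy_Schwarz_ineq2[of d x] m(2)[OF d] by (simp add: inner_add_right inner_commute[of d q] mult.commute)
  qed (simp add: span)
  then show ?thesis using m(1) that by blast
qed

lemma order_unit_absorbs:
  assumes C: "pointed_cone C" and m: "m > 0" "\<And>x. norm x \<le> m \<Longrightarrow> e + x \<in> C" and z: "norm z \<le> t * m"
  shows "t *\<^sub>R e + z \<in> C"
proof (cases "t = 0")
  case False
  have "0 \<le> t * m" using z norm_ge_zero[of z] by linarith
  then have t: "0 < t" using m(1) False by (simp add: zero_le_mult_iff)
  have "norm ((1 / t) *\<^sub>R z) \<le> m" using t z by (simp add: field_simps)
  from pointed_cone_scale[OF C m(2)[OF this], of t] show ?thesis using t by (simp add: scaleR_add_right)
qed (use z pointed_cone_0[OF C] in auto)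

text \<open>The map \<open>f e\<close> is an order unit for the cone of entanglement breaking maps.
  As \<open>P\<close> is a sum of rank-one maps over the basis, it suffices to shift these, and the
  shifts add up.\<close>

lemma entanglement_breaking_shift_exists:
  fixes C1 :: "'a::euclidean_space set" and C2 :: "'b::euclidean_space set"
  assumes C1: "pointed_cone C1" "span C1 = UNIV" and C2: "pointed_cone C2" and "linear P"
    and e: "m > 0" "\<And>x. norm x \<le> m \<Longrightarrow> e + x \<in> C2"
    and f: "\<mu> > 0" "\<And>y. norm y \<le> \<mu> \<Longrightarrow> f + y \<in> span_dual C1"
  shows "\<exists>s\<ge>0. entanglement_breaking C1 C2 (\<lambda>v. P v + (s * (f \<bullet> v)) *\<^sub>R e)"
proof -
  have eC: "e \<in> C2" and fC: "f \<in> span_dual C1" using e(2)[of 0] f(2)[of 0] e(1) f(1) by auto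
  \<comment> \<open>\<open>(\<beta> f + d)(\<alpha> e + x) + (\<beta> f - d)(\<alpha> e - x) = 2 (d x + \<alpha> \<beta> f e)\<close>\<close>
  have one: "\<exists>s\<ge>0. entanglement_breaking C1 C2 (\<lambda>v. (d \<bullet> v) *\<^sub>R x + (s * (f \<bullet> v)) *\<^sub>R e)" for d x
  proof -
    define \<alpha> where "\<alpha> = norm x / m"
    define \<beta> where "\<beta> = norm d / \<mu>"
    have a: "norm x \<le> \<alpha> * m" "norm (- x) \<le> \<alpha> * m" and b: "norm d \<le> \<beta> * \<mu>" "norm (- d) \<le> \<beta> * \<mu>"
      and nn: "0 \<le> \<alpha>" "0 \<le> \<beta>"
      using e(1) f(1) by (simp_all add: \<alpha>_def \<beta>_def)
    have x: "(\<alpha> *\<^sub>R e + x) \<in> C2" "(\<alpha> *\<^sub>R e + - x) \<in> C2"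
      using order_unit_absorbs[OF C2 e a(1)] order_unit_absorbs[OF C2 e a(2)] by auto
    have d: "(\<beta> *\<^sub>R f + d) \<in> span_dual C1" "(\<beta> *\<^sub>R f + - d) \<in> span_dual C1"
      using order_unit_absorbs[OF pointed_cone_span_dual f b(1)] order_unit_absorbs[OF pointed_cone_span_dual f b(2)] by auto
    have "entanglement_breaking C1 C2
        (\<lambda>v. ((\<beta> *\<^sub>R f + d) \<bullet> v) *\<^sub>R ((1/2) *\<^sub>R (\<alpha> *\<^sub>R e + x)) + ((\<beta> *\<^sub>R f + - d) \<bullet> v) *\<^sub>R ((1/2) *\<^sub>R (\<alpha> *\<^sub>R e + - x)))"
      by (intro entanglement_breaking_add C1 entanglement_breaking_rank_one pointed_cone_scale[OF C2] x d) auto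
    moreover have "((\<beta> *\<^sub>R f + d) \<bullet> v) *\<^sub>R ((1/2) *\<^sub>R (\<alpha> *\<^sub>R e + x)) + ((\<beta> *\<^sub>R f + - d) \<bullet> v) *\<^sub>R ((1/2) *\<^sub>R (\<alpha> *\<^sub>R e + - x))
        = (d \<bullet> v) *\<^sub>R x + ((\<alpha> * \<beta>) * (f \<bullet> v)) *\<^sub>R e" for v
    proof -
      define u w where "u = (1/2) *\<^sub>R (\<alpha> *\<^sub>R e + x)" and "w = (1/2) *\<^sub>R (\<alpha> *\<^sub>R e + - x)"
      have "u + w = (1/2) *\<^sub>R (\<alpha> *\<^sub>R e + \<alpha> *\<^sub>R e)" "u - w = (1/2) *\<^sub>R (x + x)"
        by (simp_all add: u_def w_def flip: scaleR_add_right scaleR_diff_right)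
      then have uw: "u + w = \<alpha> *\<^sub>R e" "u - w = x" by (simp_all only: scaleR_half_double)
      have "((\<beta> *\<^sub>R f + d) \<bullet> v) *\<^sub>R u + ((\<beta> *\<^sub>R f + - d) \<bullet> v) *\<^sub>R w = (\<beta> * (f \<bullet> v)) *\<^sub>R (u + w) + (d \<bullet> v) *\<^sub>R (u - w)"
        by (simp add: inner_add_left inner_diff_left algebra_simps)
      then show ?thesis unfolding uw unfolding u_def[symmetric] w_def[symmetric] by (simp add: mult_ac add.commute)
    qed
    ultimately show ?thesis using nn by (intro exI[of _ "\<alpha> * \<beta>"]) simp
  qed
  have "\<exists>s\<ge>0. entanglement_breaking C1 C2 (\<lambda>v. (\<Sum>b\<in>A. (b \<bullet> v) *\<^sub>R P b) + (s * (f \<bullet> v)) *\<^sub>R e)"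
    if "finite A" for A :: "'a set"
    using that
  proof (induction A)
    case empty
    show ?case using entanglement_breaking_rank_one[OF pointed_cone_0[OF C2] fC] by (intro exI[of _ 0]) simp
  next
    case (insert a A)
    obtain s where s: "s \<ge> 0" "entanglement_breaking C1 C2 (\<lambda>v. (\<Sum>b\<in>A. (b \<bullet> v) *\<^sub>R P b) + (s * (f \<bullet> v)) *\<^sub>R e)"
      using insert.IH by blast
    obtain r where r: "r \<ge> 0" "entanglement_breaking C1 C2 (\<lambda>v. (a \<bullet> v) *\<^sub>R P a + (r * (f \<bullet> v)) *\<^sub>R e)"
      using one by blast
    have "(((a \<bullet> v) *\<^sub>R P a + (r * (f \<bullet> v)) *\<^sub>R e) + ((\<Sum>b\<in>A. (b \<bullet> v) *\<^sub>R P b) + (s * (f \<bullet> v)) *\<^sub>R e))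
        = (\<Sum>b\<in>insert a A. (b \<bullet> v) *\<^sub>R P b) + ((r + s) * (f \<bullet> v)) *\<^sub>R e" for v
      using insert.hyps by (simp add: algebra_simps)
    with entanglement_breaking_add[OF C1(2) r(2) s(2)] show ?case
      using r(1) s(1) by (intro exI[of _ "r + s"]) simp
  qed
  from this[OF finite_Basis] show ?thesis
  proof (elim exE conjE, intro exI conjI)
    fix s assume "entanglement_breaking C1 C2 (\<lambda>v. (\<Sum>b\<in>Basis. (b \<bullet> v) *\<^sub>R P b) + (s * (f \<bullet> v)) *\<^sub>R e)"
    moreover have "(\<Sum>b\<in>Basis. (b \<bullet> v) *\<^sub>R P b) = P v" for v
    proof -
      have "P v = P (\<Sum>b\<in>Basis. (v \<bullet> b) *\<^sub>R b)" by (simp add: euclidean_representation)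
      then show ?thesis by (simp add: linear_sum[OF assms(4)] linear_scale[OF assms(4)] inner_commute)
    qed
    ultimately show "entanglement_breaking C1 C2 (\<lambda>v. P v + (s * (f \<bullet> v)) *\<^sub>R e)" by simp
  qed
qed

section \<open>Tensor powers of a map near the threshold\<close>

lemma convex_cone_convex_hull:
  assumes "S \<noteq> {}" "\<And>x c. x \<in> S \<Longrightarrow> 0 \<le> c \<Longrightarrow> c *\<^sub>R x \<in> S"
  shows "convex_cone (convex hull S)"
proof -
  have "cone S" using assms(2) by (simp add: cone_def)
  then have "cone (convex hull S)" by (rule cone_convex_hull)
  then show ?thesis using assms(1) by (auto simp: convex_cone_def cone_def conic_def)
qed

lemma linear_elementary_singleton: "linear (\<lambda>x. elementary [x])"
  by (simp add: linear_tensor_mult_left)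

lemma convex_cone_min_power:
  assumes C: "convex_cone C"
  shows "convex_cone (min_power C (Suc k))"
proof (induction k)
  case 0
  let ?g = "\<lambda>x. elementary [x]"
  have "0 \<in> ?g ` C"
    using linear_0[OF linear_elementary_singleton] convex_cone_contains_0[OF C] by (metis imageI)
  moreover have "?g x + ?g y \<in> ?g ` C" if "x \<in> C" "y \<in> C" for x y
    using linear_add[OF linear_elementary_singleton] convex_cone_add[OF C that] by (metis imageI)
  moreover have "c *\<^sub>R ?g x \<in> ?g ` C" if "x \<in> C" "0 \<le> c" for x c
  proof -
    have "c *\<^sub>R x \<in> C" using C that by (simp add: convex_cone_iff)
    then show ?thesis using linear_scale[OF linear_elementary_singleton] by (metis imageI)
  qed
  ultimately show ?case unfolding min_power.simps convex_cone_iff by blast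
next
  case (Suc k)
  let ?S = "{tensor_mult x t | x t. x \<in> C \<and> t \<in> min_power C (Suc k)}"
  have "tensor_mult 0 0 \<in> ?S" using C Suc by (blast intro: convex_cone_contains_0)
  moreover have "c *\<^sub>R z \<in> ?S" if "z \<in> ?S" "0 \<le> c" for z c
  proof -
    obtain x t where z: "z = tensor_mult x t" "x \<in> C" "t \<in> min_power C (Suc k)" using \<open>z \<in> ?S\<close> by blast
    have "c *\<^sub>R z = tensor_mult (c *\<^sub>R x) t" by (simp add: z(1) linear_scale[OF linear_tensor_mult_left])
    moreover have "c *\<^sub>R x \<in> C" using C z(2) that(2) by (simp add: convex_cone_iff)
    ultimately show ?thesis using z(3) by blast
  qed
  ultimately show ?case
    unfolding min_power.simps min_tensor_def by (intro convex_cone_convex_hull) blast+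
qed

lemma tensor_mult_in_min_power:
  "x \<in> C \<Longrightarrow> t \<in> min_power C (Suc k) \<Longrightarrow> tensor_mult x t \<in> min_power C (Suc (Suc k))"
  unfolding min_power.simps min_tensor_def by (rule hull_inc) blast

text \<open>The map \<open>\<phi> \<otimes> id\<close>, evaluating \<phi> on the first tensor
  factor.\<close>

definition contract :: "'a::euclidean_space \<Rightarrow> 'a tensor \<Rightarrow> 'a tensor" where
  "contract \<phi> = lin_extend (\<lambda>w. case w of [] \<Rightarrow> 0 | b # v \<Rightarrow> (\<phi> \<bullet> b) *\<^sub>R Poly_Mapping.single v 1)"

lemma linear_contract: "linear (contract \<phi>)"
  unfolding contract_def by (rule linear_lin_extend)

lemma contract_single: "contract \<phi> (Poly_Mapping.single (b # v) 1) = (\<phi> \<bullet> b) *\<^sub>R Poly_Mapping.single v 1"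
  by (simp add: contract_def)

lemma linear_contract_left: "linear (\<lambda>\<phi>. contract \<phi> t)"
  by (rule linearI)
    (auto simp: contract_def lin_extend_def inner_add_left scaleR_add_left scaleR_add_right scaleR_sum_right
      sum.distrib[symmetric] intro!: sum.cong split: list.split)

lemma contract_in_tensor_space:
  assumes "t \<in> tensor_space (Suc k)"
  shows "contract \<phi> t \<in> tensor_space k"
  unfolding contract_def lin_extend_def
proof (intro subspace_sum subspace_scale subspace_tensor_space)
  fix w assume "w \<in> Poly_Mapping.keys t"
  then obtain b v where "w = b # v" "length v = k" "set v \<subseteq> Basis"
    using assms by (cases w) (auto simp: tensor_space_def)
  moreover from this have "Poly_Mapping.single v 1 \<in> tensor_space k" by (simp add: tensor_space_def)
  ultimately show "(case w of [] \<Rightarrow> 0 | b # v \<Rightarrow> (\<phi> \<bullet> b) *\<^sub>R Poly_Mapping.single v 1) \<in> tensor_space k"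
    by (simp add: subspace_scale[OF subspace_tensor_space])
qed

text \<open>Applying \<open>P\<close> to the first factor leaves a lower power of \<open>P\<close>
  on contractions of \<open>t\<close>; this drives the induction on the exponent. The
  \<open>x i\<close> and \<open>d i\<close> are arbitrary, so \<open>P\<close> may contain
  subtracted terms.\<close>

lemma tensor_map_contract:
  assumes t: "t \<in> tensor_space (Suc k)" and P: "\<And>v. P v = (\<Sum>i\<in>I. (d i \<bullet> v) *\<^sub>R x i)"
  shows "tensor_map P t = (\<Sum>i\<in>I. tensor_mult (x i) (tensor_map P (contract (d i) t)))"
proof (rule linear_eq_on_words[OF linear_tensor_map])
  have "linear (\<lambda>t. tensor_mult (x i) (tensor_map P (contract (d i) t)))" for i
    using linear_compose[OF linear_contract linear_compose[OF linear_tensor_map linear_tensor_mult_right]]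
    by (simp add: o_def)
  then show "linear (\<lambda>t. \<Sum>i\<in>I. tensor_mult (x i) (tensor_map P (contract (d i) t)))"
    by (intro linear_compose_sum) simp
  fix w assume "w \<in> Poly_Mapping.keys t"
  then obtain b v where w: "w = b # v" using t by (cases w) (auto simp: tensor_space_def)
  have 1: "tensor_map P (Poly_Mapping.single u 1) = elementary (map P u)" for u by (simp add: tensor_map_def)
  have "tensor_map P (Poly_Mapping.single w 1) = tensor_mult (P b) (elementary (map P v))"
    by (simp add: 1 w)
  also have "\<dots> = (\<Sum>i\<in>I. (d i \<bullet> b) *\<^sub>R tensor_mult (x i) (elementary (map P v)))"
    by (simp only: P[of b] linear_sum[OF linear_tensor_mult_left] linear_scale[OF linear_tensor_mult_left])
  also have "\<dots> = (\<Sum>i\<in>I. tensor_mult (x i) (tensor_map P (contract (d i) (Poly_Mapping.single w 1))))"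
    by (simp only: w contract_single linear_scale[OF linear_tensor_map] linear_scale[OF linear_tensor_mult_right] 1)
  finally show "tensor_map P (Poly_Mapping.single w 1)
      = (\<Sum>i\<in>I. tensor_mult (x i) (tensor_map P (contract (d i) (Poly_Mapping.single w 1))))" .
qed

section \<open>Contractions of tensors in the maximal power\<close>

lemma dual_mult_contract:
  assumes "t \<in> tensor_space (Suc k)"
  shows "blinfun_apply (dual_mult (blinfun_inner_right \<phi>) \<psi>) t = blinfun_apply \<psi> (contract \<phi> t)"
proof (rule linear_eq_on_words[where f = "blinfun_apply (dual_mult (blinfun_inner_right \<phi>) \<psi>)"])
  have lin: "linear (blinfun_apply \<eta>)" for \<eta> :: "'v::real_normed_vector \<Rightarrow>\<^sub>L real"
    by (rule bounded_linear.linear[OF blinfun.bounded_linear_right])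
  show "linear (blinfun_apply (dual_mult (blinfun_inner_right \<phi>) \<psi>))" by (rule lin)
  show "linear (\<lambda>t. blinfun_apply \<psi> (contract \<phi> t))"
    using linear_compose[OF linear_contract lin] by (simp add: o_def)
  fix w assume "w \<in> Poly_Mapping.keys t"
  then obtain b v where w: "w = b # v" "b \<in> Basis" using assms by (cases w) (auto simp: tensor_space_def)
  show "blinfun_apply (dual_mult (blinfun_inner_right \<phi>) \<psi>) (Poly_Mapping.single w 1)
      = blinfun_apply \<psi> (contract \<phi> (Poly_Mapping.single w 1))"
    unfolding w(1) contract_single using w(2) by (simp add: blinfun_apply_dual_mult blinfun.scaleR_right)
qed

text \<open>The product functional \<open>f \<otimes> ... \<otimes> f\<close>; at exponent 0 it
  reads off the scalar.\<close>

primrec functional_power :: "'a::euclidean_space \<Rightarrow> nat \<Rightarrow> 'a tensor \<Rightarrow>\<^sub>L real" where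
  "functional_power f 0 = Blinfun (lin_extend (\<lambda>w. if w = [] then 1 else 0))"
| "functional_power f (Suc k) = dual_mult (blinfun_inner_right f) (functional_power f k)"

lemma functional_power_0: "blinfun_apply (functional_power f 0) (Poly_Mapping.single [] 1) = 1"
proof -
  have "bounded_linear (lin_extend (\<lambda>w::'a list. if w = [] then 1 else 0 :: real))"
    by (rule bounded_linear_lin_extend[of _ 1]) simp
  then show ?thesis by (simp add: bounded_linear_Blinfun_apply)
qed

lemma dual_mult_elementary_singleton:
  "blinfun_apply (dual_mult (blinfun_inner_right d) (functional_power f 0)) (elementary [y]) = d \<bullet> y"
  using functional_power_0[of f] by (simp add: dual_mult_tensor_mult)

lemma max_power_subset_tensor_space: "max_power C (Suc k) \<subseteq> tensor_space (Suc k)"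
proof (cases k)
  case 0
  then show ?thesis using elementary_in_tensor_space[of "[_]"] by (auto simp del: elementary.simps)
qed (auto simp: max_tensor_def)

lemma dual_mult_in_dual_max_power:
  assumes "d \<in> span_dual C" "\<psi> \<in> dual_cone (max_power C (Suc k))"
  shows "dual_mult (blinfun_inner_right d) \<psi> \<in> dual_cone (max_power C (Suc (Suc k)))"
proof -
  have "blinfun_inner_right d \<in> dual_cone C" using span_dualD(1)[OF assms(1)] by (simp add: dual_cone_def)
  then have "dual_mult (blinfun_inner_right d) \<psi> \<in> min_tensor dual_mult (dual_cone C) (dual_cone (max_power C (Suc k)))"
    unfolding min_tensor_def using assms(2) by (intro hull_inc) blast
  then show ?thesis unfolding max_power.simps max_tensor_def by (subst dual_cone_def) blast
qed

lemma functional_power_in_dual: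
  assumes "f \<in> span_dual C"
  shows "functional_power f (Suc k) \<in> dual_cone (max_power C (Suc k))"
proof (induction k)
  case 0
  have "0 \<le> blinfun_apply (functional_power f (Suc 0)) (elementary [y])" if "y \<in> C" for y
    using span_dualD(1)[OF assms that] unfolding functional_power.simps(2) dual_mult_elementary_singleton .
  then show ?case unfolding max_power.simps dual_cone_def by blast
next
  case (Suc k)
  then show ?case using dual_mult_in_dual_max_power[OF assms] by simp
qed

text \<open>For \<psi> nonnegative on the lower power, the product of \<open>d\<close> and \<psi> is
  nonnegative at \<open>t\<close> by definition of the maximal product, and its value there is that
  of \<psi> at the contraction. At exponent 1 the power is a copy of \<open>C\<close> and not
  defined as a dual, so the bipolar theorem is applied instead.\<close>

lemma contract_max_power:
  assumes C: "pointed_cone C" "span C = UNIV" and d: "d \<in> span_dual C" and t: "t \<in> max_power C (Suc (Suc k))"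
  shows "contract d t \<in> max_power C (Suc k)"
proof -
  have ts: "t \<in> tensor_space (Suc (Suc k))" using t max_power_subset_tensor_space by blast
  have cs: "contract d t \<in> tensor_space (Suc k)" by (rule contract_in_tensor_space[OF ts])
  have pos: "0 \<le> blinfun_apply \<psi> (contract d t)" if "\<psi> \<in> dual_cone (max_power C (Suc k))" for \<psi>
    using dual_mult_in_dual_max_power[OF d that] t
    by (simp only: dual_mult_contract[OF ts, symmetric]) (simp only: dual_cone_def mem_Collect_eq)
  show ?thesis
  proof (cases k)
    case (Suc j)
    have "\<psi> \<in> dual_cone (max_power C (Suc k))"
      if "\<psi> \<in> min_tensor dual_mult (dual_cone C) (dual_cone (max_power C (Suc j)))" for \<psi>
      using that by (auto simp: Suc dual_cone_def max_tensor_def)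
    then show ?thesis using pos cs unfolding Suc max_power.simps max_tensor_def by blast
  next
    case 0
    define s where "s = contract d t"
    define x where "x = (\<Sum>b\<in>Basis. Poly_Mapping.lookup s [b] *\<^sub>R b)"
    have s: "s = elementary [x]"
    proof -
      have ks: "Poly_Mapping.keys s \<subseteq> (\<lambda>b. [b]) ` Basis"
        using cs by (auto simp: s_def[symmetric] 0 tensor_space_def length_Suc_conv)
      have "s = (\<Sum>w\<in>Poly_Mapping.keys s. Poly_Mapping.lookup s w *\<^sub>R Poly_Mapping.single w 1)"
        by (rule tensor_expand)
      also have "\<dots> = (\<Sum>w\<in>(\<lambda>b. [b]) ` Basis. Poly_Mapping.lookup s w *\<^sub>R Poly_Mapping.single w 1)"
        using ks by (intro sum.mono_neutral_left) (auto simp: in_keys_iff)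
      also have "\<dots> = (\<Sum>b\<in>Basis. Poly_Mapping.lookup s [b] *\<^sub>R elementary [b])"
        by (subst sum.reindex) (auto simp: inj_on_def elementary_Basis simp del: elementary.simps intro!: sum.cong)
      also have "\<dots> = elementary [x]"
        unfolding x_def by (simp only: linear_sum[OF linear_elementary_singleton] linear_scale[OF linear_elementary_singleton])
      finally show ?thesis .
    qed
    have "x \<in> C"
    proof (rule span_dual_bipolar[OF C(1)])
      fix g assume g: "g \<in> span_dual C"
      \<comment> \<open>This is \<open>g\<close> acting on tensors of degree 1; its second factor
        only reads off the scalar of degree 0.\<close>
      let ?\<psi> = "dual_mult (blinfun_inner_right g) (functional_power 0 0)"
      have "?\<psi> \<in> dual_cone (max_power C (Suc k))"
        unfolding 0 max_power.simps dual_cone_def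
        using span_dualD(1)[OF g] by (auto simp del: elementary.simps functional_power.simps simp: dual_mult_elementary_singleton)
      from pos[OF this] show "0 \<le> g \<bullet> x"
        unfolding s_def[symmetric] s dual_mult_elementary_singleton .
    qed (simp add: C(2))
    then show ?thesis by (simp add: s_def[symmetric] s 0 del: elementary.simps)
  qed
qed

text \<open>\<open>y\<close> arises from \<open>t\<close> by evaluating \<psi> on all factors but
  the first. Elements of the dual are nonnegative at it, so it lies in \<open>C\<close> by the
  bipolar theorem.\<close>

lemma contract_functional:
  assumes C: "pointed_cone C" "span C = UNIV" and t: "t \<in> max_power C (Suc (Suc k))"
    and \<psi>: "\<psi> \<in> dual_cone (max_power C (Suc k))"
  obtains y where "y \<in> C" "\<And>d. d \<bullet> y = blinfun_apply \<psi> (contract d t)"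
proof -
  define y where "y = (\<Sum>b\<in>Basis. blinfun_apply \<psi> (contract b t) *\<^sub>R b)"
  have y: "d \<bullet> y = blinfun_apply \<psi> (contract d t)" for d
  proof -
    have "contract d t = contract (\<Sum>b\<in>Basis. (d \<bullet> b) *\<^sub>R b) t" by (simp add: euclidean_representation)
    also have "\<dots> = (\<Sum>b\<in>Basis. (d \<bullet> b) *\<^sub>R contract b t)"
      by (simp only: linear_sum[OF linear_contract_left] linear_scale[OF linear_contract_left])
    finally show ?thesis
      by (simp add: y_def inner_sum_right blinfun.sum_right blinfun.scaleR_right mult.commute)
  qed
  have "y \<in> C"
  proof (rule span_dual_bipolar[OF C(1)])
    fix d assume "d \<in> span_dual C"
    then show "0 \<le> d \<bullet> y" using \<psi> contract_max_power[OF C _ t] by (simp add: y dual_cone_def)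
  qed (simp add: C(2))
  then show ?thesis using y by (rule that)
qed

text \<open>The upper bound belongs to the induction because \<open>P\<close> subtracts
  \<open>\<eta> f e\<close>: what is subtracted must itself be estimated from above. The third
  conjunct makes nonnegative multiples of \<open>E\<close> available as elements of the minimal
  power.\<close>

lemma tensor_power_bounds:
  fixes C1 :: "'a::euclidean_space set" and C2 :: "'b::euclidean_space set" and n :: nat
  assumes C1: "pointed_cone C1" "span C1 = UNIV" and C2: "pointed_cone C2"
    and e: "e \<in> C2" and f: "f \<in> span_dual C1"
    and Q: "\<And>v. Q v = (\<Sum>i<n. (d i \<bullet> v) *\<^sub>R x i)" "\<And>i. i < n \<Longrightarrow> x i \<in> C2 \<and> d i \<in> span_dual C1"
    and lower: "\<And>y. y \<in> C1 \<Longrightarrow> Q y - (c * (f \<bullet> y)) *\<^sub>R e \<in> C2"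
    and upper: "\<And>y. y \<in> C1 \<Longrightarrow> (D * (f \<bullet> y)) *\<^sub>R e - Q y \<in> C2"
    and pos: "0 < c" "0 < D" "0 < \<eta>"
    and P: "\<And>v. P v = Q v - (\<eta> * (f \<bullet> v)) *\<^sub>R e"
    and small: "\<And>j. j \<le> k \<Longrightarrow> \<eta> * D ^ j \<le> (c / 2) ^ Suc j"
    and t: "t \<in> max_power C1 (Suc k)"
  defines "E j \<equiv> elementary (replicate j e)" and "F \<equiv> functional_power f"
  shows "tensor_map P t - ((c / 2) ^ Suc k * blinfun_apply (F (Suc k)) t) *\<^sub>R E (Suc k) \<in> min_power C2 (Suc k)
       \<and> (D ^ Suc k * blinfun_apply (F (Suc k)) t) *\<^sub>R E (Suc k) - tensor_map P t \<in> min_power C2 (Suc k)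
       \<and> E (Suc k) \<in> min_power C2 (Suc k)"
  using small t
proof (induction k arbitrary: t)
  case 0
  obtain y where y: "y \<in> C1" "t = elementary [y]" using "0.prems"(2) by auto
  have linP: "linear P"
  proof -
    have "linear (\<lambda>v. (\<Sum>i<n. (d i \<bullet> v) *\<^sub>R x i) - (f \<bullet> v) *\<^sub>R (\<eta> *\<^sub>R e))"
      by (intro linear_compose_sub linear_compose_sum linear_rank_one ballI)
    then show ?thesis by (simp add: P[abs_def] Q(1) mult.commute)
  qed
  have tm: "tensor_map P t = elementary [P y]"
    unfolding y(2) tensor_map_elementary[OF linP] by simp
  have Ft: "blinfun_apply (F (Suc 0)) t = f \<bullet> y"
    unfolding F_def functional_power.simps(2) y(2) by (rule dual_mult_elementary_singleton)
  have fy: "0 \<le> f \<bullet> y" by (rule span_dualD(1)[OF f y(1)])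
  have el: "a *\<^sub>R elementary [u] - b *\<^sub>R elementary [v] = elementary [a *\<^sub>R u - b *\<^sub>R v]" for a b and u v :: 'b
    by (simp only: linear_diff[OF linear_elementary_singleton] linear_scale[OF linear_elementary_singleton])
  have "P y - (c / 2 * (f \<bullet> y)) *\<^sub>R e = (Q y - (c * (f \<bullet> y)) *\<^sub>R e) + ((c / 2 - \<eta>) * (f \<bullet> y)) *\<^sub>R e"
    by (simp add: P algebra_simps flip: scaleR_add_left)
  also have "\<dots> \<in> C2"
    using "0.prems"(1)[of 0] fy by (intro pointed_cone_add[OF C2] lower y pointed_cone_scale[OF C2] e) auto
  finally have 1: "P y - (c / 2 * (f \<bullet> y)) *\<^sub>R e \<in> C2" .
  have "(D * (f \<bullet> y)) *\<^sub>R e - P y = ((D * (f \<bullet> y)) *\<^sub>R e - Q y) + (\<eta> * (f \<bullet> y)) *\<^sub>R e"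
    by (simp add: P)
  also have "\<dots> \<in> C2"
    using pos(3) fy by (intro pointed_cone_add[OF C2] upper y pointed_cone_scale[OF C2] e) auto
  finally have 2: "(D * (f \<bullet> y)) *\<^sub>R e - P y \<in> C2" .
  have E1: "E (Suc 0) = elementary [e]" by (simp add: E_def)
  show ?case
    unfolding tm Ft E1 min_power.simps power_one_right
    using 1 2 e el[of 1 "P y" "c / 2 * (f \<bullet> y)" e] el[of "D * (f \<bullet> y)" e 1 "P y"]
    by (simp del: elementary.simps)
next
  case (Suc k)
  let ?K = "min_power C2 (Suc (Suc k))"
  have K: "convex_cone ?K" and K': "convex_cone (min_power C2 (Suc k))"
    by (rule convex_cone_min_power; simp add: pointed_coneD C2)+
  have add: "u + v \<in> ?K" if "u \<in> ?K" "v \<in> ?K" for u v using K that by (simp add: convex_cone_iff del: min_power.simps)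
  have scale: "a *\<^sub>R u \<in> ?K" if "u \<in> ?K" "0 \<le> a" for u a using K that by (simp add: convex_cone_iff del: min_power.simps)
  define \<tau> where "\<tau> g = tensor_map P (contract g t)" for g
  have ts: "t \<in> tensor_space (Suc (Suc k))" using Suc.prems(2) max_power_subset_tensor_space by blast
  \<comment> \<open>Evaluating \<open>f\<close> on all factors but the first turns the inductive
    bounds for \<open>contract g t\<close> into multiples of \<open>g \<bullet> y\<close> with a
    single \<open>y\<close> in \<open>C1\<close>, to which the bounds on \<open>Q\<close>
    apply.\<close>
  obtain y where y: "y \<in> C1" "\<And>g. g \<bullet> y = blinfun_apply (F (Suc k)) (contract g t)"
    using contract_functional[OF C1 Suc.prems(2) functional_power_in_dual[OF f]] unfolding F_def by blast
  have Ft: "blinfun_apply (F (Suc (Suc k))) t = f \<bullet> y"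
    unfolding y(2) using dual_mult_contract[OF ts] by (simp add: F_def)
  have fy: "0 \<le> f \<bullet> y" by (rule span_dualD(1)[OF f y(1)])
  have IH: "\<tau> g - ((c / 2) ^ Suc k * (g \<bullet> y)) *\<^sub>R E (Suc k) \<in> min_power C2 (Suc k)"
      "(D ^ Suc k * (g \<bullet> y)) *\<^sub>R E (Suc k) - \<tau> g \<in> min_power C2 (Suc k)"
      "E (Suc k) \<in> min_power C2 (Suc k)" if g: "g \<in> span_dual C1" for g
    using Suc.IH[OF _ contract_max_power[OF C1 g Suc.prems(2)]] Suc.prems(1) unfolding \<tau>_def y(2) by auto
  have \<tau>K: "\<tau> g \<in> min_power C2 (Suc k)" if g: "g \<in> span_dual C1" for g
  proof -
    have "0 \<le> (c / 2) ^ Suc k * (g \<bullet> y)" using pos(1) span_dualD(1)[OF g y(1)] by (intro mult_nonneg_nonneg) auto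
    then have "(\<tau> g - ((c / 2) ^ Suc k * (g \<bullet> y)) *\<^sub>R E (Suc k)) + ((c / 2) ^ Suc k * (g \<bullet> y)) *\<^sub>R E (Suc k)
        \<in> min_power C2 (Suc k)"
      using IH[OF g] K' unfolding convex_cone_iff by blast
    then show ?thesis by simp
  qed
  define EE where "EE = E (Suc (Suc k))"
  have EE: "EE = tensor_mult e (E (Suc k))" by (simp add: EE_def E_def)
  have EK: "EE \<in> ?K" unfolding EE by (intro tensor_mult_in_min_power e IH(3)[OF f])
  \<comment> \<open>\<open>G\<close> has \<open>Q\<close> on the first factor and \<open>P\<close>
    on the others, and \<open>T\<close> is the part subtracted with weight \<eta>. In
    \<open>H\<close> the other factors are replaced by copies of \<open>e\<close>: it mediates
    between \<open>G\<close>, by induction, and multiples of \<open>EE\<close>, by the bounds on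
    \<open>Q\<close>.\<close>
  define G where "G = (\<Sum>i<n. tensor_mult (x i) (\<tau> (d i)))"
  define T where "T = tensor_mult e (\<tau> f)"
  define H where "H = tensor_mult (Q y) (E (Suc k))"
  have H: "H = (\<Sum>i<n. (d i \<bullet> y) *\<^sub>R tensor_mult (x i) (E (Suc k)))"
    by (simp only: H_def Q(1) linear_sum[OF linear_tensor_mult_left] linear_scale[OF linear_tensor_mult_left])
  have tm: "tensor_map P t = G - \<eta> *\<^sub>R T"
  proof -
    have "P v = (\<Sum>i<Suc n. ((if i = n then f else d i) \<bullet> v) *\<^sub>R (if i = n then - (\<eta> *\<^sub>R e) else x i))" for v
      by (simp add: P Q(1) mult.commute)
    from tensor_map_contract[OF ts this] show ?thesis
      by (simp add: G_def T_def \<tau>_def linear_neg[OF linear_tensor_mult_left] linear_scale[OF linear_tensor_mult_left])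
  qed
  have G1: "G - (c / 2) ^ Suc k *\<^sub>R H \<in> ?K"
  proof -
    have "G - (c / 2) ^ Suc k *\<^sub>R H
        = (\<Sum>i<n. tensor_mult (x i) (\<tau> (d i) - ((c / 2) ^ Suc k * (d i \<bullet> y)) *\<^sub>R E (Suc k)))"
      by (simp only: G_def H scaleR_sum_right sum_subtractf[symmetric] linear_diff[OF linear_tensor_mult_right]
          linear_scale[OF linear_tensor_mult_right] scaleR_scaleR)
    also have "\<dots> \<in> ?K"
      using Q(2) by (intro sum_in_cone[OF K] tensor_mult_in_min_power IH) auto
    finally show ?thesis .
  qed
  have G2: "D ^ Suc k *\<^sub>R H - G \<in> ?K"
  proof -
    have "D ^ Suc k *\<^sub>R H - G
        = (\<Sum>i<n. tensor_mult (x i) ((D ^ Suc k * (d i \<bullet> y)) *\<^sub>R E (Suc k) - \<tau> (d i)))"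
      by (simp only: G_def H scaleR_sum_right sum_subtractf[symmetric] linear_diff[OF linear_tensor_mult_right]
          linear_scale[OF linear_tensor_mult_right] scaleR_scaleR)
    also have "\<dots> \<in> ?K"
      using Q(2) by (intro sum_in_cone[OF K] tensor_mult_in_min_power IH) auto
    finally show ?thesis .
  qed
  have H1: "H - (c * (f \<bullet> y)) *\<^sub>R EE \<in> ?K"
    unfolding H_def EE using tensor_mult_in_min_power[OF lower[OF y(1)] IH(3)[OF f]]
    by (simp only: linear_diff[OF linear_tensor_mult_left] linear_scale[OF linear_tensor_mult_left])
  have H2: "(D * (f \<bullet> y)) *\<^sub>R EE - H \<in> ?K"
    unfolding H_def EE using tensor_mult_in_min_power[OF upper[OF y(1)] IH(3)[OF f]]
    by (simp only: linear_diff[OF linear_tensor_mult_left] linear_scale[OF linear_tensor_mult_left])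
  have T1: "T \<in> ?K" unfolding T_def by (intro tensor_mult_in_min_power e \<tau>K f)
  have T2: "(D ^ Suc k * (f \<bullet> y)) *\<^sub>R EE - T \<in> ?K"
    unfolding T_def EE using tensor_mult_in_min_power[OF e IH(2)[OF f]]
    by (simp only: linear_diff[OF linear_tensor_mult_right] linear_scale[OF linear_tensor_mult_right])
  \<comment> \<open>\<open>(c / 2) ^ Suc k * c\<close> is twice the required
    \<open>(c / 2) ^ Suc (Suc k)\<close>; the spare half pays for the loss
    \<open>\<eta> * D ^ Suc k\<close>.\<close>
  have slack: "0 \<le> ((c / 2) ^ Suc k * c - \<eta> * D ^ Suc k - (c / 2) ^ Suc (Suc k)) * (f \<bullet> y)"
  proof -
    have "(c / 2) ^ Suc k * c = 2 * (c / 2) ^ Suc (Suc k)" by simp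
    then have "0 \<le> (c / 2) ^ Suc k * c - \<eta> * D ^ Suc k - (c / 2) ^ Suc (Suc k)"
      using Suc.prems(1)[of "Suc k"] by simp
    then show ?thesis using fy by (rule mult_nonneg_nonneg)
  qed
  define p where "p = (c / 2) ^ Suc k"
  define q where "q = D ^ Suc k"
  define r where "r = (c / 2) ^ Suc (Suc k)"
  have pq: "0 \<le> p" "0 \<le> q" using pos by (simp_all add: p_def q_def)
  note G1 = G1[folded p_def] and G2 = G2[folded q_def] and T2 = T2[folded q_def]
    and slack = slack[folded p_def q_def r_def]
  have "tensor_map P t - (r * (f \<bullet> y)) *\<^sub>R EE
      = ((G - p *\<^sub>R H) + p *\<^sub>R (H - (c * (f \<bullet> y)) *\<^sub>R EE))
        + (\<eta> *\<^sub>R ((q * (f \<bullet> y)) *\<^sub>R EE - T) + ((p * c - \<eta> * q - r) * (f \<bullet> y)) *\<^sub>R EE)"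
    by (simp add: tm algebra_simps)
  also have "\<dots> \<in> ?K"
    using pos pq slack by (intro add G1 H1 T2 EK scale) auto
  finally have low: "tensor_map P t - (r * (f \<bullet> y)) *\<^sub>R EE \<in> ?K" .
  have "(q * D * (f \<bullet> y)) *\<^sub>R EE - tensor_map P t
      = ((q *\<^sub>R H - G) + q *\<^sub>R ((D * (f \<bullet> y)) *\<^sub>R EE - H)) + \<eta> *\<^sub>R T"
    by (simp add: tm algebra_simps)
  also have "\<dots> \<in> ?K"
    using pos pq by (intro add G2 H2 T1 scale) auto
  finally have up: "(q * D * (f \<bullet> y)) *\<^sub>R EE - tensor_map P t \<in> ?K" .
  have q': "D ^ Suc (Suc k) = q * D" by (simp add: q_def)
  show ?case
    unfolding Ft r_def[symmetric] EE_def[symmetric] q' using low up EK by blast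
qed

lemma tensor_power_in_min_power:
  fixes C1 :: "'a::euclidean_space set" and C2 :: "'b::euclidean_space set" and n :: nat
  assumes C1: "pointed_cone C1" "span C1 = UNIV" and C2: "pointed_cone C2"
    and e: "e \<in> C2" and f: "f \<in> span_dual C1"
    and Q: "\<And>v. Q v = (\<Sum>i<n. (d i \<bullet> v) *\<^sub>R x i)" "\<And>i. i < n \<Longrightarrow> x i \<in> C2 \<and> d i \<in> span_dual C1"
    and lower: "\<And>y. y \<in> C1 \<Longrightarrow> Q y - (c * (f \<bullet> y)) *\<^sub>R e \<in> C2"
    and upper: "\<And>y. y \<in> C1 \<Longrightarrow> (D * (f \<bullet> y)) *\<^sub>R e - Q y \<in> C2"
    and pos: "0 < c" "0 < D" "0 < \<eta>"
    and P: "\<And>v. P v = Q v - (\<eta> * (f \<bullet> v)) *\<^sub>R e"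
    and small: "\<And>j. j \<le> k \<Longrightarrow> \<eta> * D ^ j \<le> (c / 2) ^ Suc j"
    and t: "t \<in> max_power C1 (Suc k)"
  shows "tensor_map P t \<in> min_power C2 (Suc k)"
proof -
  let ?F = "functional_power f (Suc k)" and ?E = "elementary (replicate (Suc k) e)"
  have b: "tensor_map P t - ((c / 2) ^ Suc k * blinfun_apply ?F t) *\<^sub>R ?E \<in> min_power C2 (Suc k)"
    "?E \<in> min_power C2 (Suc k)"
    using tensor_power_bounds[OF C1 C2 e f Q lower upper pos P small t] by blast+
  have "0 \<le> blinfun_apply ?F t" using functional_power_in_dual[OF f, of k] t by (simp add: dual_cone_def)
  then have "0 \<le> (c / 2) ^ Suc k * blinfun_apply ?F t" using pos by (intro mult_nonneg_nonneg) auto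
  then have "(tensor_map P t - ((c / 2) ^ Suc k * blinfun_apply ?F t) *\<^sub>R ?E)
      + ((c / 2) ^ Suc k * blinfun_apply ?F t) *\<^sub>R ?E \<in> min_power C2 (Suc k)"
    using b convex_cone_min_power[OF pointed_coneD(3)[OF C2]] unfolding convex_cone_iff by blast
  then show ?thesis by simp
qed

section \<open>Choice of the constants and conclusion\<close>

lemma small_step_exists:
  fixes c D :: real
  assumes "0 < c" "0 < D"
  obtains \<eta> where "0 < \<eta>" "\<eta> < c" "\<eta> \<le> 1" "\<And>j. j \<le> k \<Longrightarrow> \<eta> * D ^ j \<le> (c / 2) ^ Suc j"
proof -
  define M where "M = Min ((\<lambda>j. (c / 2) ^ Suc j / D ^ j) ` {..k})"
  have M: "0 < M" "\<And>j. j \<le> k \<Longrightarrow> M \<le> (c / 2) ^ Suc j / D ^ j"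
    using assms by (auto simp: M_def)
  define \<eta> where "\<eta> = min (min (c / 2) 1) M"
  have "\<eta> * D ^ j \<le> (c / 2) ^ Suc j" if "j \<le> k" for j
  proof -
    have "\<eta> \<le> (c / 2) ^ Suc j / D ^ j" using M(2)[OF that] by (simp add: \<eta>_def)
    then show ?thesis using assms(2) by (simp add: pos_le_divide_eq)
  qed
  moreover have "0 < \<eta>" "\<eta> < c" "\<eta> \<le> 1" using assms M(1) by (auto simp: \<eta>_def)
  ultimately show ?thesis using that by blast
qed

theorem theoremA5:
  fixes C1 :: "'a::euclidean_space set" and C2 :: "'b::euclidean_space set" and k :: nat
  assumes "proper_cone C1" and "\<not> classical_cone C1"
    and "proper_cone C2" and "\<not> classical_cone C2"
    and "1 \<le> k"
  shows "\<exists>P :: 'a \<Rightarrow> 'b. linear P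
           \<and> tensor_map P ` max_power C1 k \<subseteq> min_power C2 k
           \<and> \<not> entanglement_breaking C1 C2 P"
proof -
  note p1 = proper_cone_pointed[OF assms(1)] and s1 = proper_cone_span[OF assms(1)]
    and p2 = proper_cone_pointed[OF assms(3)] and s2 = proper_cone_span[OF assms(3)]
  obtain l where k: "k = Suc l" using assms(5) by (cases k) auto
  have "entangled (span_dual C1) C2"
    using simplicial_cone_imp_classical[OF _ s1] simplicial_cone_imp_classical[OF _ s2] assms(2,4)
      simplicial_cone_span_dual[OF p1]
    by (intro nonsimplicial_cones_entangled pointed_cone_span_dual p2) auto
  then obtain R W where R: "linear R" "\<forall>g. (\<forall>d\<in>span_dual C1. 0 \<le> g \<bullet> d) \<longrightarrow> R g \<in> C2"
    and W: "linear W" "\<forall>d\<in>span_dual C1. \<forall>c\<in>C2. 0 \<le> W d \<bullet> c" and neg: "(\<Sum>b\<in>Basis. W b \<bullet> R b) < 0"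
    unfolding entangled_def by (elim exE conjE)
  have RC: "R y \<in> C2" if "y \<in> C1" for y
    using R(2) span_dualD(1)[OF _ that] by (simp add: inner_commute)
  obtain m e where m: "m > 0" and e: "\<And>x. norm x \<le> m \<Longrightarrow> e + x \<in> C2"
    using order_unit[OF p2 s2] by blast
  obtain f where "f \<in> span_dual C1" and fpos: "\<And>y. y \<in> C1 \<Longrightarrow> y \<noteq> 0 \<Longrightarrow> 0 < f \<bullet> y"
    using strictly_positive_functional[OF p1] by blast
  obtain \<mu> where \<mu>: "\<mu> > 0" "\<And>y. y \<in> C1 \<Longrightarrow> \<mu> * norm y \<le> f \<bullet> y"
    using positive_functional_norm_bound[OF p1 fpos] by blast
  have f: "f + h \<in> span_dual C1" if h: "norm h \<le> \<mu>" for h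
  proof -
    have "0 \<le> (f + h) \<bullet> y" if y: "y \<in> C1" for y
    proof -
      have "norm h * norm y \<le> \<mu> * norm y" using h by (intro mult_right_mono) auto
      then show ?thesis using Cauchy_Schwarz_ineq2[of h y] \<mu>(2)[OF y] by (simp add: inner_add_left)
    qed
    then show ?thesis by (simp add: span_dual_def s1)
  qed
  have eC: "e \<in> C2" and fC: "f \<in> span_dual C1" using e[of 0] f[of 0] m \<mu>(1) by auto
  define shift where "shift s v = R v + (s * (f \<bullet> v)) *\<^sub>R e" for s v
  define S where "S = {s. 0 \<le> s \<and> entanglement_breaking C1 C2 (shift s)}"
  define s0 where "s0 = Inf S"
  have Sne: "S \<noteq> {}"
    using entanglement_breaking_shift_exists[OF p1 s1 p2 R(1) m e \<mu>(1) f] by (auto simp: S_def shift_def[abs_def])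
  have Sbd: "bdd_below S" unfolding S_def by (rule bdd_belowI[of _ 0]) simp
  define \<Lambda> where "\<Lambda> = W f \<bullet> e"
  define \<rho> where "\<rho> = (\<Sum>b\<in>Basis. W b \<bullet> R b)"
  have \<Lambda>: "0 \<le> \<Lambda>" using W(2) fC eC by (simp add: \<Lambda>_def)
  \<comment> \<open>The trace against \<open>W\<close> is nonnegative on entanglement breaking maps
    and affine in \<open>s\<close>, so \<open>\<rho> + s \<Lambda> \<ge> 0\<close> with
    \<open>\<rho> < 0\<close> keeps \<open>s\<close> away from 0. The added 1 covers
    \<open>\<Lambda> = 0\<close>.\<close>
  have bound: "- \<rho> / (\<Lambda> + 1) \<le> s" if "s \<in> S" for s
  proof -
    have s: "0 \<le> s" "entanglement_breaking C1 C2 (shift s)" using that by (auto simp: S_def)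
    have Wf: "W f = (\<Sum>b\<in>Basis. (f \<bullet> b) *\<^sub>R W b)"
    proof -
      have "W f = W (\<Sum>b\<in>Basis. (f \<bullet> b) *\<^sub>R b)" by (simp add: euclidean_representation)
      then show ?thesis by (simp add: linear_sum[OF W(1)] linear_scale[OF W(1)])
    qed
    have "0 \<le> (\<Sum>b\<in>Basis. W b \<bullet> shift s b)" by (rule entanglement_breaking_trace_nonneg[OF s1 s(2) W])
    also have "\<dots> = \<rho> + s * \<Lambda>"
      unfolding shift_def \<rho>_def \<Lambda>_def Wf
      by (simp add: inner_add_right sum.distrib inner_sum_left sum_distrib_left mult.assoc)
    finally have "- \<rho> \<le> s * (\<Lambda> + 1)" using s(1) by (simp add: distrib_left)
    moreover have "0 < \<Lambda> + 1" using \<Lambda> by simp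
    ultimately show ?thesis by (simp only: pos_divide_le_eq)
  qed
  have "0 < - \<rho> / (\<Lambda> + 1)" using neg \<Lambda> by (simp add: \<rho>_def divide_neg_pos)
  moreover have "- \<rho> / (\<Lambda> + 1) \<le> s0" unfolding s0_def by (rule cInf_greatest[OF Sne bound])
  ultimately have s0: "0 < s0" by linarith
  obtain K where K: "\<And>v. norm (R v) \<le> K * norm v" "K > 0"
    using linear_bounded_pos[OF R(1)] by blast
  \<comment> \<open>\<open>s0 + 1\<close> bounds the coefficient \<open>s\<close> of
    \<open>f e\<close>, as \<open>s < s0 + \<eta>\<close> and \<open>\<eta> \<le> 1\<close>; the
    last term covers \<open>R\<close>, by
    \<open>|R y| \<le> K |y| \<le> (K / \<mu>) (f \<bullet> y)\<close>. None of this depends on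
    \<eta>, which is chosen afterwards.\<close>
  define D where "D = s0 + 1 + K / (\<mu> * m)"
  have D: "0 < D" using s0 K(2) \<mu>(1) m by (auto simp: D_def intro!: add_pos_pos)
  obtain \<eta> where \<eta>: "0 < \<eta>" "\<eta> < s0" "\<eta> \<le> 1" and small: "\<And>j. j \<le> l \<Longrightarrow> \<eta> * D ^ j \<le> (s0 / 2) ^ Suc j"
    using small_step_exists[OF s0 D, of l] by blast
  obtain s where s: "s \<in> S" "s < s0 + \<eta>"
    using cInf_lessD[OF Sne, of "s0 + \<eta>"] \<eta>(1) unfolding s0_def by auto
  have s0s: "s0 \<le> s" unfolding s0_def by (rule cInf_lower[OF s(1) Sbd])
  \<comment> \<open>\<open>s - \<eta>\<close> lies below the threshold \<open>s0\<close>, so this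
    shift is not entanglement breaking; \<open>\<eta> < s0\<close> keeps it nonnegative, as
    membership in \<open>S\<close> demands.\<close>
  define P where "P = shift (s - \<eta>)"
  have P: "P v = shift s v - (\<eta> * (f \<bullet> v)) *\<^sub>R e" for v
    by (simp add: P_def shift_def algebra_simps)
  have linP: "linear P"
  proof -
    have "linear (\<lambda>v. R v + (f \<bullet> v) *\<^sub>R ((s - \<eta>) *\<^sub>R e))"
      by (intro linear_compose_add R linear_rank_one)
    then show ?thesis by (simp add: P_def shift_def[abs_def] mult.commute)
  qed
  obtain n x d where Q: "\<forall>i<n. x i \<in> C2 \<and> d i \<in> span_dual C1" "shift s = (\<lambda>v. \<Sum>i<(n::nat). (d i \<bullet> v) *\<^sub>R x i)"
    using s(1) entanglement_breakingE[OF _ s1, of C2 "shift s"] unfolding S_def by blast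
  have fy: "0 \<le> f \<bullet> y" if "y \<in> C1" for y by (rule span_dualD(1)[OF fC that])
  have lower: "shift s y - (s0 * (f \<bullet> y)) *\<^sub>R e \<in> C2" if y: "y \<in> C1" for y
  proof -
    have "shift s y - (s0 * (f \<bullet> y)) *\<^sub>R e = R y + ((s - s0) * (f \<bullet> y)) *\<^sub>R e"
      by (simp add: shift_def algebra_simps)
    also have "\<dots> \<in> C2"
      using s0s fy[OF y] by (intro pointed_cone_add[OF p2] RC y pointed_cone_scale[OF p2] eC) auto
    finally show ?thesis .
  qed
  have upper: "(D * (f \<bullet> y)) *\<^sub>R e - shift s y \<in> C2" if y: "y \<in> C1" for y
  proof -
    let ?t = "K / (\<mu> * m) * (f \<bullet> y)"
    have "norm (- R y) \<le> K * norm y" using K(1) by simp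
    also have "\<dots> = K / \<mu> * (\<mu> * norm y)" using \<mu>(1) by simp
    also have "\<dots> \<le> K / \<mu> * (f \<bullet> y)" using \<mu> K(2) y by (intro mult_left_mono) auto
    also have "\<dots> = ?t * m" using m \<mu>(1) by simp
    finally have "?t *\<^sub>R e + - R y \<in> C2" using order_unit_absorbs[OF p2 m e] by blast
    moreover have "((s0 + 1 - s) * (f \<bullet> y)) *\<^sub>R e \<in> C2"
      using s(2) \<eta>(3) fy[OF y] by (intro pointed_cone_scale[OF p2] eC) auto
    ultimately have "(?t *\<^sub>R e + - R y) + ((s0 + 1 - s) * (f \<bullet> y)) *\<^sub>R e \<in> C2"
      by (rule pointed_cone_add[OF p2])
    moreover have "(?t *\<^sub>R e + - R y) + ((s0 + 1 - s) * (f \<bullet> y)) *\<^sub>R e = (D * (f \<bullet> y)) *\<^sub>R e - shift s y"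
      by (simp only: shift_def D_def) (simp add: algebra_simps)
    ultimately show ?thesis by simp
  qed
  have "tensor_map P t \<in> min_power C2 k" if "t \<in> max_power C1 k" for t
    unfolding k
    by (rule tensor_power_in_min_power[OF p1 s1 p2 eC fC, where Q = "shift s" and n = n and d = d and x = x
          and c = s0 and D = D and \<eta> = \<eta>])
      (use Q lower upper s0 D \<eta> P small that in \<open>simp_all add: k del: max_power.simps power_Suc\<close>)
  moreover have "\<not> entanglement_breaking C1 C2 P"
  proof
    assume "entanglement_breaking C1 C2 P"
    then have "s - \<eta> \<in> S" using s0s \<eta>(2) by (simp add: S_def P_def)
    then have "s0 \<le> s - \<eta>" unfolding s0_def by (rule cInf_lower[OF _ Sbd])
    then show False using s(2) by simp
  qed
  ultimately show ?thesis using linP by blast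
qed

end
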